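(* Let $\omega_1,\omega_2\in\mathbb{C}$ be half-periods that are not colinear (linearly independent over $\mathbb{R}$), let $L_\omega = 2\omega_1\mathbb{Z}+2\omega_2\mathbb{Z}$ and $\mathbb{T}_\omega=\mathbb{C}/L_\omega$. Let $b\ge 1$ be an integer, let $K_1,\dots,K_b\subset \mathbb{T}_\omega$ be disjoint, connected compact sets with smooth boundary, and let $\Omega=\mathbb{T}_\omega\setminus\bigcup_{j=1}^b K_j$. Let $\mathcal{P}=\{2\omega_1x+2\omega_2y\in\mathbb{C} : (x,y)\in[0,1]^2\}\setminus\bigcup_{j=1}^b K_j$ be the corresponding fundamental parallelogram with the sets $K_j$ removed. For each $j\in\{1,\dots,b\}$ let $a_j$ be a point in $K_j$. If $u$ is a harmonic function on $\Omega$ (equivalently, harmonic and doubly-periodic on $\mathcal{P}$), then there exist an analytic function $\hat f$ on $\mathcal{P}$ and real numbers $c_1,\dots,c_b$ satisfying $\sum_{j=1}^b c_j=0$, such that $\hat f'$ is elliptic and $$u(z)=\Re \hat f(z)+\sum_{j=1}^b c_j\log|\hat\sigma(z-a_j,\omega)|,\qquad z\in\Omega,$$ where $\hat\sigma$ is the modified Weierstrass sigma function. If there is only one connected boundary component (i.e. $b=1$), then $c_1=0$ and $u(z)=\Re\hat f(z)$.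
   Context: Write $\omega=(\omega_1,\omega_2)$ and $z^*$ for the complex conjugate of $z$. Harmonic functions are real-valued. Points and subsets of $\mathbb{T}_\omega$ are identified with representatives in $\mathbb{C}$; $\Omega$ is obtained from $\mathcal{P}$ by identifying opposite sides. A function $f$ is doubly-periodic if $f(z+2\omega_1)=f(z)$ and $f(z+2\omega_2)=f(z)$ for all $z$. A function is elliptic if it is meromorphic and doubly-periodic. Weierstrass functions for $L_\omega$: the Weierstrass zeta function is $$\zeta(z)=\frac1z+\sum_{\ell\in L_\omega\setminus\{0\}}\left(\frac1{z-\ell}+\frac1\ell+\frac z{\ell^2}\right),$$ and the Weierstrass sigma function is the holomorphic function $$\sigma(z,\omega)=\lim_{\varepsilon\to0}\varepsilon\exp\left(\int_\varepsilon^z\zeta(w)\,dw\right),$$ which satisfies $\sigma'/\sigma=\zeta$ and has simple zeros at the lattice points. Let $A$ be the area of $\mathbb{T}_\omega$, and let $\gamma_2=\gamma_2(\omega)\in\mathbb{C}$ be the lattice invariant satisfying $\zeta(\omega_i)=\gamma_2\omega_i+\pi\omega_i^*/A$ for $i=1,2$. The modified Weierstrass sigma function is $$\hat\sigma(z,\omega)=e^{-\frac12\gamma_2z^2-\frac12\pi|z|^2/A}\,\sigma(z,\omega).$$ It is not holomorphic, but $|\hat\sigma(z,\omega)|$ is doubly-periodic. *)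

theory Defs
  imports "HOL-Complex_Analysis.Complex_Analysis"
begin

text \<open>Throughout, \<open>\<omega>\<^sub>1\<close> and \<open>\<omega>\<^sub>2\<close> are half-periods.\<close>

definition period_lattice :: "complex \<Rightarrow> complex \<Rightarrow> complex set" where
  "period_lattice \<omega>\<^sub>1 \<omega>\<^sub>2 =
     {2 * \<omega>\<^sub>1 * of_int m + 2 * \<omega>\<^sub>2 * of_int n | m n. True}"

definition torus_proj :: "complex \<Rightarrow> complex \<Rightarrow> complex \<Rightarrow> complex set" where
  "torus_proj \<omega>\<^sub>1 \<omega>\<^sub>2 z = {w. w - z \<in> period_lattice \<omega>\<^sub>1 \<omega>\<^sub>2}"

text \<open>A point of the torus is a coset of the period lattice; the topology is the quotient
  topology.\<close>

definition torus :: "complex \<Rightarrow> complex \<Rightarrow> complex set topology" where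
  "torus \<omega>\<^sub>1 \<omega>\<^sub>2 = topology (\<lambda>U. U \<subseteq> range (torus_proj \<omega>\<^sub>1 \<omega>\<^sub>2) \<and>
                                 open (torus_proj \<omega>\<^sub>1 \<omega>\<^sub>2 -` U))"

lemma openin_torus:
  "openin (torus \<omega>\<^sub>1 \<omega>\<^sub>2) U \<longleftrightarrow>
     U \<subseteq> range (torus_proj \<omega>\<^sub>1 \<omega>\<^sub>2) \<and> open (torus_proj \<omega>\<^sub>1 \<omega>\<^sub>2 -` U)"
proof -
  have "istopology (\<lambda>U. U \<subseteq> range (torus_proj \<omega>\<^sub>1 \<omega>\<^sub>2) \<and> open (torus_proj \<omega>\<^sub>1 \<omega>\<^sub>2 -` U))"
    unfolding istopology_def by (auto simp: vimage_Union)
  then show ?thesis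
    by (simp add: torus_def topology_inverse')
qed

lemma topspace_torus: "topspace (torus \<omega>\<^sub>1 \<omega>\<^sub>2) = range (torus_proj \<omega>\<^sub>1 \<omega>\<^sub>2)"
proof
  show "topspace (torus \<omega>\<^sub>1 \<omega>\<^sub>2) \<subseteq> range (torus_proj \<omega>\<^sub>1 \<omega>\<^sub>2)"
    using openin_topspace openin_torus by blast
  have "torus_proj \<omega>\<^sub>1 \<omega>\<^sub>2 -` range (torus_proj \<omega>\<^sub>1 \<omega>\<^sub>2) = UNIV"
    by auto
  then have "openin (torus \<omega>\<^sub>1 \<omega>\<^sub>2) (range (torus_proj \<omega>\<^sub>1 \<omega>\<^sub>2))"
    by (simp add: openin_torus)
  then show "range (torus_proj \<omega>\<^sub>1 \<omega>\<^sub>2) \<subseteq> topspace (torus \<omega>\<^sub>1 \<omega>\<^sub>2)"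
    by (rule openin_subset)
qed

lemma quotient_map_torus_proj:
  "quotient_map euclidean (torus \<omega>\<^sub>1 \<omega>\<^sub>2) (torus_proj \<omega>\<^sub>1 \<omega>\<^sub>2)"
  by (auto simp: quotient_map_def topspace_torus openin_torus vimage_def)

definition parallelogram :: "complex \<Rightarrow> complex \<Rightarrow> complex set" where
  "parallelogram \<omega>\<^sub>1 \<omega>\<^sub>2 =
     {2 * \<omega>\<^sub>1 * of_real x + 2 * \<omega>\<^sub>2 * of_real y | x y. x \<in> {0..1} \<and> y \<in> {0..1}}"

definition torus_area :: "complex \<Rightarrow> complex \<Rightarrow> real" where
  "torus_area \<omega>\<^sub>1 \<omega>\<^sub>2 = measure lebesgue (parallelogram \<omega>\<^sub>1 \<omega>\<^sub>2)"

text \<open>A set has smooth boundary if near each boundary point \<open>p\<close>, in orthonormal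
  coordinates \<open>(x, y)\<close> centred at \<open>p\<close>, it is the region below the graph of a
  \<open>C\<^sup>\<infinity>\<close> function. The projection to the torus is a local isometry, so for a subset
  of the torus this is a condition on its full preimage in the plane.\<close>

definition smooth_real_fun :: "(real \<Rightarrow> real) \<Rightarrow> bool" where
  "smooth_real_fun h \<longleftrightarrow> (\<forall>n x. ((deriv ^^ n) h) differentiable (at x))"

definition smooth_boundary :: "complex set \<Rightarrow> bool" where
  "smooth_boundary S \<longleftrightarrow>
     (\<forall>p \<in> frontier S. \<exists>r e h. r > 0 \<and> cmod e = 1 \<and> smooth_real_fun h \<and>
        (\<forall>x y. p + e * Complex x y \<in> ball p r \<longrightarrow>
                 (p + e * Complex x y \<in> S \<longleftrightarrow> y \<le> h x)))"

definition torus_smooth_boundary :: "complex \<Rightarrow> complex \<Rightarrow> complex set set \<Rightarrow> bool" where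
  "torus_smooth_boundary \<omega>\<^sub>1 \<omega>\<^sub>2 K \<longleftrightarrow> smooth_boundary (torus_proj \<omega>\<^sub>1 \<omega>\<^sub>2 -` K)"

definition partial_x :: "(complex \<Rightarrow> real) \<Rightarrow> complex \<Rightarrow> real" where
  "partial_x u z = deriv (\<lambda>t. u (z + of_real t)) 0"

definition partial_y :: "(complex \<Rightarrow> real) \<Rightarrow> complex \<Rightarrow> real" where
  "partial_y u z = deriv (\<lambda>t. u (z + \<i> * of_real t)) 0"

definition C1_fun_on :: "(complex \<Rightarrow> real) \<Rightarrow> complex set \<Rightarrow> bool" where
  "C1_fun_on u S \<longleftrightarrow> u differentiable_on S \<and>
     continuous_on S (partial_x u) \<and> continuous_on S (partial_y u)"

definition harmonic_on :: "(complex \<Rightarrow> real) \<Rightarrow> complex set \<Rightarrow> bool" where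
  "harmonic_on u S \<longleftrightarrow> open S \<and>
     C1_fun_on u S \<and> C1_fun_on (partial_x u) S \<and> C1_fun_on (partial_y u) S \<and>
     (\<forall>z \<in> S. partial_x (partial_x u) z + partial_y (partial_y u) z = 0)"

text \<open>The projection is a local isometry, so harmonicity on an open subset of the torus is
  harmonicity of the lift to the plane.\<close>

definition torus_harmonic_on ::
    "complex \<Rightarrow> complex \<Rightarrow> (complex set \<Rightarrow> real) \<Rightarrow> complex set set \<Rightarrow> bool" where
  "torus_harmonic_on \<omega>\<^sub>1 \<omega>\<^sub>2 u \<Omega> \<longleftrightarrow>
     harmonic_on (u \<circ> torus_proj \<omega>\<^sub>1 \<omega>\<^sub>2) (torus_proj \<omega>\<^sub>1 \<omega>\<^sub>2 -` \<Omega>)"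

definition doubly_periodic_on ::
    "complex \<Rightarrow> complex \<Rightarrow> (complex \<Rightarrow> complex) \<Rightarrow> complex set \<Rightarrow> bool" where
  "doubly_periodic_on \<omega>\<^sub>1 \<omega>\<^sub>2 g D \<longleftrightarrow>
     (\<forall>z \<in> D. z + 2 * \<omega>\<^sub>1 \<in> D \<and> z + 2 * \<omega>\<^sub>2 \<in> D \<and>
              g (z + 2 * \<omega>\<^sub>1) = g z \<and> g (z + 2 * \<omega>\<^sub>2) = g z)"

definition elliptic_on ::
    "complex \<Rightarrow> complex \<Rightarrow> (complex \<Rightarrow> complex) \<Rightarrow> complex set \<Rightarrow> bool" where
  "elliptic_on \<omega>\<^sub>1 \<omega>\<^sub>2 g D \<longleftrightarrow> g meromorphic_on D \<and> doubly_periodic_on \<omega>\<^sub>1 \<omega>\<^sub>2 g D"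

definition weierstrass_zeta :: "complex \<Rightarrow> complex \<Rightarrow> complex \<Rightarrow> complex" where
  "weierstrass_zeta \<omega>\<^sub>1 \<omega>\<^sub>2 z =
     1 / z + (\<Sum>\<^sub>\<infinity>l \<in> period_lattice \<omega>\<^sub>1 \<omega>\<^sub>2 - {0}. 1 / (z - l) + 1 / l + z / l\<^sup>2)"

text \<open>\<open>\<sigma>(z) = lim \<epsilon> exp (\<integral>\<^sub>\<epsilon>\<^sup>z \<zeta>(w) dw)\<close> as \<open>\<epsilon> \<rightarrow> 0\<close>. The integral is taken along
  any path from \<open>\<epsilon>\<close> to \<open>z\<close> that avoids the poles of \<open>\<zeta>\<close>; as all residues of \<open>\<zeta>\<close> are
  \<open>1\<close>, the exponential does not depend on the path. At the lattice points the
  integral diverges, and \<open>\<sigma>\<close> takes the value \<open>0\<close> of its holomorphic extension.\<close>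

definition weierstrass_sigma :: "complex \<Rightarrow> complex \<Rightarrow> complex \<Rightarrow> complex" where
  "weierstrass_sigma \<omega>\<^sub>1 \<omega>\<^sub>2 z =
     (if z \<in> period_lattice \<omega>\<^sub>1 \<omega>\<^sub>2 then 0
      else Lim (at 0) (\<lambda>\<epsilon>. \<epsilon> * exp (contour_integral
             (SOME \<gamma>. valid_path \<gamma> \<and> pathstart \<gamma> = \<epsilon> \<and> pathfinish \<gamma> = z \<and>
                      path_image \<gamma> \<inter> period_lattice \<omega>\<^sub>1 \<omega>\<^sub>2 = {})
             (weierstrass_zeta \<omega>\<^sub>1 \<omega>\<^sub>2))))"

text \<open>Existence of \<open>\<gamma>\<^sub>2\<close> is the Legendre relation; uniqueness is clear as \<open>\<omega>\<^sub>1 \<noteq> 0\<close>.\<close>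

definition gamma2 :: "complex \<Rightarrow> complex \<Rightarrow> complex" where
  "gamma2 \<omega>\<^sub>1 \<omega>\<^sub>2 = (THE g. \<forall>\<omega> \<in> {\<omega>\<^sub>1, \<omega>\<^sub>2}.
     weierstrass_zeta \<omega>\<^sub>1 \<omega>\<^sub>2 \<omega> = g * \<omega> + of_real pi * cnj \<omega> / of_real (torus_area \<omega>\<^sub>1 \<omega>\<^sub>2))"

definition modified_sigma :: "complex \<Rightarrow> complex \<Rightarrow> complex \<Rightarrow> complex" where
  "modified_sigma \<omega>\<^sub>1 \<omega>\<^sub>2 z =
     exp (- (1/2) * gamma2 \<omega>\<^sub>1 \<omega>\<^sub>2 * z\<^sup>2
          - of_real (1/2 * pi * (cmod z)\<^sup>2 / torus_area \<omega>\<^sub>1 \<omega>\<^sub>2))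
     * weierstrass_sigma \<omega>\<^sub>1 \<omega>\<^sub>2 z"

end

theory Submission
  imports Defs
begin

text \<open>The Wirtinger derivative \<open>g = u\<^sub>x - \<i> u\<^sub>y\<close> of the lift of \<open>u\<close> is holomorphic and doubly periodic on the
  preimage \<open>D\<close> of \<open>\<Omega>\<close>. It suffices to find real \<open>c\<^sub>j\<close> with sum zero such that \<open>g - \<Sum> c\<^sub>j \<zeta>(z - a\<^sub>j)\<close> has vanishing
  periods in \<open>D\<close>: this function is again doubly periodic, and after subtracting a suitable constant its primitive is \<open>f\<close>.
  As \<open>\<zeta>\<close> has residue \<open>1\<close> at every lattice point, the condition on a loop \<open>\<gamma>\<close> in \<open>D\<close> reads
  \<open>\<integral>\<^sub>\<gamma> g = 2\<pi>\<i> \<Sum> c\<^sub>j W\<^sub>\<gamma>(a\<^sub>j)\<close>, where \<open>W\<^sub>\<gamma>(p)\<close> is the sum of the winding numbers of \<open>\<gamma>\<close> around the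
  translates of \<open>p\<close>. The function \<open>W\<^sub>\<gamma>\<close> is periodic and locally constant off the translates of \<open>\<gamma>\<close>, hence constant on
  each \<open>K\<^sub>j\<close>.

  Subdivide the plane into small cells that are parallelograms with sides \<open>2\<omega>\<^sub>1/N\<close> and \<open>2\<omega>\<^sub>2/N\<close>. Let \<open>R(Q)\<close> be the integral of
  \<open>g\<close> along those edges of the cell \<open>Q\<close> that lie in \<open>D\<close>. Cauchy's formula summed over all cells shows
  that \<open>\<integral>\<^sub>\<gamma> g\<close> is, up to orientation, the sum of \<open>R(Q)\<close> times the winding number of \<open>\<gamma>\<close> around a point
  of \<open>Q\<close> outside \<open>D\<close>. Collecting the cells modulo the lattice according to the \<open>K\<^sub>j\<close> they meet gives the \<open>c\<^sub>j\<close>, and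
  their sum vanishes because the edges cancel on the torus. The mesh must be fine compared with
  the distance of \<open>\<gamma>\<close> from the complement of \<open>D\<close>, so this yields the \<open>c\<^sub>j\<close> only for finitely many loops at a time; since
  the conditions are linear in finitely many unknowns, solvability of all finite
  subsystems suffices.\<close>

section \<open>Harmonic functions\<close>

text \<open>A real-linear map of the plane is determined by its values at 1 and \<open>\<i>\<close>;
  the chain rule along the two coordinate lines identifies these values with the partial
  derivatives.\<close>

lemma has_derivative_partials:
  assumes "u differentiable (at z)"
  shows "(u has_derivative (\<lambda>h. Re h * partial_x u z + Im h * partial_y u z)) (at z)"
proof -
  obtain u' where u': "(u has_derivative u') (at z)"
    using assms by (auto simp: differentiable_def)
  interpret bounded_linear u' using u' by (rule has_derivative_bounded_linear)
  have "((\<lambda>t. u (z + of_real t)) has_derivative (\<lambda>t. u' (of_real t))) (at 0)"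
    by (rule has_derivative_compose[of "\<lambda>t. z + of_real t" "\<lambda>t. of_real t" 0 UNIV u u', simplified])
      (auto intro!: derivative_eq_intros u')
  moreover have "(\<lambda>t::real. u' (of_real t)) = (\<lambda>t. u' 1 * t)"
  proof
    show "u' (of_real t) = u' 1 * t" for t
      using scaleR[of t 1] by (simp add: scaleR_conv_of_real)
  qed
  ultimately have "((\<lambda>t. u (z + of_real t)) has_real_derivative u' 1) (at 0)"
    by (simp add: has_field_derivative_def)
  then have x: "partial_x u z = u' 1" unfolding partial_x_def by (rule DERIV_imp_deriv)
  have "((\<lambda>t. u (z + \<i> * of_real t)) has_derivative (\<lambda>t. u' (\<i> * of_real t))) (at 0)"
    by (rule has_derivative_compose[of "\<lambda>t. z + \<i> * of_real t" "\<lambda>t. \<i> * of_real t" 0 UNIV u u', simplified])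
      (auto intro!: derivative_eq_intros u')
  moreover have "(\<lambda>t::real. u' (\<i> * of_real t)) = (\<lambda>t. u' \<i> * t)"
  proof
    show "u' (\<i> * of_real t) = u' \<i> * t" for t
      using scaleR[of t \<i>] by (simp add: scaleR_conv_of_real mult.commute)
  qed
  ultimately have "((\<lambda>t. u (z + \<i> * of_real t)) has_real_derivative u' \<i>) (at 0)"
    by (simp add: has_field_derivative_def)
  then have y: "partial_y u z = u' \<i>" unfolding partial_y_def by (rule DERIV_imp_deriv)
  have "u' h = Re h * partial_x u z + Im h * partial_y u z" for h
  proof -
    have "h = Re h *\<^sub>R 1 + Im h *\<^sub>R \<i>" by (simp add: complex_eq_iff)
    then have "u' h = u' (Re h *\<^sub>R 1) + u' (Im h *\<^sub>R \<i>)" by (metis add)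
    then show ?thesis by (simp add: scaleR x y del: scaleR_one)
  qed
  then have "u' = (\<lambda>h. Re h * partial_x u z + Im h * partial_y u z)" by (rule ext)
  then show ?thesis using u' by simp
qed

lemma has_real_derivative_along:
  assumes "u differentiable (at (z + of_real t * v))"
  shows "((\<lambda>t. u (z + of_real t * v)) has_real_derivative
           Re v * partial_x u (z + of_real t * v) + Im v * partial_y u (z + of_real t * v)) (at t)"
proof -
  have "((\<lambda>t. u (z + of_real t * v)) has_derivative
     (\<lambda>s. Re (of_real s * v) * partial_x u (z + of_real t * v)
        + Im (of_real s * v) * partial_y u (z + of_real t * v))) (at t)"
    by (rule has_derivative_compose[of "\<lambda>t. z + of_real t * v" "\<lambda>t. of_real t * v" t UNIV u, simplified])
      (use has_derivative_partials[OF assms] in \<open>auto intro!: derivative_eq_intros\<close>)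
  then show ?thesis
    by (rule has_derivative_imp_has_field_derivative) (simp add: algebra_simps)
qed

text \<open>Both mixed partials are limits of the same second difference quotient, rewritten by two
  applications of the mean value theorem.\<close>

lemma second_difference_mvt:
  assumes "0 < h" and diff: "\<And>s t. \<lbrakk>0 \<le> s; s \<le> h; 0 \<le> t; t \<le> h\<rbrakk> \<Longrightarrow> u differentiable (at (z + of_real s * v + of_real t * w))"
    and diff': "\<And>s t. \<lbrakk>0 \<le> s; s \<le> h; 0 \<le> t; t \<le> h\<rbrakk> \<Longrightarrow> p differentiable (at (z + of_real s * v + of_real t * w))"
    and p: "\<And>x. p x = Re v * partial_x u x + Im v * partial_y u x"
  shows "\<exists>s t. 0 < s \<and> s < h \<and> 0 < t \<and> t < h \<and>
    u (z + of_real h * v + of_real h * w) - u (z + of_real h * v) - u (z + of_real h * w) + u z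
     = h\<^sup>2 * (Re w * partial_x p (z + of_real s * v + of_real t * w)
            + Im w * partial_y p (z + of_real s * v + of_real t * w))"
proof -
  \<comment> \<open>The difference is taken in direction \<open>w\<close> while the argument moves
    along \<open>v\<close>, so the derivative of \<open>\<phi>\<close> is a difference of two values
    of \<open>p\<close>.\<close>
  define \<phi> where "\<phi> s = u (z + of_real h * w + of_real s * v) - u (z + of_real s * v)" for s
  have "\<exists>s>0. s < h \<and> \<phi> h - \<phi> 0 = (h - 0) * (p (z + of_real h * w + of_real s * v) - p (z + of_real s * v))"
  proof (rule MVT2)
    show "(\<phi> has_real_derivative p (z + of_real h * w + of_real s * v) - p (z + of_real s * v)) (at s)"
      if "0 \<le> s" "s \<le> h" for s
      unfolding \<phi>_def p
      using diff[of s h] diff[of s 0] that \<open>0 < h\<close>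
      by (intro DERIV_diff has_real_derivative_along) (auto simp: add_ac)
  qed (use assms in auto)
  then obtain s where s: "0 < s" "s < h"
    "\<phi> h - \<phi> 0 = h * (p (z + of_real h * w + of_real s * v) - p (z + of_real s * v))" by auto
  define \<psi> where "\<psi> t = p ((z + of_real s * v) + of_real t * w)" for t
  have "\<exists>t>0. t < h \<and> \<psi> h - \<psi> 0 = (h - 0) * (Re w * partial_x p (z + of_real s * v + of_real t * w)
            + Im w * partial_y p (z + of_real s * v + of_real t * w))"
  proof (rule MVT2)
    show "(\<psi> has_real_derivative (Re w * partial_x p (z + of_real s * v + of_real t * w)
            + Im w * partial_y p (z + of_real s * v + of_real t * w))) (at t)"
      if "0 \<le> t" "t \<le> h" for t
      unfolding \<psi>_def using diff'[of s t] that s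
      by (intro has_real_derivative_along) auto
  qed (use assms in auto)
  then obtain t where t: "0 < t" "t < h" "\<psi> h - \<psi> 0 = h * (Re w * partial_x p (z + of_real s * v + of_real t * w)
            + Im w * partial_y p (z + of_real s * v + of_real t * w))" by auto
  have "u (z + of_real h * v + of_real h * w) - u (z + of_real h * v) - u (z + of_real h * w) + u z = \<phi> h - \<phi> 0"
    by (simp add: \<phi>_def add_ac)
  also have "\<dots> = h * (\<psi> h - \<psi> 0)"
    using s by (simp add: \<psi>_def add_ac)
  finally show ?thesis
    using s t by (intro exI[of _ s] exI[of _ t]) (simp add: power2_eq_square)
qed

text \<open>Schwarz's theorem by contradiction: by continuity, both mixed partials stay near
  \<open>z\<close> within half of their gap at \<open>z\<close>. But the second difference over a
  small square is \<open>h\<^sup>2\<close> times a value of either one, which forces two such values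
  to coincide.\<close>

lemma mixed_partials_eq:
  assumes "open S" "z \<in> S" "C1_fun_on u S" "C1_fun_on (partial_x u) S" "C1_fun_on (partial_y u) S"
  shows "partial_y (partial_x u) z = partial_x (partial_y u) z"
proof (rule ccontr)
  assume neq: "\<not> ?thesis"
  define e where "e = \<bar>partial_y (partial_x u) z - partial_x (partial_y u) z\<bar> / 2"
  have e: "e > 0" using neq by (simp add: e_def)
  have diff: "f differentiable (at x)" if "x \<in> S" "C1_fun_on f S" for f x
    using that assms(1) by (simp add: C1_fun_on_def differentiable_on_eq_differentiable_at)
  have cont: "isCont (partial_y (partial_x u)) z" "isCont (partial_x (partial_y u)) z"
    using assms by (auto simp: C1_fun_on_def continuous_on_eq_continuous_at)
  obtain d0 where d0: "d0 > 0" "ball z d0 \<subseteq> S" using assms openE by blast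
  obtain d1 where d1: "d1 > 0" "\<And>x. dist x z < d1 \<Longrightarrow> dist (partial_y (partial_x u) x) (partial_y (partial_x u) z) < e"
    using cont(1) e by (auto simp: continuous_at_eps_delta)
  obtain d2 where d2: "d2 > 0" "\<And>x. dist x z < d2 \<Longrightarrow> dist (partial_x (partial_y u) x) (partial_x (partial_y u) z) < e"
    using cont(2) e by (auto simp: continuous_at_eps_delta)
  \<comment> \<open>Points of the square lie within \<open>2 * h\<close> of \<open>z\<close>;
    dividing by 3 keeps this strictly below all three radii.\<close>
  define h where "h = min d0 (min d1 d2) / 3"
  have h: "h > 0" "2 * h < d0" "2 * h < d1" "2 * h < d2" using d0 d1 d2 by (auto simp: h_def)
  have near: "dist (z + of_real s * v + of_real t * w) z \<le> 2 * h"
    if "0 \<le> s" "s \<le> h" "0 \<le> t" "t \<le> h" "cmod v = 1" "cmod w = 1" for s t v w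
  proof -
    have "cmod (of_real s * v + of_real t * w) \<le> s * 1 + t * 1"
      using that by (intro norm_triangle_le add_mono) (auto simp: norm_mult)
    then show ?thesis using that by (simp add: dist_norm)
  qed
  have inS: "z + of_real s * v + of_real t * w \<in> S"
    if "0 \<le> s" "s \<le> h" "0 \<le> t" "t \<le> h" "cmod v = 1" "cmod w = 1" for s t v w
    using near[OF that] d0 h by (auto simp: dist_commute subset_iff)
  obtain s t where st: "0 < s" "s < h" "0 < t" "t < h"
    "u (z + of_real h * 1 + of_real h * \<i>) - u (z + of_real h * 1) - u (z + of_real h * \<i>) + u z
     = h\<^sup>2 * partial_y (partial_x u) (z + of_real s * 1 + of_real t * \<i>)"
    using second_difference_mvt[of h u z 1 \<i> "partial_x u", OF h(1) diff[OF inS assms(3)] diff[OF inS assms(4)]]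
    by auto
  obtain s' t' where st': "0 < s'" "s' < h" "0 < t'" "t' < h"
    "u (z + of_real h * \<i> + of_real h * 1) - u (z + of_real h * \<i>) - u (z + of_real h * 1) + u z
     = h\<^sup>2 * partial_x (partial_y u) (z + of_real s' * \<i> + of_real t' * 1)"
    using second_difference_mvt[of h u z \<i> 1 "partial_y u", OF h(1) diff[OF inS assms(3)] diff[OF inS assms(5)]]
    by auto
  have "h\<^sup>2 * partial_y (partial_x u) (z + of_real s * 1 + of_real t * \<i>)
      = h\<^sup>2 * partial_x (partial_y u) (z + of_real s' * \<i> + of_real t' * 1)"
    unfolding st(5)[symmetric] st'(5)[symmetric] by (simp add: add_ac)
  then have eq: "partial_y (partial_x u) (z + of_real s * 1 + of_real t * \<i>)
      = partial_x (partial_y u) (z + of_real s' * \<i> + of_real t' * 1)" using h by simp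
  have "dist (partial_y (partial_x u) (z + of_real s * 1 + of_real t * \<i>)) (partial_y (partial_x u) z) < e"
    using near[of s t 1 \<i>] st h by (intro d1) auto
  moreover have "dist (partial_x (partial_y u) (z + of_real s' * \<i> + of_real t' * 1)) (partial_x (partial_y u) z) < e"
    using near[of s' t' \<i> 1] st' h by (intro d2) auto
  ultimately show False
    unfolding eq e_def dist_real_def by argo
qed

text \<open>Twice the usual operator d/dz, so that the real part of a holomorphic function f is sent
  to f' itself.\<close>

definition wirtinger_deriv :: "(complex \<Rightarrow> real) \<Rightarrow> complex \<Rightarrow> complex" where
  "wirtinger_deriv u z = Complex (partial_x u z) (- partial_y u z)"

text \<open>One Cauchy-Riemann equation is the symmetry of the mixed partials, the other is
  Laplace's equation.\<close>

lemma harmonic_on_imp_holomorphic: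
  assumes "harmonic_on u S"
  shows "wirtinger_deriv u holomorphic_on S"
proof -
  have S: "open S" and C: "C1_fun_on u S" "C1_fun_on (partial_x u) S" "C1_fun_on (partial_y u) S"
    and lap: "\<And>z. z \<in> S \<Longrightarrow> partial_x (partial_x u) z + partial_y (partial_y u) z = 0"
    using assms by (auto simp: harmonic_on_def)
  have "wirtinger_deriv u field_differentiable (at z)" if z: "z \<in> S" for z
  proof -
    let ?p = "partial_x u" and ?q = "partial_y u"
    have d: "?p differentiable (at z)" "?q differentiable (at z)"
      using C z S by (simp_all add: C1_fun_on_def differentiable_on_eq_differentiable_at)
    have eq: "partial_x ?q z = partial_y ?p z" "partial_y ?q z = - partial_x ?p z"
      using mixed_partials_eq[OF S z C] lap[OF z] by auto
    have "((\<lambda>z. of_real (?p z) - \<i> * of_real (?q z)) has_derivative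
       (\<lambda>h. of_real (Re h * partial_x ?p z + Im h * partial_y ?p z) -
            \<i> * of_real (Re h * partial_x ?q z + Im h * partial_y ?q z))) (at z)"
      by (intro has_derivative_diff has_derivative_mult_right has_derivative_of_real
          has_derivative_partials d)
    moreover have "(\<lambda>h. of_real (Re h * partial_x ?p z + Im h * partial_y ?p z) -
            \<i> * of_real (Re h * partial_x ?q z + Im h * partial_y ?q z)) =
         (*) (Complex (partial_x ?p z) (- partial_y ?p z))"
      by (rule ext) (simp add: complex_eq_iff eq algebra_simps)
    moreover have "(\<lambda>z. of_real (?p z) - \<i> * of_real (?q z)) = wirtinger_deriv u"
      by (rule ext) (simp add: wirtinger_deriv_def complex_eq_iff)
    ultimately have "(wirtinger_deriv u has_field_derivative Complex (partial_x ?p z) (- partial_y ?p z)) (at z)"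
      by (simp add: has_field_derivative_def)
    then show ?thesis by (auto simp: field_differentiable_def)
  qed
  then show ?thesis
    by (simp add: holomorphic_on_open[OF S] field_differentiable_def)
qed

text \<open>The differential of \<open>u\<close> at \<open>z\<close> sends \<open>h\<close> to
  \<open>Re (?g z * h)\<close>, so the real part of the integrand is the derivative of
  \<open>u\<close> along the path, off finitely many corners. In particular, the periods of the
  Wirtinger derivative are purely imaginary.\<close>

lemma harmonic_on_contour_integral:
  assumes u: "harmonic_on u S" and \<gamma>: "valid_path \<gamma>" "path_image \<gamma> \<subseteq> S"
  shows "Re (contour_integral \<gamma> (wirtinger_deriv u)) = u (pathfinish \<gamma>) - u (pathstart \<gamma>)"
proof -
  let ?g = "wirtinger_deriv u"
  have S: "open S" using u by (simp add: harmonic_on_def)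
  have "?g contour_integrable_on \<gamma>"
    using contour_integrable_holomorphic_simple[OF harmonic_on_imp_holomorphic[OF u] S] \<gamma> by blast
  then have "((\<lambda>t. ?g (\<gamma> t) * vector_derivative \<gamma> (at t within {0..1})) has_integral contour_integral \<gamma> ?g) {0..1}"
    using has_contour_integral_integral by (auto simp: has_contour_integral_def)
  then have 1: "((\<lambda>t. Re (?g (\<gamma> t) * vector_derivative \<gamma> (at t within {0..1}))) has_integral Re (contour_integral \<gamma> ?g)) {0..1}"
    by (rule has_integral_Re)
  obtain T where T: "finite T" "\<gamma> C1_differentiable_on ({0..1} - T)" and cont: "continuous_on {0..1} \<gamma>"
    using \<gamma> by (auto simp: valid_path_def piecewise_C1_differentiable_on_def)
  have du: "(u has_derivative (\<lambda>h. Re (?g z * h))) (at z)" if "z \<in> S" for z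
  proof -
    have "u differentiable (at z)"
      using u that S by (simp add: harmonic_on_def C1_fun_on_def differentiable_on_eq_differentiable_at)
    from has_derivative_partials[OF this] show ?thesis
      by (simp add: wirtinger_deriv_def mult.commute)
  qed
  have "((\<lambda>t. Re (?g (\<gamma> t) * vector_derivative \<gamma> (at t within {0..1}))) has_integral u (\<gamma> 1) - u (\<gamma> 0)) {0..1}"
  proof (rule fundamental_theorem_of_calculus_interior_strong[OF T(1), where f = "\<lambda>t. u (\<gamma> t)"])
    have "continuous_on S u"
      using u by (auto simp: harmonic_on_def C1_fun_on_def intro: differentiable_imp_continuous_on)
    then show "continuous_on {0..1} (\<lambda>t. u (\<gamma> t))"
      using \<gamma>(2) by (intro continuous_on_compose2[OF _ cont]) (auto simp: path_image_def)
    fix t assume t0: "t \<in> {0<..<1} - T"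
    then have t: "t \<in> {0..1} - T" by auto
    have "\<gamma> differentiable (at t within {0..1})"
      using T(2) t by (meson C1_differentiable_on_eq Diff_subset differentiable_at_withinI)
    then have "(\<gamma> has_vector_derivative vector_derivative \<gamma> (at t within {0..1})) (at t within {0..1})"
      using vector_derivative_works by blast
    then have 2: "(\<gamma> has_derivative (\<lambda>s. s *\<^sub>R vector_derivative \<gamma> (at t within {0..1}))) (at t within {0..1})"
      by (simp add: has_vector_derivative_def)
    have "\<gamma> t \<in> S"
      using \<gamma>(2) t by (auto simp: path_image_def)
    from has_derivative_compose[OF 2 du[OF this]]
    show "((\<lambda>t. u (\<gamma> t)) has_vector_derivative Re (?g (\<gamma> t) * vector_derivative \<gamma> (at t within {0..1}))) (at t)"
      using t0 by (simp add: has_vector_derivative_def at_within_Icc_at algebra_simps)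
  qed auto
  from has_integral_unique[OF 1 this] show ?thesis by (simp add: pathfinish_def pathstart_def)
qed

section \<open>The period lattice\<close>

text \<open>Stated for an arbitrary real basis of the plane because it is used twice: for the full
  periods and for the short sides of the grid cells. \<open>Im (cnj \<alpha> * \<beta>)\<close> is
  the determinant of the basis.\<close>

locale complex_basis =
  fixes \<alpha> \<beta> :: complex
  assumes indep: "Im (cnj \<alpha> * \<beta>) \<noteq> 0"
begin

text \<open>Cramer's rule, with \<open>Im (cnj z * w)\<close> as the determinant of \<open>z\<close>
  and \<open>w\<close>.\<close>

definition coord1 :: "complex \<Rightarrow> real" where
  "coord1 z = - Im (cnj \<beta> * z) / Im (cnj \<alpha> * \<beta>)"

definition coord2 :: "complex \<Rightarrow> real" where
  "coord2 z = Im (cnj \<alpha> * z) / Im (cnj \<alpha> * \<beta>)"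

lemma coord_decomp: "of_real (coord1 z) * \<alpha> + of_real (coord2 z) * \<beta> = z"
proof -
  define d where "d = Im (cnj \<alpha> * \<beta>)"
  have d: "d \<noteq> 0" "d = Re \<alpha> * Im \<beta> - Im \<alpha> * Re \<beta>" using indep by (auto simp: d_def)
  have 1: "coord1 z * d = Im \<beta> * Re z - Re \<beta> * Im z" "coord2 z * d = Re \<alpha> * Im z - Im \<alpha> * Re z"
    using d(1) unfolding coord1_def coord2_def d_def[symmetric] by simp_all
  have "(coord1 z * Re \<alpha> + coord2 z * Re \<beta>) * d = (coord1 z * d) * Re \<alpha> + (coord2 z * d) * Re \<beta>"
    by (simp add: algebra_simps)
  also have "\<dots> = Re z * d" unfolding 1 by (simp add: d(2) algebra_simps)
  finally have re: "coord1 z * Re \<alpha> + coord2 z * Re \<beta> = Re z" using d(1) by simp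
  have "(coord1 z * Im \<alpha> + coord2 z * Im \<beta>) * d = (coord1 z * d) * Im \<alpha> + (coord2 z * d) * Im \<beta>"
    by (simp add: algebra_simps)
  also have "\<dots> = Im z * d" unfolding 1 by (simp add: d(2) algebra_simps)
  finally have im: "coord1 z * Im \<alpha> + coord2 z * Im \<beta> = Im z" using d(1) by simp
  show ?thesis by (simp add: complex_eq_iff re im)
qed

lemma coord1_comb [simp]: "coord1 (of_real x * \<alpha> + of_real y * \<beta>) = x"
  using indep by (simp add: coord1_def field_simps)

lemma coord2_comb [simp]: "coord2 (of_real x * \<alpha> + of_real y * \<beta>) = y"
  using indep by (simp add: coord2_def field_simps)

lemma coord_add [simp]: "coord1 (z + w) = coord1 z + coord1 w" "coord2 (z + w) = coord2 z + coord2 w"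
  by (simp_all only: coord1_def coord2_def distrib_left plus_complex.sel minus_add_distrib add_divide_distrib)

lemma coord_bound:
  obtains C where "C > 0" "\<And>z. \<bar>coord1 z\<bar> + \<bar>coord2 z\<bar> \<le> C * norm z"
proof
  let ?d = "\<bar>Im (cnj \<alpha> * \<beta>)\<bar>"
  have d: "?d > 0" using indep by simp
  have \<alpha>: "\<alpha> \<noteq> 0" using indep by auto
  show "0 < (norm \<alpha> + norm \<beta>) / ?d" using d \<alpha> by (intro divide_pos_pos add_pos_nonneg) auto
  fix z
  have "\<bar>Im (cnj \<beta> * z)\<bar> \<le> norm \<beta> * norm z" "\<bar>Im (cnj \<alpha> * z)\<bar> \<le> norm \<alpha> * norm z"
    by (metis abs_Im_le_cmod norm_mult complex_mod_cnj)+
  then show "\<bar>coord1 z\<bar> + \<bar>coord2 z\<bar> \<le> (norm \<alpha> + norm \<beta>) / ?d * norm z"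
    using d by (simp add: coord1_def coord2_def abs_divide add_divide_distrib[symmetric] divide_right_mono algebra_simps)
qed

end

section \<open>Convergence of sums over pairs of integers and the period lattice\<close>

lemma summable_on_int_inverse_powr:
  "(\<lambda>m::int. (1 / (1 + \<bar>real_of_int m\<bar>)) powr (3/2)) summable_on UNIV"
proof -
  let ?f = "\<lambda>m::int. (1 / (1 + \<bar>real_of_int m\<bar>)) powr (3/2)"
  have "summable (\<lambda>n. real n powr (-(3/2)))" by (subst summable_real_powr_iff) simp
  then have "summable (\<lambda>n. real (Suc n) powr (-(3/2)))" by (subst summable_Suc_iff)
  moreover have "real (Suc n) powr (-(3/2)) = (1 / (1 + real n)) powr (3/2)" for n
    by (simp add: powr_minus_divide powr_divide add.commute)
  ultimately have s: "(\<lambda>n. (1 / (1 + real n)) powr (3/2)) summable_on UNIV"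
    by (intro norm_summable_imp_summable_on) simp
  have "?f summable_on (range int)"
    by (subst summable_on_reindex) (use s in \<open>auto simp: o_def\<close>)
  moreover have "?f summable_on (range (\<lambda>n. - int n))"
    by (subst summable_on_reindex) (use s in \<open>auto simp: o_def inj_on_def\<close>)
  ultimately have "?f summable_on (range int \<union> range (\<lambda>n. - int n))"
    by (rule summable_on_union)
  moreover have "range int \<union> range (\<lambda>n. - int n) = UNIV"
  proof -
    have "m \<in> range int \<union> range (\<lambda>n. - int n)" for m
      by (cases m rule: int_cases2) auto
    then show ?thesis by blast
  qed
  ultimately show ?thesis by simp
qed

text \<open>Off the origin, (1 + |m|)(1 + |n|) is at most 9 (|m| + |n|)^2; raised to the power 3/2,
  this bounds the term by 27 times a product of terms of two convergent one-variable sums. At the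
  origin the term is 1/0 = 0.\<close>

lemma summable_on_int_pairs:
  "(\<lambda>(m, n). 1 / (\<bar>real_of_int m\<bar> + \<bar>real_of_int n\<bar>) ^ 3) summable_on UNIV"
proof -
  let ?f = "\<lambda>m::int. (1 / (1 + \<bar>real_of_int m\<bar>)) powr (3/2)"
  have "(\<lambda>(m, n). ?f m * ?f n) summable_on (UNIV \<times> UNIV)"
  proof (rule summable_on_SigmaI)
    show "((\<lambda>n. case (m, n) of (m, n) \<Rightarrow> ?f m * ?f n) has_sum ?f m * infsum ?f UNIV) UNIV" for m
      using has_sum_cmult_right[OF has_sum_infsum[OF summable_on_int_inverse_powr]] by simp
    show "(\<lambda>m. ?f m * infsum ?f UNIV) summable_on UNIV"
      using summable_on_cmult_left[OF summable_on_int_inverse_powr] by simp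
  qed auto
  then have s: "(\<lambda>(m, n). 27 * (?f m * ?f n)) summable_on UNIV"
    using summable_on_cmult_right[of "\<lambda>(m, n). ?f m * ?f n" UNIV 27] by (simp add: case_prod_unfold)
  show ?thesis
  proof (rule summable_on_comparison_test[OF s], clarify)
    fix m n :: int
    let ?x = "\<bar>real_of_int m\<bar>" and ?y = "\<bar>real_of_int n\<bar>"
    show "1 / (?x + ?y) ^ 3 \<le> 27 * (?f m * ?f n)"
    proof (cases "m = 0 \<and> n = 0")
      case False
      then have "\<bar>m\<bar> + \<bar>n\<bar> \<ge> 1" by linarith
      then have xy: "?x + ?y \<ge> 1" by linarith
      have "(?x + 1) * (?y + 1) \<le> (3 * (?x + ?y)) ^ 2"
      proof -
        have "(?x + 1) * (?y + 1) \<le> (3 * (?x + ?y)) * (3 * (?x + ?y))"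
          using xy by (intro mult_mono) auto
        then show ?thesis by (simp add: power2_eq_square)
      qed
      then have "((?x + 1) * (?y + 1)) powr (3/2) \<le> ((3 * (?x + ?y)) ^ 2) powr (3/2)"
        by (intro powr_mono2) auto
      also have "\<dots> = (3 * (?x + ?y)) powr 3"
        using xy by (simp flip: powr_numeral add: powr_powr)
      also have "\<dots> = (3 * (?x + ?y)) ^ 3"
        using xy by (intro powr_numeral mult_nonneg_nonneg add_nonneg_nonneg) auto
      also have "\<dots> = 27 * (?x + ?y) ^ 3"
        by (subst power_mult_distrib) simp
      finally have le: "((?x + 1) * (?y + 1)) powr (3/2) \<le> 27 * (?x + ?y) ^ 3" .
      have "?f m * ?f n = 1 / ((?x + 1) * (?y + 1)) powr (3/2)"
        by (simp add: powr_divide powr_mult add.commute)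
      moreover have "((?x + 1) * (?y + 1)) powr (3/2) > 0"
        by (auto simp: powr_gt_zero add_nonneg_eq_0_iff)
      moreover have "1 / s \<le> 27 * (1 / q)" if "q \<le> 27 * s" "q > 0" "s > 0" for q s :: real
        using that by (simp add: field_simps)
      ultimately show ?thesis
        using le xy by (metis less_le_trans zero_less_one zero_less_power)
    qed auto
  qed (auto simp: case_prod_unfold)
qed

locale period_pair =
  fixes \<omega>\<^sub>1 \<omega>\<^sub>2 :: complex
  assumes noncollinear: "\<not> collinear {0, \<omega>\<^sub>1, \<omega>\<^sub>2}"
begin

text \<open>Coordinates count full periods, so lattice points have integer coordinates and each
  half-period has a coordinate 1/2.\<close>

sublocale complex_basis "2 * \<omega>\<^sub>1" "2 * \<omega>\<^sub>2"
proof
  show "Im (cnj (2 * \<omega>\<^sub>1) * (2 * \<omega>\<^sub>2)) \<noteq> 0"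
  proof
    assume "Im (cnj (2 * \<omega>\<^sub>1) * (2 * \<omega>\<^sub>2)) = 0"
    then have im: "Re \<omega>\<^sub>1 * Im \<omega>\<^sub>2 = Im \<omega>\<^sub>1 * Re \<omega>\<^sub>2" by (simp add: algebra_simps)
    have nz: "\<omega>\<^sub>1 \<noteq> 0" and nc: "\<And>c. \<omega>\<^sub>2 \<noteq> c *\<^sub>R \<omega>\<^sub>1"
      using noncollinear by (auto simp: collinear_lemma)
    have "\<omega>\<^sub>2 = (if Re \<omega>\<^sub>1 = 0 then Im \<omega>\<^sub>2 / Im \<omega>\<^sub>1 else Re \<omega>\<^sub>2 / Re \<omega>\<^sub>1) *\<^sub>R \<omega>\<^sub>1"
      using im nz by (auto simp: complex_eq_iff field_simps)
    then show False using nc by blast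
  qed
qed

abbreviation L where "L \<equiv> period_lattice \<omega>\<^sub>1 \<omega>\<^sub>2"

definition lat :: "int \<times> int \<Rightarrow> complex" where
  "lat = (\<lambda>(m, n). 2 * \<omega>\<^sub>1 * of_int m + 2 * \<omega>\<^sub>2 * of_int n)"

lemma range_lat: "range lat = L"
  by (auto simp: lat_def period_lattice_def)

lemma coord_lat [simp]: "coord1 (lat p) = of_int (fst p)" "coord2 (lat p) = of_int (snd p)"
  using coord1_comb[of "of_int (fst p)" "of_int (snd p)"] coord2_comb[of "of_int (fst p)" "of_int (snd p)"]
  by (simp_all add: lat_def case_prod_unfold mult_ac)

lemma inj_lat: "inj lat"
proof (rule injI)
  fix p q assume "lat p = lat q"
  then have "coord1 (lat p) = coord1 (lat q)" "coord2 (lat p) = coord2 (lat q)" by auto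
  then show "p = q" by (simp add: prod_eq_iff)
qed

lemma bij_betw_lat: "bij_betw lat UNIV L"
  using inj_lat range_lat by (simp add: bij_betw_def)

lemma lat_add: "lat (p + q) = lat p + lat q"
  by (simp add: lat_def case_prod_unfold algebra_simps)

lemma lat_uminus: "lat (- p) = - lat p"
  by (simp add: lat_def case_prod_unfold algebra_simps)

lemma zero_in_lattice [simp]: "0 \<in> L"
  and lattice_add: "x \<in> L \<Longrightarrow> y \<in> L \<Longrightarrow> x + y \<in> L"
  and lattice_uminus: "x \<in> L \<Longrightarrow> - x \<in> L"
proof -
  show "0 \<in> L" unfolding range_lat[symmetric] by (rule image_eqI[of _ _ "(0, 0)"]) (auto simp: lat_def)
  show "x \<in> L \<Longrightarrow> y \<in> L \<Longrightarrow> x + y \<in> L" unfolding range_lat[symmetric]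
    by (auto simp flip: lat_add)
  show "x \<in> L \<Longrightarrow> - x \<in> L" unfolding range_lat[symmetric] by (auto simp flip: lat_uminus)
qed

lemma lattice_diff: "x \<in> L \<Longrightarrow> y \<in> L \<Longrightarrow> x - y \<in> L"
  using lattice_add[of x "- y"] lattice_uminus by simp

lemma lattice_uminus_iff [simp]: "- x \<in> L \<longleftrightarrow> x \<in> L"
  using lattice_uminus[of x] lattice_uminus[of "- x"] by auto

lemma lattice_add_iff: "y \<in> L \<Longrightarrow> x + y \<in> L \<longleftrightarrow> x \<in> L"
  using lattice_add[of x y] lattice_diff[of "x + y" y] by auto

lemma periods_in_lattice: "2 * \<omega>\<^sub>1 \<in> L" "2 * \<omega>\<^sub>2 \<in> L"
proof -
  show "2 * \<omega>\<^sub>1 \<in> L" unfolding range_lat[symmetric] by (rule image_eqI[of _ _ "(1, 0)"]) (auto simp: lat_def)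
  show "2 * \<omega>\<^sub>2 \<in> L" unfolding range_lat[symmetric] by (rule image_eqI[of _ _ "(0, 1)"]) (auto simp: lat_def)
qed

lemma half_periods_notin_lattice: "\<omega>\<^sub>1 \<notin> L" "\<omega>\<^sub>2 \<notin> L"
proof -
  have h: "False" if "of_int k = (1/2::real)" for k
  proof -
    have "real_of_int (2 * k) = real_of_int 1" using that by simp
    then have "2 * k = 1" by (simp only: of_int_eq_iff)
    then show False by presburger
  qed
  show "\<omega>\<^sub>1 \<notin> L"
  proof
    assume "\<omega>\<^sub>1 \<in> L"
    then obtain p where "\<omega>\<^sub>1 = lat p" unfolding range_lat[symmetric] by auto
    then have "coord1 \<omega>\<^sub>1 = of_int (fst p)" by (metis coord_lat(1))
    moreover have "coord1 \<omega>\<^sub>1 = 1/2" using coord1_comb[of "1/2" 0] by simp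
    ultimately show False using h by metis
  qed
  show "\<omega>\<^sub>2 \<notin> L"
  proof
    assume "\<omega>\<^sub>2 \<in> L"
    then obtain p where "\<omega>\<^sub>2 = lat p" unfolding range_lat[symmetric] by auto
    then have "coord2 \<omega>\<^sub>2 = of_int (snd p)" by (metis coord_lat(2))
    moreover have "coord2 \<omega>\<^sub>2 = 1/2" using coord2_comb[of 0 "1/2"] by simp
    ultimately show False using h by metis
  qed
qed

text \<open>Lattice points have integer coordinates, and \<open>coord_bound\<close> confines those
  of a ball to a finite square of indices.\<close>

lemma finite_lattice_cball: "finite (L \<inter> cball z R)"
proof -
  obtain C where C: "C > 0" "\<And>z. \<bar>coord1 z\<bar> + \<bar>coord2 z\<bar> \<le> C * norm z" using coord_bound by blast
  define k where "k = \<lceil>C * (norm z + R)\<rceil>"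
  have "L \<inter> cball z R \<subseteq> lat ` ({-k..k} \<times> {-k..k})"
  proof
    fix l assume l: "l \<in> L \<inter> cball z R"
    then obtain p where p: "l = lat p" unfolding range_lat[symmetric] by auto
    have "norm l \<le> norm z + R" using l norm_triangle_sub[of l z] by (auto simp: dist_norm norm_minus_commute)
    then have "C * norm l \<le> C * (norm z + R)" using C(1) by simp
    then have "\<bar>real_of_int (fst p)\<bar> + \<bar>real_of_int (snd p)\<bar> \<le> C * (norm z + R)"
      using C(2)[of l] by (simp add: p)
    also have "\<dots> \<le> of_int k" by (simp add: k_def)
    finally have "\<bar>fst p\<bar> \<le> k" "\<bar>snd p\<bar> \<le> k" by linarith+
    then show "l \<in> lat ` ({-k..k} \<times> {-k..k})"
      unfolding p by (intro imageI) (auto simp: mem_Times_iff)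
  qed
  then show ?thesis by (rule finite_subset) auto
qed

lemma closed_lattice: "closed L"
proof -
  have "open (- L)"
    unfolding open_contains_ball
  proof
    fix z assume z: "z \<in> - L"
    have "open (ball z 1 - (L \<inter> cball z 1))"
      by (intro open_Diff finite_imp_closed finite_lattice_cball) auto
    moreover have "z \<in> ball z 1 - (L \<inter> cball z 1)" using z by auto
    ultimately obtain e where "e > 0" "ball z e \<subseteq> ball z 1 - (L \<inter> cball z 1)"
      by (metis openE)
    then show "\<exists>e>0. ball z e \<subseteq> - L" by (intro exI[of _ e]) fastforce
  qed
  then show ?thesis by (simp add: closed_def)
qed

lemma countable_lattice: "countable L"
  unfolding range_lat[symmetric] by simp

lemma connected_Compl_lattice: "connected (- L)"
  using connected_open_diff_countable[of UNIV L] countable_lattice by (simp add: Compl_eq_Diff_UNIV connected_UNIV)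

text \<open>The norm dominates |m| + |n| up to a constant, which reduces the claim to pairs of
  integers. The exponent 3 is the decay found in \<open>zeta_term_bound\<close>.\<close>

lemma lattice_summable: "(\<lambda>l. 1 / norm l ^ 3) summable_on L"
proof -
  obtain C where C: "C > 0" "\<And>z. \<bar>coord1 z\<bar> + \<bar>coord2 z\<bar> \<le> C * norm z" using coord_bound by blast
  have s: "(\<lambda>p. C ^ 3 * (case p of (m, n) \<Rightarrow> 1 / (\<bar>real_of_int m\<bar> + \<bar>real_of_int n\<bar>) ^ 3)) summable_on UNIV"
    by (intro summable_on_cmult_right summable_on_int_pairs)
  have "(\<lambda>p. 1 / norm (lat p) ^ 3) summable_on UNIV"
  proof (rule summable_on_comparison_test[OF s])
    fix p :: "int \<times> int"
    let ?s = "\<bar>real_of_int (fst p)\<bar> + \<bar>real_of_int (snd p)\<bar>"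
    have le: "?s \<le> C * norm (lat p)" using C(2)[of "lat p"] by simp
    show "1 / norm (lat p) ^ 3 \<le> C ^ 3 * (case p of (m, n) \<Rightarrow> 1 / (\<bar>real_of_int m\<bar> + \<bar>real_of_int n\<bar>) ^ 3)"
    proof (cases "p = 0")
      case True
      then show ?thesis by (simp add: lat_def zero_prod_def)
    next
      case False
      then have "?s > 0" by (auto simp: prod_eq_iff add_nonneg_pos add_pos_nonneg)
      moreover from this le have "norm (lat p) > 0"
        by (smt (verit) C(1) mult_nonneg_nonpos)
      moreover have "?s ^ 3 \<le> (C * norm (lat p)) ^ 3" using le by (intro power_mono) auto
      ultimately show ?thesis by (simp add: case_prod_unfold field_simps)
    qed
  qed auto
  then show ?thesis
    unfolding range_lat[symmetric] by (subst summable_on_reindex[OF inj_lat]) (simp add: o_def)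
qed

end

section \<open>The Weierstrass zeta function\<close>

lemma contour_integral_translate:
  shows "contour_integral \<gamma> (\<lambda>w. f (w + a)) = contour_integral (\<lambda>t. \<gamma> t + a) f"
proof -
  have "((\<lambda>t. \<gamma> t + a) has_vector_derivative D) (at x) \<longleftrightarrow> (\<gamma> has_vector_derivative D) (at x)" for D x
    using has_vector_derivative_add[OF _ has_vector_derivative_const, of \<gamma> D "at x" a]
      has_vector_derivative_add[OF _ has_vector_derivative_const, of "\<lambda>t. \<gamma> t + a" D "at x" "- a"]
    by auto
  then have "vector_derivative (\<lambda>t. \<gamma> t + a) (at x) = vector_derivative \<gamma> (at x)" for x
    by (simp add: vector_derivative_def)
  then show ?thesis by (simp add: contour_integral_integral)
qed

lemma valid_path_translate:
  fixes \<gamma> :: "real \<Rightarrow> complex"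
  shows "valid_path \<gamma> \<Longrightarrow> valid_path (\<lambda>t. \<gamma> t + a)"
  using valid_path_compose_holomorphic[of \<gamma> "\<lambda>z. z + a" UNIV] holomorphic_on_add[of "\<lambda>z. z" UNIV "\<lambda>_. a"]
  by (simp add: o_def)

context period_pair
begin

abbreviation \<zeta> where "\<zeta> \<equiv> weierstrass_zeta \<omega>\<^sub>1 \<omega>\<^sub>2"

text \<open>Division by zero yields zero, so that the term for \<open>l = 0\<close> is \<open>1 / z\<close>.\<close>

definition zeta_term :: "complex \<Rightarrow> complex \<Rightarrow> complex" where
  "zeta_term z l = 1 / (z - l) + 1 / l + z / l\<^sup>2"

text \<open>Minus the term of the Weierstrass p-function that belongs to \<open>l\<close>; for
  \<open>l = 0\<close> this is -1/z^2.\<close>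

definition zeta_term_deriv :: "complex \<Rightarrow> complex \<Rightarrow> complex" where
  "zeta_term_deriv z l = - 1 / (z - l)\<^sup>2 + 1 / l\<^sup>2"

text \<open>Over a common denominator the three fractions collapse to
  \<open>z\<^sup>2 / (l\<^sup>2 * (z - l))\<close>, and |z - l| is at least |l|/2.\<close>

lemma zeta_term_bound:
  assumes "norm z \<le> R" "2 * R \<le> norm l" "R > 0"
  shows "norm (zeta_term z l) \<le> 2 * R\<^sup>2 * (1 / norm l ^ 3)"
proof -
  have l: "norm l > 0" "l \<noteq> 0" using assms by auto
  have ge: "norm l / 2 \<le> norm (z - l)"
    using assms norm_triangle_ineq2[of l z] by (simp add: norm_minus_commute)
  then have "z \<noteq> l" using l by auto
  then have "zeta_term z l = z\<^sup>2 / (l\<^sup>2 * (z - l))"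
    using l by (simp add: zeta_term_def divide_simps) (simp add: power2_eq_square algebra_simps)
  then have "norm (zeta_term z l) = norm z ^ 2 / (norm l ^ 2 * norm (z - l))"
    by (simp add: norm_divide norm_mult norm_power)
  also have "\<dots> \<le> R ^ 2 / (norm l ^ 2 * (norm l / 2))"
    using assms l ge by (intro frac_le mult_left_mono power_mono mult_pos_pos) auto
  also have "\<dots> = 2 * R\<^sup>2 * (1 / norm l ^ 3)"
    using l by (simp add: power2_eq_square power3_eq_cube)
  finally show ?thesis .
qed

lemma zeta_term_has_derivative:
  assumes "z \<noteq> l"
  shows "((\<lambda>z. zeta_term z l) has_field_derivative zeta_term_deriv z l) (at z)"
  unfolding zeta_term_def zeta_term_deriv_def divide_inverse using assms
  by (auto intro!: derivative_eq_intros simp: power2_eq_square)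

lemma zeta_term_summable: "zeta_term z summable_on L"
proof -
  define R where "R = norm z + 1"
  define A where "A = L \<inter> cball 0 (2 * R)"
  have R: "R > 0" "norm z \<le> R" by (auto simp: R_def add_nonneg_pos)
  have "(\<lambda>l. norm (zeta_term z l)) summable_on (L - A)"
  proof (rule summable_on_comparison_test)
    show "(\<lambda>l. 2 * R\<^sup>2 * (1 / norm l ^ 3)) summable_on (L - A)"
      using summable_on_subset_banach[OF lattice_summable] by (intro summable_on_cmult_right) auto
    show "norm (zeta_term z l) \<le> 2 * R\<^sup>2 * (1 / norm l ^ 3)" if "l \<in> L - A" for l
      using that R by (intro zeta_term_bound) (auto simp: A_def)
  qed auto
  then have "zeta_term z summable_on (L - A)" by (rule abs_summable_summable)
  moreover have "zeta_term z summable_on A"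
    unfolding A_def by (intro summable_on_finite finite_lattice_cball)
  ultimately have "zeta_term z summable_on (L - A \<union> A)" by (rule summable_on_union)
  moreover have "L - A \<union> A = L" by (auto simp: A_def)
  ultimately show ?thesis by simp
qed

lemma zeta_eq_infsum: "\<zeta> z = (\<Sum>\<^sub>\<infinity>l\<in>L. zeta_term z l)"
proof -
  have "(\<Sum>\<^sub>\<infinity>l\<in>L. zeta_term z l) = (\<Sum>\<^sub>\<infinity>l\<in>insert 0 (L - {0}). zeta_term z l)"
    by (simp add: insert_absorb)
  also have "\<dots> = zeta_term z 0 + (\<Sum>\<^sub>\<infinity>l\<in>L - {0}. zeta_term z l)"
    by (intro infsum_insert summable_on_subset_banach[OF zeta_term_summable]) auto
  finally show ?thesis by (simp add: weierstrass_zeta_def zeta_term_def)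
qed

text \<open>Weierstrass M-test: beyond radius \<open>2 * R\<close> the bound of
  \<open>zeta_term_bound\<close> is uniform for |z| at most \<open>R\<close>, so the tail converges
  uniformly and may be differentiated term by term. The finitely many terms with \<open>l\<close> in
  \<open>A\<close> carry all poles in the ball.\<close>

lemma zeta_tail:
  assumes "R > 0"
  defines "A \<equiv> L \<inter> cball 0 (2 * R)"
  shows "(\<lambda>z. \<Sum>\<^sub>\<infinity>l\<in>L - A. zeta_term z l) holomorphic_on ball 0 R"
    and "z \<in> ball 0 R \<Longrightarrow> \<exists>d. ((\<lambda>z. \<Sum>\<^sub>\<infinity>l\<in>L - A. zeta_term z l) has_field_derivative d) (at z) \<and>
           (zeta_term_deriv z has_sum d) (L - A)"
    and "z \<in> ball 0 R \<Longrightarrow> \<zeta> z = (\<Sum>l\<in>A. zeta_term z l) + (\<Sum>\<^sub>\<infinity>l\<in>L - A. zeta_term z l)"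
proof -
  let ?H = "\<lambda>z. \<Sum>\<^sub>\<infinity>l\<in>L - A. zeta_term z l"
  have ne: "z \<noteq> l" if "z \<in> cball 0 R" "l \<in> L - A" for z l
    using that assms by (auto simp: A_def)
  have der: "((\<lambda>z. zeta_term z l) has_field_derivative zeta_term_deriv z l) (at z)"
    if "z \<in> cball 0 R" "l \<in> L - A" for z l
    using ne[OF that] by (intro zeta_term_has_derivative)
  have ulim: "uniform_limit (cball 0 R) (\<lambda>X z. \<Sum>l\<in>X. zeta_term z l) ?H (finite_subsets_at_top (L - A))"
  proof (rule Weierstrass_m_test_general)
    show "(\<lambda>l. 2 * R\<^sup>2 * (1 / norm l ^ 3)) summable_on (L - A)"
      using summable_on_subset_banach[OF lattice_summable] by (intro summable_on_cmult_right) auto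
    show "norm (zeta_term z l) \<le> 2 * R\<^sup>2 * (1 / norm l ^ 3)" if "l \<in> L - A" "z \<in> cball 0 R" for l z
      using that \<open>R > 0\<close> by (intro zeta_term_bound) (auto simp: A_def)
  qed
  have ev: "\<forall>\<^sub>F X in finite_subsets_at_top (L - A). continuous_on (cball 0 R) (\<lambda>z. \<Sum>l\<in>X. zeta_term z l) \<and>
      (\<forall>w\<in>ball 0 R. ((\<lambda>z. \<Sum>l\<in>X. zeta_term z l) has_field_derivative (\<Sum>l\<in>X. zeta_term_deriv w l)) (at w))"
  proof (rule eventually_finite_subsets_at_top_weakI)
    fix X assume X: "finite X" "X \<subseteq> L - A"
    have d: "((\<lambda>z. \<Sum>l\<in>X. zeta_term z l) has_field_derivative (\<Sum>l\<in>X. zeta_term_deriv w l)) (at w)"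
      if "w \<in> cball 0 R" for w
      using that X by (intro DERIV_sum der) auto
    then have "continuous_on (cball 0 R) (\<lambda>z. \<Sum>l\<in>X. zeta_term z l)"
      by (intro continuous_at_imp_continuous_on ballI DERIV_isCont)
    then show "continuous_on (cball 0 R) (\<lambda>z. \<Sum>l\<in>X. zeta_term z l) \<and>
      (\<forall>w\<in>ball 0 R. ((\<lambda>z. \<Sum>l\<in>X. zeta_term z l) has_field_derivative (\<Sum>l\<in>X. zeta_term_deriv w l)) (at w))"
      using d by auto
  qed
  obtain g' where g': "\<And>w. w \<in> ball 0 R \<Longrightarrow> (?H has_field_derivative g' w) (at w) \<and>
      ((\<lambda>X. \<Sum>l\<in>X. zeta_term_deriv w l) \<longlongrightarrow> g' w) (finite_subsets_at_top (L - A))"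
    by (rule has_complex_derivative_uniform_limit[OF ev ulim finite_subsets_at_top_neq_bot \<open>R > 0\<close>]) blast
  show "?H holomorphic_on ball 0 R"
    using g' unfolding holomorphic_on_open[OF open_ball] by blast
  show "\<exists>d. (?H has_field_derivative d) (at z) \<and> (zeta_term_deriv z has_sum d) (L - A)" if "z \<in> ball 0 R"
    using g'[OF that] by (auto simp: has_sum_def)
  have "finite A" unfolding A_def by (rule finite_lattice_cball)
  then have "(\<Sum>\<^sub>\<infinity>l\<in>A \<union> (L - A). zeta_term z l) = (\<Sum>l\<in>A. zeta_term z l) + ?H z"
    by (subst infsum_Un_disjoint) (auto intro: summable_on_subset_banach[OF zeta_term_summable])
  moreover have "A \<union> (L - A) = L" by (auto simp: A_def)
  ultimately show "\<zeta> z = (\<Sum>l\<in>A. zeta_term z l) + ?H z" by (simp add: zeta_eq_infsum)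
qed

text \<open>The corrections 1/l + z/l^2 of the finitely many near terms are entire and join the
  holomorphic tail. What remains shows residue 1 at every pole.\<close>

lemma zeta_principal_part:
  assumes "R > 0"
  obtains G where "G holomorphic_on ball 0 R"
    "\<And>z. z \<in> ball 0 R \<Longrightarrow> \<zeta> z = (\<Sum>l\<in>L \<inter> cball 0 (2 * R). 1 / (z - l)) + G z"
proof
  let ?A = "L \<inter> cball 0 (2 * R)"
  let ?G = "\<lambda>z. (\<Sum>l\<in>?A. 1 / l + z / l\<^sup>2) + (\<Sum>\<^sub>\<infinity>l\<in>L - ?A. zeta_term z l)"
  have "(\<lambda>z. \<Sum>l\<in>?A. 1 / l + z / l\<^sup>2) holomorphic_on ball 0 R"
    unfolding divide_inverse by (intro holomorphic_intros)
  then show "?G holomorphic_on ball 0 R"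
    by (intro holomorphic_on_add zeta_tail(1)[OF assms])
  show "\<zeta> z = (\<Sum>l\<in>?A. 1 / (z - l)) + ?G z" if "z \<in> ball 0 R" for z
    using zeta_tail(3)[OF assms that] by (simp add: zeta_term_def sum.distrib add.assoc)
qed

text \<open>The derivative is kept together with its termwise expansion, on which the index shifts
  of \<open>zeta_quasi_periodic\<close> act.\<close>

lemma zeta_has_derivative:
  assumes "z \<notin> L"
  shows "\<exists>d. (\<zeta> has_field_derivative d) (at z) \<and> (zeta_term_deriv z has_sum d) L"
proof -
  define R where "R = norm z + 1"
  define A where "A = L \<inter> cball 0 (2 * R)"
  have R: "R > 0" "z \<in> ball 0 R" by (auto simp: R_def add_nonneg_pos)
  obtain d where d: "((\<lambda>z. \<Sum>\<^sub>\<infinity>l\<in>L - A. zeta_term z l) has_field_derivative d) (at z)"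
      "(zeta_term_deriv z has_sum d) (L - A)"
    using zeta_tail(2)[OF R] unfolding A_def by blast
  have fin: "finite A" unfolding A_def by (rule finite_lattice_cball)
  have "((\<lambda>z. zeta_term z l) has_field_derivative zeta_term_deriv z l) (at z)" if "l \<in> A" for l
    using that assms by (intro zeta_term_has_derivative) (auto simp: A_def)
  then have "((\<lambda>z. (\<Sum>l\<in>A. zeta_term z l) + (\<Sum>\<^sub>\<infinity>l\<in>L - A. zeta_term z l)) has_field_derivative
      (\<Sum>l\<in>A. zeta_term_deriv z l) + d) (at z)"
    by (intro DERIV_add DERIV_sum d)
  then have "(\<zeta> has_field_derivative (\<Sum>l\<in>A. zeta_term_deriv z l) + d) (at z)"
    by (rule has_field_derivative_transform_within_open[of _ _ _ "ball 0 R"])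
      (use R zeta_tail(3)[OF R(1)] in \<open>auto simp: A_def\<close>)
  moreover have "(zeta_term_deriv z has_sum (\<Sum>l\<in>A. zeta_term_deriv z l) + d) (A \<union> (L - A))"
    by (intro has_sum_Un_disjoint has_sum_finite fin d) auto
  moreover have "A \<union> (L - A) = L" by (auto simp: A_def)
  ultimately show ?thesis by auto
qed

lemma zeta_holomorphic: "\<zeta> holomorphic_on - L"
  using zeta_has_derivative closed_lattice by (auto simp: holomorphic_on_open open_Compl)

text \<open>The change of the derivative \<open>P\<close> under the period does not depend on the
  point; at \<open>- \<omega>\<close> it vanishes because \<open>P\<close> is even. So
  \<open>P\<close> is periodic, and the increment of \<zeta> is constant because the complement of
  the lattice is connected.\<close>

lemma zeta_quasi_periodic:
  assumes "\<omega> \<in> {\<omega>\<^sub>1, \<omega>\<^sub>2}"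
  obtains \<eta> where "\<And>z. z \<notin> L \<Longrightarrow> \<zeta> (z + 2 * \<omega>) = \<zeta> z + \<eta>"
proof -
  have w: "2 * \<omega> \<in> L" "\<omega> \<notin> L"
    using assms periods_in_lattice half_periods_notin_lattice by auto
  define P where "P z = (\<Sum>\<^sub>\<infinity>l\<in>L. zeta_term_deriv z l)" for z
  have P: "(\<zeta> has_field_derivative P z) (at z)" "(zeta_term_deriv z has_sum P z) L" if "z \<notin> L" for z
    using zeta_has_derivative[OF that] by (auto simp: P_def infsumI)
  have bij: "bij_betw (\<lambda>l. l - 2 * \<omega>) L L"
    by (rule bij_betw_byWitness[where f' = "\<lambda>l. l + 2 * \<omega>"])
      (use w in \<open>auto intro: lattice_add lattice_diff\<close>)
  \<comment> \<open>After the shift of the index the terms that contain \<open>z\<close> cancel;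
    only the corrections 1/l^2 remain.\<close>
  have shift: "((\<lambda>l. 1 / l\<^sup>2 - 1 / (l - 2 * \<omega>)\<^sup>2) has_sum P (z + 2 * \<omega>) - P z) L" if z: "z \<notin> L" for z
  proof -
    have z': "z + 2 * \<omega> \<notin> L" using z w by (simp add: lattice_add_iff)
    have "((\<lambda>l. zeta_term_deriv z (l - 2 * \<omega>)) has_sum P z) L"
      using P(2)[OF z] has_sum_reindex_bij_betw[OF bij] by blast
    then have "((\<lambda>l. - zeta_term_deriv z (l - 2 * \<omega>)) has_sum - P z) L"
      by (simp add: has_sum_uminus)
    from has_sum_add[OF P(2)[OF z'] this] show ?thesis
      by (simp add: zeta_term_deriv_def algebra_simps)
  qed
  have bij': "bij_betw uminus L L"
    by (rule bij_betw_byWitness[where f' = uminus]) (auto intro: lattice_uminus)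
  have even: "P (- z) = P z" if z: "z \<notin> L" for z
  proof -
    have z': "- z \<notin> L" using z by simp
    have "((\<lambda>l. zeta_term_deriv (- z) (- l)) has_sum P (- z)) L"
      using P(2)[OF z'] has_sum_reindex_bij_betw[OF bij'] by blast
    moreover have "zeta_term_deriv (- z) (- l) = zeta_term_deriv z l" for l
      by (simp add: zeta_term_deriv_def power2_commute)
    ultimately show ?thesis using P(2)[OF z] by (auto intro: has_sum_unique)
  qed
  have "P (z + 2 * \<omega>) = P z" if z: "z \<notin> L" for z
  proof -
    have "P (z + 2 * \<omega>) - P z = P (- \<omega> + 2 * \<omega>) - P (- \<omega>)"
      using shift[OF z] shift[of "- \<omega>"] w by (auto intro: has_sum_unique)
    also have "\<dots> = 0" using even[OF w(2)] by simp
    finally show ?thesis by simp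
  qed
  then have D: "((\<lambda>z. \<zeta> (z + 2 * \<omega>) - \<zeta> z) has_field_derivative 0) (at z)" if "z \<in> - L" for z
  proof -
    have "z + 2 * \<omega> \<notin> L" using that w by (simp add: lattice_add_iff)
    from P(1)[OF this] have "((\<lambda>z. \<zeta> (z + 2 * \<omega>)) has_field_derivative P (z + 2 * \<omega>)) (at z)"
      by (simp add: DERIV_shift)
    from DERIV_diff[OF this P(1)] show ?thesis using that \<open>\<And>z. z \<notin> L \<Longrightarrow> P (z + 2 * \<omega>) = P z\<close> by simp
  qed
  have "continuous_on (- L) (\<lambda>z. \<zeta> (z + 2 * \<omega>) - \<zeta> z)"
    by (intro continuous_at_imp_continuous_on ballI DERIV_isCont[OF D])
  from DERIV_zero_connected_constant[OF connected_Compl_lattice open_Compl[OF closed_lattice] finite.emptyI this]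
  obtain c where "\<And>z. z \<in> - L \<Longrightarrow> \<zeta> (z + 2 * \<omega>) - \<zeta> z = c"
    using D by auto
  then have "\<zeta> (z + 2 * \<omega>) = \<zeta> z + c" if "z \<notin> L" for z using that by (metis ComplI add.commute diff_add_cancel)
  then show ?thesis by (rule that)
qed

text \<open>Inside a ball that contains the curve, the holomorphic remainder integrates to zero and
  each simple pole contributes its winding number. All farther lattice points have winding number
  zero, so the infinite sum is a finite sum of integers.\<close>

lemma zeta_closed_contour:
  assumes \<gamma>: "valid_path \<gamma>" "pathfinish \<gamma> = pathstart \<gamma>" "path_image \<gamma> \<inter> L = {}"
  shows "contour_integral \<gamma> \<zeta> = 2 * pi * \<i> * (\<Sum>\<^sub>\<infinity>l\<in>L. winding_number \<gamma> l)"
    and "(\<Sum>\<^sub>\<infinity>l\<in>L. winding_number \<gamma> l) \<in> \<int>"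
proof -
  have "bounded (path_image \<gamma>)" using \<gamma> by (simp add: bounded_valid_path_image)
  then obtain R where R: "R > 0" "path_image \<gamma> \<subseteq> ball 0 R"
    by (meson bounded_subset_ballD)
  define A where "A = L \<inter> cball 0 (2 * R)"
  have fin: "finite A" unfolding A_def by (rule finite_lattice_cball)
  obtain G where G: "G holomorphic_on ball 0 R"
    "\<And>z. z \<in> ball 0 R \<Longrightarrow> \<zeta> z = (\<Sum>l\<in>A. 1 / (z - l)) + G z"
    using zeta_principal_part[OF R(1)] unfolding A_def by blast
  have "(G has_contour_integral 0) \<gamma>"
    using Cauchy_theorem_convex_simple[OF G(1) _ \<gamma>(1) R(2)] \<gamma> by simp
  moreover have "((\<lambda>z. \<Sum>l\<in>A. 1 / (z - l)) has_contour_integral (\<Sum>l\<in>A. 2 * pi * \<i> * winding_number \<gamma> l)) \<gamma>"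
    using \<gamma> fin by (intro has_contour_integral_sum has_contour_integral_winding_number) (auto simp: A_def)
  ultimately have "((\<lambda>z. (\<Sum>l\<in>A. 1 / (z - l)) + G z) has_contour_integral (\<Sum>l\<in>A. 2 * pi * \<i> * winding_number \<gamma> l) + 0) \<gamma>"
    by (rule has_contour_integral_add[rotated])
  then have 1: "(\<zeta> has_contour_integral (\<Sum>l\<in>A. 2 * pi * \<i> * winding_number \<gamma> l) + 0) \<gamma>"
    by (rule has_contour_integral_eq) (use G R in auto)
  have 2: "(\<Sum>\<^sub>\<infinity>l\<in>L. winding_number \<gamma> l) = (\<Sum>l\<in>A. winding_number \<gamma> l)"
  proof -
    have "winding_number \<gamma> l = 0" if "l \<in> L - A" for l
    proof (rule winding_number_zero_outside[of _ "ball 0 R"])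
      show "path \<gamma>" using \<gamma> by (simp add: valid_path_imp_path)
      show "l \<notin> ball 0 R" using that R by (auto simp: A_def)
    qed (use \<gamma> R in auto)
    then have "(\<Sum>\<^sub>\<infinity>l\<in>L. winding_number \<gamma> l) = (\<Sum>\<^sub>\<infinity>l\<in>A. winding_number \<gamma> l)"
      by (intro infsum_cong_neutral) (auto simp: A_def)
    then show ?thesis using fin by simp
  qed
  show "contour_integral \<gamma> \<zeta> = 2 * pi * \<i> * (\<Sum>\<^sub>\<infinity>l\<in>L. winding_number \<gamma> l)"
    using contour_integral_unique[OF 1] by (simp add: 2 sum_distrib_left)
  show "(\<Sum>\<^sub>\<infinity>l\<in>L. winding_number \<gamma> l) \<in> \<int>"
    unfolding 2 using \<gamma> by (intro Ints_sum integer_winding_number) (auto simp: A_def valid_path_imp_path)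
qed

end

section \<open>The Weierstrass sigma function\<close>

context period_pair
begin

abbreviation \<sigma> where "\<sigma> \<equiv> weierstrass_sigma \<omega>\<^sub>1 \<omega>\<^sub>2"

lemma zeta_contour_integrable:
  "valid_path \<gamma> \<Longrightarrow> path_image \<gamma> \<inter> L = {} \<Longrightarrow> \<zeta> contour_integrable_on \<gamma>"
  using contour_integrable_holomorphic_simple[OF zeta_holomorphic open_Compl[OF closed_lattice]] by blast

text \<open>The two paths form a closed contour, over which \<zeta> integrates to an integer
  multiple of 2 pi i. Hence the arbitrary choice of a path in the definition of \<sigma> is
  harmless.\<close>

lemma exp_zeta_path_independent:
  assumes p: "valid_path p" "path_image p \<inter> L = {}" and q: "valid_path q" "path_image q \<inter> L = {}"
    and ends: "pathstart q = pathstart p" "pathfinish q = pathfinish p"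
  shows "exp (contour_integral p \<zeta>) = exp (contour_integral q \<zeta>)"
proof -
  let ?\<gamma> = "p +++ reversepath q"
  have \<gamma>: "valid_path ?\<gamma>" "pathfinish ?\<gamma> = pathstart ?\<gamma>" "path_image ?\<gamma> \<inter> L = {}"
    using p q ends by (auto simp: path_image_join)
  obtain k where "(\<Sum>\<^sub>\<infinity>l\<in>L. winding_number ?\<gamma> l) = of_int k"
    using zeta_closed_contour(2)[OF \<gamma>] by (auto elim: Ints_cases)
  then have "contour_integral ?\<gamma> \<zeta> = 2 * of_int k * pi * \<i>"
    using zeta_closed_contour(1)[OF \<gamma>] by simp
  moreover have "contour_integral ?\<gamma> \<zeta> = contour_integral p \<zeta> - contour_integral q \<zeta>"
    using p q ends by (simp add: contour_integral_join contour_integral_reversepath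
        zeta_contour_integrable contour_integrable_reversepath)
  ultimately have "contour_integral p \<zeta> = contour_integral q \<zeta> + (of_int (2 * k) * pi) * \<i>"
    by (simp add: algebra_simps)
  then show ?thesis unfolding exp_eq by blast
qed

lemma path_avoiding_lattice:
  assumes "x \<notin> L" "y \<notin> L"
  obtains p where "valid_path p" "path_image p \<inter> L = {}" "pathstart p = x" "pathfinish p = y"
proof -
  obtain p where "polynomial_function p" "path_image p \<subseteq> - L" "pathstart p = x" "pathfinish p = y"
    using connected_open_polynomial_connected[OF open_Compl[OF closed_lattice] connected_Compl_lattice] assms by blast
  then show ?thesis using that valid_path_polynomial_function by blast
qed

text \<open>Trades the limit in the definition for a fixed base point. Near 0, \<zeta> is 1/z plus a
  function with primitive \<open>F\<close>, so x times the exponential of the integral from x to e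
  equals \<open>e * exp (F e - F x)\<close>, which converges as x tends to 0.\<close>

lemma sigma_eq_exp_zeta:
  obtains C e where "C \<noteq> 0" "e \<notin> L"
    "\<And>\<gamma>. \<lbrakk>valid_path \<gamma>; path_image \<gamma> \<inter> L = {}; pathstart \<gamma> = e\<rbrakk> \<Longrightarrow>
       \<sigma> (pathfinish \<gamma>) = C * exp (contour_integral \<gamma> \<zeta>)"
proof -
  obtain r where r: "r > 0" "\<And>l. l \<in> L \<inter> cball 0 1 \<Longrightarrow> l \<noteq> 0 \<Longrightarrow> r \<le> dist 0 l"
    using finite_set_avoid[OF finite_lattice_cball[of 0 1], of 0] by blast
  \<comment> \<open>With this radius, 0 is the only lattice point within \<open>2 * R\<close> of the
    origin, so a single principal part survives.\<close>
  define R where "R = min r 1 / 3"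
  have R: "R > 0" "2 * R < r" "2 * R < 1" using r(1) by (auto simp: R_def)
  have A: "L \<inter> cball 0 (2 * R) = {0}"
  proof -
    have "l = 0" if "l \<in> L \<inter> cball 0 (2 * R)" for l
      using r(2)[of l] that R by (cases "l = 0") auto
    then show ?thesis using R by auto
  qed
  have notL: "z \<notin> L" if "z \<in> ball 0 R - {0}" for z
  proof
    assume "z \<in> L"
    then have "z \<in> L \<inter> cball 0 (2 * R)" using that R by auto
    then show False using A that by auto
  qed
  obtain G where G: "G holomorphic_on ball 0 R" "\<And>z. z \<in> ball 0 R \<Longrightarrow> \<zeta> z = 1 / z + G z"
    using zeta_principal_part[OF R(1)] unfolding A by auto
  obtain F where F: "\<And>z. z \<in> ball 0 R \<Longrightarrow> (F has_field_derivative G z) (at z)"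
    using holomorphic_convex_primitive'[OF convex_ball open_ball G(1)]
    by (metis at_within_open open_ball)
  define e :: complex where "e = of_real (R / 2)"
  have e: "e \<in> ball 0 R - {0}" using R by (auto simp: e_def)
  have near: "x * exp (contour_integral q \<zeta>) = e * exp (F e - F x) * exp (contour_integral \<gamma> \<zeta>)"
    if x: "x \<in> ball 0 R - {0}" and q: "valid_path q" "path_image q \<inter> L = {}" "pathstart q = x" "pathfinish q = pathfinish \<gamma>"
      and \<gamma>: "valid_path \<gamma>" "path_image \<gamma> \<inter> L = {}" "pathstart \<gamma> = e" for x q \<gamma>
  proof -
    have "connected (ball 0 R - {0::complex})"
      using connected_open_delete[of "ball (0::complex) R" 0] by simp
    then obtain p where p: "polynomial_function p" "path_image p \<subseteq> ball 0 R - {0}" "pathstart p = x" "pathfinish p = e"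
      using connected_open_polynomial_connected[of "ball 0 R - {0::complex}"] e x by blast
    have vp: "valid_path p" using p(1) by (rule valid_path_polynomial_function)
    have pL: "path_image p \<inter> L = {}" using p(2) notL by blast
    have p0: "0 \<notin> path_image p" using p(2) by blast
    have "((\<lambda>z. 1 / (z - 0)) has_contour_integral 2 * pi * \<i> * winding_number p 0) p"
      by (rule has_contour_integral_winding_number[OF vp p0])
    moreover have "(G has_contour_integral F e - F x) p"
      using contour_integral_primitive[of "ball 0 R" F G p] F vp p has_field_derivative_at_within by blast
    ultimately have "((\<lambda>z. 1 / (z - 0) + G z) has_contour_integral 2 * pi * \<i> * winding_number p 0 + (F e - F x)) p"
      by (rule has_contour_integral_add)
    then have "(\<zeta> has_contour_integral 2 * pi * \<i> * winding_number p 0 + (F e - F x)) p"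
      by (rule has_contour_integral_eq) (use G(2) p(2) in auto)
    then have "contour_integral p \<zeta> = 2 * pi * \<i> * winding_number p 0 + (F e - F x)"
      by (rule contour_integral_unique)
    \<comment> \<open>The integral of 1/z along \<open>p\<close> is a logarithm of
      \<open>e / x\<close>; the winding number of the open path supplies it without a choice of
      branch.\<close>
    moreover have "e = exp (2 * pi * \<i> * winding_number p 0) * x"
      using winding_number_exp_2pi[OF valid_path_imp_path[OF vp] p0] p by simp
    ultimately have ep: "x * exp (contour_integral p \<zeta>) = e * exp (F e - F x)"
      by (simp add: exp_add mult_ac)
    have "exp (contour_integral q \<zeta>) = exp (contour_integral (p +++ \<gamma>) \<zeta>)"
      by (rule exp_zeta_path_independent) (use p vp pL q \<gamma> in \<open>auto simp: path_image_join\<close>)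
    also have "contour_integral (p +++ \<gamma>) \<zeta> = contour_integral p \<zeta> + contour_integral \<gamma> \<zeta>"
      using p vp pL \<gamma> by (intro contour_integral_join zeta_contour_integrable) auto
    finally show ?thesis using ep by (simp add: exp_add)
  qed
  show ?thesis
  proof (rule that)
    show "e * exp (F e - F 0) \<noteq> 0" using e by auto
    show "e \<notin> L" using notL[OF e] .
    fix \<gamma> assume \<gamma>: "valid_path \<gamma>" "path_image \<gamma> \<inter> L = {}" "pathstart \<gamma> = e"
    let ?z = "pathfinish \<gamma>"
    have z: "?z \<notin> L" using \<gamma>(2) pathfinish_in_path_image[of \<gamma>] by blast
    \<comment> \<open>The same choice as in the definition of \<open>weierstrass_sigma\<close>, as a
      function of the starting point.\<close>
    define Q where "Q x = (SOME q. valid_path q \<and> pathstart q = x \<and> pathfinish q = ?z \<and> path_image q \<inter> L = {})" for x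
    have Q: "valid_path (Q x) \<and> pathstart (Q x) = x \<and> pathfinish (Q x) = ?z \<and> path_image (Q x) \<inter> L = {}"
      if x: "x \<notin> L" for x
    proof -
      obtain q where "valid_path q" "path_image q \<inter> L = {}" "pathstart q = x" "pathfinish q = ?z"
        using path_avoiding_lattice[OF x z] .
      then have "\<exists>q. valid_path q \<and> pathstart q = x \<and> pathfinish q = ?z \<and> path_image q \<inter> L = {}"
        by blast
      then show ?thesis unfolding Q_def by (rule someI_ex)
    qed
    have "isCont F 0" using F[of 0] R by (auto intro: DERIV_isCont)
    then have "((\<lambda>x. e * exp (F e - F x) * exp (contour_integral \<gamma> \<zeta>)) \<longlongrightarrow>
        e * exp (F e - F 0) * exp (contour_integral \<gamma> \<zeta>)) (at 0)"
      by (intro tendsto_intros) (simp add: isCont_def)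
    moreover have "\<forall>\<^sub>F x in at 0. e * exp (F e - F x) * exp (contour_integral \<gamma> \<zeta>) = x * exp (contour_integral (Q x) \<zeta>)"
    proof -
      have "\<forall>\<^sub>F x in at 0. x \<in> ball 0 R - {0}"
        using R by (auto simp: eventually_at dist_commute intro!: exI[of _ R])
      then show ?thesis
      proof eventually_elim
        case (elim x)
        show ?case using near[OF elim, of "Q x" \<gamma>] Q[OF notL[OF elim]] \<gamma> by simp
      qed
    qed
    ultimately have "((\<lambda>x. x * exp (contour_integral (Q x) \<zeta>)) \<longlongrightarrow>
        e * exp (F e - F 0) * exp (contour_integral \<gamma> \<zeta>)) (at 0)"
      by (rule Lim_transform_eventually)
    then show "\<sigma> ?z = e * exp (F e - F 0) * exp (contour_integral \<gamma> \<zeta>)"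
      using z unfolding weierstrass_sigma_def Q_def by (auto intro: tendsto_Lim)
  qed
qed

text \<open>Prepending a path from the base point makes \<open>C\<close> and \<open>e\<close>
  cancel. This is \<sigma>'/\<sigma> = \<zeta> in integrated form, from which the later facts about
  \<sigma> are drawn.\<close>

lemma sigma_path:
  assumes \<gamma>: "valid_path \<gamma>" "path_image \<gamma> \<inter> L = {}"
  shows "\<sigma> (pathfinish \<gamma>) = \<sigma> (pathstart \<gamma>) * exp (contour_integral \<gamma> \<zeta>)"
    and "\<sigma> (pathstart \<gamma>) \<noteq> 0"
proof -
  obtain C e where C: "C \<noteq> 0" "e \<notin> L"
    "\<And>\<gamma>. \<lbrakk>valid_path \<gamma>; path_image \<gamma> \<inter> L = {}; pathstart \<gamma> = e\<rbrakk> \<Longrightarrow>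
       \<sigma> (pathfinish \<gamma>) = C * exp (contour_integral \<gamma> \<zeta>)"
    using sigma_eq_exp_zeta by blast
  have "pathstart \<gamma> \<notin> L" using \<gamma>(2) pathstart_in_path_image[of \<gamma>] by blast
  then obtain p where p: "valid_path p" "path_image p \<inter> L = {}" "pathstart p = e" "pathfinish p = pathstart \<gamma>"
    using path_avoiding_lattice[OF C(2)] by metis
  have "\<sigma> (pathfinish (p +++ \<gamma>)) = C * exp (contour_integral (p +++ \<gamma>) \<zeta>)"
    by (rule C) (use p \<gamma> in \<open>auto simp: path_image_join\<close>)
  moreover have "contour_integral (p +++ \<gamma>) \<zeta> = contour_integral p \<zeta> + contour_integral \<gamma> \<zeta>"
    using p \<gamma> by (intro contour_integral_join zeta_contour_integrable) auto
  moreover have s: "\<sigma> (pathstart \<gamma>) = C * exp (contour_integral p \<zeta>)"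
    using C(3)[OF p(1-3)] p(4) by simp
  ultimately show "\<sigma> (pathfinish \<gamma>) = \<sigma> (pathstart \<gamma>) * exp (contour_integral \<gamma> \<zeta>)"
    by (simp add: exp_add)
  show "\<sigma> (pathstart \<gamma>) \<noteq> 0" using s C(1) by simp
qed

lemma sigma_nonzero: "z \<notin> L \<Longrightarrow> \<sigma> z \<noteq> 0"
  using sigma_path(2)[of "linepath z z"] by simp

lemma ln_sigma_path:
  assumes \<gamma>: "valid_path \<gamma>" "path_image \<gamma> \<inter> L = {}"
  shows "ln (cmod (\<sigma> (pathfinish \<gamma>))) - ln (cmod (\<sigma> (pathstart \<gamma>))) = Re (contour_integral \<gamma> \<zeta>)"
  using sigma_path[OF assms] by (simp add: norm_mult ln_mult)

lemma ln_modified_sigma: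
  assumes "z \<notin> L"
  shows "ln (cmod (modified_sigma \<omega>\<^sub>1 \<omega>\<^sub>2 z)) = ln (cmod (\<sigma> z))
     - Re (gamma2 \<omega>\<^sub>1 \<omega>\<^sub>2 / 2 * z\<^sup>2) - pi / (2 * torus_area \<omega>\<^sub>1 \<omega>\<^sub>2) * (cmod z)\<^sup>2"
  using sigma_nonzero[OF assms] by (simp add: modified_sigma_def norm_mult ln_mult)

end

section \<open>Parallelogram grids\<close>

text \<open>The density is continuous, so \<open>Cauchy_next_derivative\<close> allows
  differentiation under the integral sign; the exponent 1 in \<open>int\<close> is the form that it
  expects.\<close>

lemma cauchy_transform_holomorphic:
  assumes "continuous_on (closed_segment a b) g"
  shows "(\<lambda>z. contour_integral (linepath a b) (\<lambda>w. g w / (w - z))) holomorphic_on - closed_segment a b"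
proof -
  let ?f = "\<lambda>z. contour_integral (linepath a b) (\<lambda>w. g w / (w - z))"
  have int: "((\<lambda>w. g w / (w - z) ^ 1) has_contour_integral ?f z) (linepath a b)"
    if "z \<in> UNIV - path_image (linepath a b)" for z
  proof -
    have "(\<lambda>w. g w / (w - z)) contour_integrable_on (linepath a b)"
      using that assms by (intro contour_integrable_continuous_linepath continuous_intros) auto
    then show ?thesis by (simp add: has_contour_integral_integral)
  qed
  have "\<exists>d. (?f has_field_derivative d) (at z)" if "z \<in> - closed_segment a b" for z
    using Cauchy_next_derivative(2)[of "linepath a b" g "norm (b - a)" UNIV 1 ?f z] int that assms
    by auto
  then show ?thesis
    by (subst holomorphic_on_open) (auto simp: open_Compl)
qed

text \<open>Exchanging the integrals leaves, for each \<open>w\<close> on the segment, the loop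
  integral of \<open>1 / (w - z)\<close>, which is -2 pi i times the constant winding
  number.\<close>

lemma has_contour_integral_cauchy_transform:
  assumes \<gamma>: "polynomial_function \<gamma>" "pathfinish \<gamma> = pathstart \<gamma>"
    and disj: "closed_segment a b \<inter> path_image \<gamma> = {}"
    and g: "continuous_on (closed_segment a b) g"
    and c: "\<And>w. w \<in> closed_segment a b \<Longrightarrow> winding_number \<gamma> w = c"
  shows "((\<lambda>z. contour_integral (linepath a b) (\<lambda>w. g w / (w - z))) has_contour_integral
           - (2 * pi * \<i>) * c * contour_integral (linepath a b) g) \<gamma>"
proof -
  let ?e = "linepath a b"
  have vp: "valid_path \<gamma>" using \<gamma> by (simp add: valid_path_polynomial_function)
  have "contour_integral \<gamma> (\<lambda>z. contour_integral ?e (\<lambda>w. g w / (w - z)))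
      = contour_integral ?e (\<lambda>w. contour_integral \<gamma> (\<lambda>z. g w / (w - z)))"
  proof (rule contour_integral_swap)
    have "continuous_on (path_image \<gamma> \<times> path_image ?e) (\<lambda>x. g (snd x) / (snd x - fst x))"
      using disj by (intro continuous_intros continuous_on_compose2[OF g]) auto
    then show "continuous_on (path_image \<gamma> \<times> path_image ?e) (\<lambda>(z, w). g w / (w - z))"
      by (simp add: case_prod_unfold)
    \<comment> \<open>The exchange of integrals needs a continuous velocity, which is why the loops
      are polynomial.\<close>
    obtain p' where p': "polynomial_function p'" "\<And>x. (\<gamma> has_vector_derivative p' x) (at x)"
      using has_vector_derivative_polynomial_function[OF \<gamma>(1)] by blast
    have eq: "(\<lambda>t. vector_derivative \<gamma> (at t)) = p'"
      using p'(2) by (auto simp: vector_derivative_at)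
    show "continuous_on {0..1} (\<lambda>t. vector_derivative \<gamma> (at t))"
      unfolding eq using p'(1) by (rule continuous_on_polymonial_function)
  qed (use vp in auto)
  also have "\<dots> = contour_integral ?e (\<lambda>w. - (2 * pi * \<i>) * c * g w)"
  proof (rule contour_integral_cong)
    fix w assume w: "w \<in> path_image ?e"
    then have "w \<notin> path_image \<gamma>" using disj by auto
    then have "((\<lambda>z. 1 / (z - w)) has_contour_integral 2 * pi * \<i> * c) \<gamma>"
      using has_contour_integral_winding_number[OF vp] c w by auto
    then have "((\<lambda>z. - g w * (1 / (z - w))) has_contour_integral - g w * (2 * pi * \<i> * c)) \<gamma>"
      by (rule has_contour_integral_lmul)
    moreover have "- g w * (1 / (z - w)) = g w / (w - z)" for z
      by (metis minus_diff_eq minus_divide_left minus_divide_right times_divide_eq_right mult.right_neutral)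
    ultimately show "contour_integral \<gamma> (\<lambda>z. g w / (w - z)) = - (2 * pi * \<i>) * c * g w"
      using contour_integral_unique by (fastforce simp: mult_ac)
  qed auto
  also have "\<dots> = - (2 * pi * \<i>) * c * contour_integral ?e g"
    using g by (intro contour_integral_lmul contour_integrable_continuous_linepath)
  finally have eq: "contour_integral \<gamma> (\<lambda>z. contour_integral ?e (\<lambda>w. g w / (w - z)))
     = - (2 * pi * \<i>) * c * contour_integral ?e g" .
  have "(\<lambda>z. contour_integral ?e (\<lambda>w. g w / (w - z))) contour_integrable_on \<gamma>"
    by (rule contour_integrable_holomorphic_simple[OF cauchy_transform_holomorphic[OF g] _ vp])
      (use disj in \<open>auto simp: open_Compl\<close>)
  then show ?thesis using eq has_contour_integral_integral by metis
qed

section \<open>Telescoping over grids and integrals along grid edges\<close>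

lemma sum_telescope_int:
  fixes f :: "int \<Rightarrow> 'a::ab_group_add"
  assumes "a \<le> b"
  shows "(\<Sum>n\<in>{a..<b}. f (n + 1) - f n) = f b - f a"
  using assms
proof (induction b rule: int_ge_induct)
  case (step i)
  have "{a..<i + 1} = insert i {a..<i}" using step by auto
  then show ?case using step by simp
qed auto

text \<open>Every interior edge borders two cells and enters with opposite signs, so only the rim of
  the square survives. \<open>H\<close> and \<open>V\<close> stand for the edges in the two grid
  directions.\<close>

lemma sum_grid_telescope:
  fixes H V :: "int \<Rightarrow> int \<Rightarrow> 'a::ab_group_add"
  assumes "a \<le> b"
  shows "(\<Sum>m\<in>{a..<b}. \<Sum>n\<in>{a..<b}. H m n + V (m + 1) n - H m (n + 1) - V m n)
    = (\<Sum>m\<in>{a..<b}. H m a - H m b) + (\<Sum>n\<in>{a..<b}. V b n - V a n)"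
proof -
  have "(\<Sum>m\<in>{a..<b}. \<Sum>n\<in>{a..<b}. H m n + V (m + 1) n - H m (n + 1) - V m n)
     = (\<Sum>m\<in>{a..<b}. \<Sum>n\<in>{a..<b}. (V (m + 1) n - V m n) - (H m (n + 1) - H m n))"
    by (intro sum.cong) (auto simp: algebra_simps)
  also have "\<dots> = (\<Sum>m\<in>{a..<b}. \<Sum>n\<in>{a..<b}. V (m + 1) n - V m n) -
      (\<Sum>m\<in>{a..<b}. \<Sum>n\<in>{a..<b}. H m (n + 1) - H m n)"
    by (simp only: sum_subtractf)
  also have "(\<Sum>m\<in>{a..<b}. \<Sum>n\<in>{a..<b}. V (m + 1) n - V m n)
      = (\<Sum>n\<in>{a..<b}. \<Sum>m\<in>{a..<b}. V (m + 1) n - V m n)"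
    by (rule sum.swap)
  also have "(\<Sum>n\<in>{a..<b}. \<Sum>m\<in>{a..<b}. V (m + 1) n - V m n) - (\<Sum>m\<in>{a..<b}. \<Sum>n\<in>{a..<b}. H m (n + 1) - H m n)
      = (\<Sum>n\<in>{a..<b}. V b n - V a n) - (\<Sum>m\<in>{a..<b}. H m b - H m a)"
    using sum_telescope_int[OF assms, of "\<lambda>m. V m _"] sum_telescope_int[OF assms, of "H _"] by simp
  also have "\<dots> = (\<Sum>m\<in>{a..<b}. H m a - H m b) + (\<Sum>n\<in>{a..<b}. V b n - V a n)"
    by (simp add: sum_subtractf)
  finally show ?thesis .
qed

text \<open>An edge that leaves \<open>D\<close> counts as zero as a whole, so neighbouring cells
  agree on each shared edge and sums over cells telescope even across cells that are not contained
  in \<open>D\<close>.\<close>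

definition edge_integral :: "complex set \<Rightarrow> complex \<Rightarrow> complex \<Rightarrow> (complex \<Rightarrow> complex) \<Rightarrow> complex" where
  "edge_integral D a b f = (if closed_segment a b \<subseteq> D then contour_integral (linepath a b) f else 0)"

lemma isCont_edge_integral:
  assumes "continuous_on D g" "z \<notin> closed_segment a b"
  shows "isCont (\<lambda>z. edge_integral D a b (\<lambda>w. g w / (w - z))) z"
proof (cases "closed_segment a b \<subseteq> D")
  case True
  then have "continuous_on (closed_segment a b) g" using assms continuous_on_subset by blast
  from holomorphic_on_imp_continuous_on[OF cauchy_transform_holomorphic[OF this]]
  show ?thesis
    using True assms(2) by (simp add: edge_integral_def continuous_on_eq_continuous_at open_Compl)
qed (simp add: edge_integral_def)

lemma has_contour_integral_edge_integral:
  assumes "polynomial_function \<gamma>" "pathfinish \<gamma> = pathstart \<gamma>"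
    and "closed_segment a b \<inter> path_image \<gamma> = {}" and g: "continuous_on D g"
    and "\<And>w. w \<in> closed_segment a b \<Longrightarrow> winding_number \<gamma> w = c"
  shows "((\<lambda>z. edge_integral D a b (\<lambda>w. g w / (w - z))) has_contour_integral
           - (2 * pi * \<i>) * c * edge_integral D a b g) \<gamma>"
proof (cases "closed_segment a b \<subseteq> D")
  case True
  then have "continuous_on (closed_segment a b) g" using g continuous_on_subset by blast
  then show ?thesis
    using has_contour_integral_cauchy_transform[OF assms(1-3) _ assms(5)] True by (simp add: edge_integral_def)
qed (simp add: edge_integral_def has_contour_integral_0)

lemma edge_integral_translate:
  assumes "\<And>z. z + v \<in> D \<longleftrightarrow> z \<in> D" "\<And>z. z \<in> D \<Longrightarrow> g (z + v) = g z"
  shows "edge_integral D (a + v) (b + v) g = edge_integral D a b g"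
proof -
  have seg: "closed_segment (a + v) (b + v) = (\<lambda>z. z + v) ` closed_segment a b"
    using closed_segment_translation[of v a b] by (simp add: add.commute)
  have eq: "linepath (a + v) (b + v) = (\<lambda>t. linepath a b t + v)"
    by (rule ext) (simp add: linepath_def algebra_simps)
  have "contour_integral (linepath (a + v) (b + v)) g = contour_integral (linepath a b) (\<lambda>z. g (z + v))"
    by (simp add: eq contour_integral_translate)
  also have "\<dots> = contour_integral (linepath a b) g" if "closed_segment a b \<subseteq> D"
    using that assms(2) by (intro contour_integral_cong) auto
  finally show ?thesis
    using assms(1) by (auto simp: edge_integral_def seg)
qed

section \<open>Grid cells, their boundaries and Cauchy's theorem on them\<close>

context complex_basis
begin

lemma linear_coord: "linear coord1" "linear coord2"
  by (intro linearI; simp add: coord1_def coord2_def algebra_simps add_divide_distrib diff_divide_distrib)+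

lemma continuous_coord: "continuous_on S coord1" "continuous_on S coord2"
  by (simp_all add: linear_continuous_on linear_linear linear_coord)

definition coord_box :: "real set \<Rightarrow> real set \<Rightarrow> complex set" where
  "coord_box X Y = {z. coord1 z \<in> X \<and> coord2 z \<in> Y}"

lemma coord_box_Int: "coord_box X Y = coord1 -` X \<inter> coord2 -` Y"
  by (auto simp: coord_box_def)

lemma convex_coord_box: "convex X \<Longrightarrow> convex Y \<Longrightarrow> convex (coord_box X Y)"
  unfolding coord_box_Int by (intro convex_Int convex_linear_vimage linear_coord)

lemma open_coord_box: "open X \<Longrightarrow> open Y \<Longrightarrow> open (coord_box X Y)"
  unfolding coord_box_Int by (intro open_Int open_vimage continuous_coord)

definition node :: "int \<Rightarrow> int \<Rightarrow> complex" where
  "node m n = of_int m * \<alpha> + of_int n * \<beta>"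

lemma coord_node [simp]: "coord1 (node m n) = of_int m" "coord2 (node m n) = of_int n"
  using coord1_comb[of "of_int m" "of_int n"] coord2_comb[of "of_int m" "of_int n"]
  by (simp_all add: node_def)

lemma node_add: "node (m + i) (n + j) = node m n + node i j"
  by (simp add: node_def algebra_simps)

definition cell :: "int \<Rightarrow> int \<Rightarrow> complex set" where
  "cell m n = coord_box {of_int m..of_int m + 1} {of_int n..of_int n + 1}"

lemma convex_cell: "convex (cell m n)"
  unfolding cell_def by (intro convex_coord_box) auto

lemma node_in_cell: "node m n \<in> cell m n" "node (m + 1) n \<in> cell m n"
  "node m (n + 1) \<in> cell m n" "node (m + 1) (n + 1) \<in> cell m n"
  by (auto simp: cell_def coord_box_def)

lemma cell_shift: "z \<in> cell m n \<Longrightarrow> z + node i j \<in> cell (m + i) (n + j)"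
  by (auto simp: cell_def coord_box_def)

lemma edge_subset_cell:
  "closed_segment (node m n) (node (m + 1) n) \<subseteq> cell m n"
  "closed_segment (node (m + 1) n) (node (m + 1) (n + 1)) \<subseteq> cell m n"
  "closed_segment (node m (n + 1)) (node (m + 1) (n + 1)) \<subseteq> cell m n"
  "closed_segment (node m n) (node m (n + 1)) \<subseteq> cell m n"
  by (simp_all add: closed_segment_subset node_in_cell convex_cell)

lemma cell_diameter:
  assumes "z \<in> cell m n" "w \<in> cell m n"
  shows "norm (z - w) \<le> norm \<alpha> + norm \<beta>"
proof -
  have "z - w = (of_real (coord1 z) * \<alpha> + of_real (coord2 z) * \<beta>) - (of_real (coord1 w) * \<alpha> + of_real (coord2 w) * \<beta>)"
    by (simp only: coord_decomp)
  also have "\<dots> = of_real (coord1 z - coord1 w) * \<alpha> + of_real (coord2 z - coord2 w) * \<beta>"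
    by (simp add: algebra_simps)
  also have "norm \<dots> \<le> 1 * norm \<alpha> + 1 * norm \<beta>"
    unfolding norm_mult norm_of_real
    using assms by (intro order_trans[OF norm_triangle_ineq] add_mono)
      (auto simp: norm_mult cell_def coord_box_def abs_le_iff simp flip: of_real_diff intro!: mult_left_le_one_le)
  finally show ?thesis by simp
qed

definition boundary :: "int \<Rightarrow> int \<Rightarrow> real \<Rightarrow> complex" where
  "boundary m n = linepath (node m n) (node (m + 1) n) +++ linepath (node (m + 1) n) (node (m + 1) (n + 1)) +++
     linepath (node (m + 1) (n + 1)) (node m (n + 1)) +++ linepath (node m (n + 1)) (node m n)"

lemma boundary_simps [simp]: "valid_path (boundary m n)" "path (boundary m n)"
    "pathstart (boundary m n) = node m n" "pathfinish (boundary m n) = node m n"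
  by (auto simp: boundary_def valid_path_join)

lemma path_image_boundary: "path_image (boundary m n) =
    closed_segment (node m n) (node (m + 1) n) \<union> closed_segment (node (m + 1) n) (node (m + 1) (n + 1)) \<union>
    closed_segment (node m (n + 1)) (node (m + 1) (n + 1)) \<union> closed_segment (node m n) (node m (n + 1))"
  by (auto simp: boundary_def path_image_join closed_segment_commute)

lemma boundary_coords:
  assumes "w \<in> path_image (boundary m n)"
  shows "w \<in> cell m n \<and> (coord1 w \<in> {of_int m, of_int m + 1} \<or> coord2 w \<in> {of_int n, of_int n + 1})"
proof -
  have *: "closed_segment x y \<subseteq> coord_box {c} UNIV" if "coord1 x = c" "coord1 y = c" for x y c
    using that by (intro closed_segment_subset convex_coord_box) (auto simp: coord_box_def)
  have **: "closed_segment x y \<subseteq> coord_box UNIV {c}" if "coord2 x = c" "coord2 y = c" for x y c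
    using that by (intro closed_segment_subset convex_coord_box) (auto simp: coord_box_def)
  show ?thesis
    using assms edge_subset_cell[of m n] *[of "node m n" "of_int m" "node m (n + 1)"]
      *[of "node (m + 1) n" "of_int m + 1" "node (m + 1) (n + 1)"]
      **[of "node m n" "of_int n" "node (m + 1) n"] **[of "node m (n + 1)" "of_int n + 1" "node (m + 1) (n + 1)"]
    unfolding path_image_boundary by (auto simp: coord_box_def)
qed

text \<open>The quantity R(Q) of the overview. The edges are those of \<open>boundary\<close>, the
  last two reversed so that adjacent cells use identical edge integrals.\<close>

definition cell_sum :: "complex set \<Rightarrow> (complex \<Rightarrow> complex) \<Rightarrow> int \<Rightarrow> int \<Rightarrow> complex" where
  "cell_sum D f m n = edge_integral D (node m n) (node (m + 1) n) f
     + edge_integral D (node (m + 1) n) (node (m + 1) (n + 1)) f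
     - edge_integral D (node m (n + 1)) (node (m + 1) (n + 1)) f
     - edge_integral D (node m n) (node m (n + 1)) f"

lemma has_contour_integral_boundary:
  assumes "cell m n \<subseteq> D" "continuous_on (path_image (boundary m n)) f"
  shows "(f has_contour_integral cell_sum D f m n) (boundary m n)"
proof -
  have i: "f contour_integrable_on linepath (node m n) (node (m + 1) n)"
    "f contour_integrable_on linepath (node (m + 1) n) (node (m + 1) (n + 1))"
    "f contour_integrable_on linepath (node m (n + 1)) (node (m + 1) (n + 1))"
    "f contour_integrable_on linepath (node m n) (node m (n + 1))"
    using assms(2) unfolding path_image_boundary
    by (auto intro!: contour_integrable_continuous_linepath intro: continuous_on_subset)
  have r: "(f has_contour_integral - contour_integral (linepath b a) f) (linepath a b)"
    if "f contour_integrable_on linepath b a" for a b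
    using has_contour_integral_reversepath[OF _ has_contour_integral_integral[OF that]] by simp
  have "(f has_contour_integral contour_integral (linepath (node m n) (node (m + 1) n)) f
     + (contour_integral (linepath (node (m + 1) n) (node (m + 1) (n + 1))) f
     + (- contour_integral (linepath (node m (n + 1)) (node (m + 1) (n + 1))) f
     + - contour_integral (linepath (node m n) (node m (n + 1))) f))) (boundary m n)"
    unfolding boundary_def
    by (intro has_contour_integral_join has_contour_integral_integral i r) (auto simp: valid_path_join)
  moreover have "closed_segment (node m n) (node (m + 1) n) \<subseteq> D"
    "closed_segment (node (m + 1) n) (node (m + 1) (n + 1)) \<subseteq> D"
    "closed_segment (node m (n + 1)) (node (m + 1) (n + 1)) \<subseteq> D"
    "closed_segment (node m n) (node m (n + 1)) \<subseteq> D"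
    using edge_subset_cell[of m n] assms(1) by blast+
  ultimately show ?thesis by (simp add: cell_sum_def edge_integral_def algebra_simps)
qed

text \<open>Equal to \<open>1\<close> or \<open>-1\<close> depending on the orientation of the basis. The base point is the centroid
  of one of the two triangles into which a diagonal divides the cell.\<close>

definition orient :: complex where
  "orient = winding_number (boundary 0 0) (of_real (2/3) * \<alpha> + of_real (1/3) * \<beta>)"

text \<open>Translation reduces to the cell at the origin, whose interior is connected and disjoint
  from the boundary.\<close>

lemma winding_number_boundary:
  assumes "z \<in> coord_box {of_int m<..<of_int m + 1} {of_int n<..<of_int n + 1}"
  shows "winding_number (boundary m n) z = orient"
proof -
  let ?z = "z - node m n"
  let ?B = "coord_box {0<..<1} {0<..<1}"
  have "(\<lambda>t. boundary m n t - z) = (\<lambda>t. boundary 0 0 t - ?z)"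
    by (rule ext) (simp add: boundary_def joinpaths_def linepath_def node_def algebra_simps)
  then have "winding_number (boundary m n) z = winding_number (boundary 0 0) ?z"
    using winding_number_offset[of "boundary m n" z] winding_number_offset[of "boundary 0 0" ?z] by metis
  also have "\<dots> = orient"
    unfolding orient_def
  proof (rule winding_number_eq[where S = ?B])
    have "coord1 ?z = coord1 z - of_int m" "coord2 ?z = coord2 z - of_int n"
      using coord_add[of ?z "node m n"] by auto
    then show "?z \<in> ?B" using assms by (simp add: coord_box_def)
    show "of_real (2/3) * \<alpha> + of_real (1/3) * \<beta> \<in> ?B" unfolding coord_box_def mem_Collect_eq coord1_comb coord2_comb by simp
    show "connected ?B" by (intro convex_connected convex_coord_box) auto
    show "?B \<inter> path_image (boundary 0 0) = {}"
      using boundary_coords[of _ 0 0] by (force simp: coord_box_def)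
  qed auto
  finally show ?thesis .
qed

text \<open>The diagonal from 0 to \<alpha> + \<beta> splits the boundary into two triangles. The
  one around the base point contributes 1 or -1; the other lies in a half-plane that misses the
  point and contributes 0.\<close>

lemma orient_nonzero: "orient \<noteq> 0"
proof -
  let ?z = "of_real (2/3) * \<alpha> + of_real (1/3) * \<beta>"
  have c: "coord1 ?z = 2/3" "coord2 ?z = 1/3" using coord1_comb coord2_comb by blast+
  have nodes: "node 0 0 = 0" "node 1 0 = \<alpha>" "node 1 1 = \<alpha> + \<beta>" "node 0 1 = \<beta>"
    by (simp_all add: node_def)
  have cn: "coord1 0 = 0" "coord2 0 = 0" "coord1 \<alpha> = 1" "coord2 \<alpha> = 0" "coord1 \<beta> = 0" "coord2 \<beta> = 1"
    using coord_node[of 0 0] coord_node[of 1 0] coord_node[of 0 1] by (auto simp: nodes)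
  \<comment> \<open>The closed half-plane beyond the diagonal: it contains 0, \<beta> and \<alpha> +
    \<beta> but not the base point.\<close>
  let ?T = "{z. coord1 z \<le> coord2 z}"
  have "convex ((\<lambda>z. coord1 z - coord2 z) -` {..0})"
    by (intro convex_linear_vimage linear_compose_sub linear_coord) auto
  moreover have "(\<lambda>z. coord1 z - coord2 z) -` {..0} = ?T" by auto
  ultimately have cT: "convex ?T" by simp
  have zT: "?z \<notin> ?T" using c by simp
  have zin: "?z \<notin> closed_segment x y" if "x \<in> ?T" "y \<in> ?T" for x y
    using closed_segment_subset[OF that cT] zT by blast
  have off: "?z \<notin> closed_segment 0 \<alpha>" "?z \<notin> closed_segment \<alpha> (\<alpha> + \<beta>)"
  proof -
    have "?z \<notin> path_image (boundary 0 0)"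
      using boundary_coords[of ?z 0 0] c by auto
    then show "?z \<notin> closed_segment 0 \<alpha>" "?z \<notin> closed_segment \<alpha> (\<alpha> + \<beta>)"
      by (simp_all add: path_image_boundary nodes)
  qed
  note off' = off zin[of 0 "\<alpha> + \<beta>"] zin[of "\<alpha> + \<beta>" 0] zin[of "\<alpha> + \<beta>" \<beta>] zin[of \<beta> 0]
  have w: "orient = winding_number (linepath 0 \<alpha>) ?z + winding_number (linepath \<alpha> (\<alpha> + \<beta>)) ?z +
       winding_number (linepath (\<alpha> + \<beta>) \<beta>) ?z + winding_number (linepath \<beta> 0) ?z"
    unfolding orient_def boundary_def using off' cn
    by (simp add: nodes winding_number_join path_image_join del: of_real_divide)
  have "winding_number (linepath 0 (\<alpha> + \<beta>) +++ linepath (\<alpha> + \<beta>) \<beta> +++ linepath \<beta> 0) ?z = 0"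
  proof (rule winding_number_zero_outside[OF _ cT])
    show "path_image (linepath 0 (\<alpha> + \<beta>) +++ linepath (\<alpha> + \<beta>) \<beta> +++ linepath \<beta> 0) \<subseteq> ?T"
      using cT cn by (simp add: path_image_join closed_segment_subset)
  qed (use zT in auto)
  then have t2: "winding_number (linepath 0 (\<alpha> + \<beta>)) ?z + winding_number (linepath (\<alpha> + \<beta>) \<beta>) ?z + winding_number (linepath \<beta> 0) ?z = 0"
    using off' cn by (simp add: winding_number_join path_image_join add.assoc del: of_real_divide)
  have "?z \<in> interior (convex hull {0, \<alpha>, \<alpha> + \<beta>})"
  proof (rule interiorI)
    \<comment> \<open>The open triangle with vertices 0, \<alpha> and \<alpha> + \<beta>, cut out by
      strict inequalities between the coordinates.\<close>
    let ?W = "{z. coord2 z < coord1 z} \<inter> coord_box {..<1} {0<..}"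
    show "open ?W" by (intro open_Int open_coord_box open_Collect_less continuous_coord) auto
    show "?z \<in> ?W" using c by (simp add: coord_box_def)
    show "?W \<subseteq> convex hull {0, \<alpha>, \<alpha> + \<beta>}"
    proof
      fix z assume z: "z \<in> ?W"
      have "z = (1 - coord1 z) *\<^sub>R 0 + (coord1 z - coord2 z) *\<^sub>R \<alpha> + coord2 z *\<^sub>R (\<alpha> + \<beta>)"
        by (subst coord_decomp[of z, symmetric]) (simp add: scaleR_conv_of_real algebra_simps)
      then show "z \<in> convex hull {0, \<alpha>, \<alpha> + \<beta>}"
        unfolding convex_hull_3 using z by (fastforce simp: coord_box_def)
    qed
  qed
  then have "winding_number (linepath 0 \<alpha> +++ linepath \<alpha> (\<alpha> + \<beta>) +++ linepath (\<alpha> + \<beta>) 0) ?z \<in> {1, -1}"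
    by (subst winding_number_triangle) auto
  then have t1: "winding_number (linepath 0 \<alpha>) ?z + winding_number (linepath \<alpha> (\<alpha> + \<beta>)) ?z + winding_number (linepath (\<alpha> + \<beta>) 0) ?z \<in> {1, -1}"
    using off' cn by (simp add: winding_number_join path_image_join add.assoc del: of_real_divide)
  have rev: "winding_number (linepath (\<alpha> + \<beta>) 0) ?z = - winding_number (linepath 0 (\<alpha> + \<beta>)) ?z"
    using winding_number_reversepath[of "linepath 0 (\<alpha> + \<beta>)" ?z] off' cn by (simp del: of_real_divide)
  have "orient = (winding_number (linepath 0 \<alpha>) ?z + winding_number (linepath \<alpha> (\<alpha> + \<beta>)) ?z + winding_number (linepath (\<alpha> + \<beta>) 0) ?z)
    + (winding_number (linepath 0 (\<alpha> + \<beta>)) ?z + winding_number (linepath (\<alpha> + \<beta>) \<beta>) ?z + winding_number (linepath \<beta> 0) ?z)"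
    unfolding w rev by simp
  then show ?thesis using t1 t2 by auto
qed

lemma cell_sum_eq_0:
  assumes "g holomorphic_on D" "cell m n \<subseteq> D"
  shows "cell_sum D g m n = 0"
proof -
  have g: "g holomorphic_on cell m n" using assms holomorphic_on_subset by blast
  have sub: "path_image (boundary m n) \<subseteq> cell m n" using boundary_coords by blast
  have "(g has_contour_integral 0) (boundary m n)"
    using Cauchy_theorem_convex_simple[OF g convex_cell _ sub] by simp
  moreover have "(g has_contour_integral cell_sum D g m n) (boundary m n)"
    using has_contour_integral_boundary[OF assms(2)] g sub
      holomorphic_on_imp_continuous_on continuous_on_subset by blast
  ultimately show ?thesis using has_contour_integral_unique by blast
qed

text \<open>Non-integer coordinates keep \<open>z\<close> off all grid lines: either it is interior
  to the cell and Cauchy's integral formula applies, or the quotient is holomorphic on the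
  cell.\<close>

lemma cell_sum_cauchy:
  assumes "g holomorphic_on D" "cell m n \<subseteq> D" and z: "coord1 z \<notin> \<int>" "coord2 z \<notin> \<int>"
  shows "cell_sum D (\<lambda>w. g w / (w - z)) m n = (if z \<in> cell m n then 2 * pi * \<i> * orient * g z else 0)"
proof -
  have g: "g holomorphic_on cell m n" using assms holomorphic_on_subset by blast
  have sub: "path_image (boundary m n) \<subseteq> cell m n" using boundary_coords by blast
  have zn: "z \<notin> path_image (boundary m n)"
    using boundary_coords[of z m n] z by (auto intro: Ints_add)
  have "continuous_on (path_image (boundary m n)) (\<lambda>w. g w / (w - z))"
    using zn holomorphic_on_imp_continuous_on[OF holomorphic_on_subset[OF g sub]]
    by (intro continuous_intros) auto
  then have 1: "((\<lambda>w. g w / (w - z)) has_contour_integral cell_sum D (\<lambda>w. g w / (w - z)) m n) (boundary m n)"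
    by (rule has_contour_integral_boundary[OF assms(2)])
  show ?thesis
  proof (cases "z \<in> cell m n")
    case True
    have "coord1 z \<noteq> of_int m" "coord1 z \<noteq> of_int (m + 1)" "coord2 z \<noteq> of_int n" "coord2 z \<noteq> of_int (n + 1)"
      using z Ints_of_int by metis+
    then have zb: "z \<in> coord_box {of_int m<..<of_int m + 1} {of_int n<..<of_int n + 1}"
      using True by (auto simp: cell_def coord_box_def)
    have "z \<in> interior (cell m n)"
    proof (rule interiorI[OF _ zb])
      show "open (coord_box {real_of_int m<..<of_int m + 1} {real_of_int n<..<of_int n + 1})"
        by (intro open_coord_box) auto
    qed (auto simp: cell_def coord_box_def)
    from Cauchy_integral_formula_convex_simple[OF convex_cell g this, of "boundary m n"]
    have "((\<lambda>w. g w / (w - z)) has_contour_integral (2 * pi * \<i> * orient * g z)) (boundary m n)"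
      using sub zn winding_number_boundary[OF zb] by auto
    then show ?thesis using True has_contour_integral_unique[OF 1] by simp
  next
    case False
    have "(\<lambda>w. g w / (w - z)) holomorphic_on cell m n"
      using False g by (intro holomorphic_intros) auto
    from Cauchy_theorem_convex_simple[OF this convex_cell _ sub]
    show ?thesis using False has_contour_integral_unique[OF 1] by simp
  qed
qed

lemma in_cell_iff_floor:
  assumes "coord1 z \<notin> \<int>" "coord2 z \<notin> \<int>"
  shows "z \<in> cell m n \<longleftrightarrow> m = \<lfloor>coord1 z\<rfloor> \<and> n = \<lfloor>coord2 z\<rfloor>"
proof -
  have *: "of_int k \<le> x \<and> x \<le> of_int k + 1 \<longleftrightarrow> k = \<lfloor>x\<rfloor>" if "x \<notin> \<int>" for x :: real and k
  proof -
    have "x \<noteq> of_int (k + 1)" using that Ints_of_int by metis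
    then have "of_int k \<le> x \<and> x \<le> of_int k + 1 \<longleftrightarrow> of_int k \<le> x \<and> x < of_int k + 1" by auto
    then show ?thesis by (simp add: floor_eq_iff eq_commute[of k])
  qed
  show ?thesis using *[OF assms(1), of m] *[OF assms(2), of n] by (auto simp: cell_def coord_box_def)
qed

lemma cell_sum_grid:
  assumes "a \<le> b"
  shows "(\<Sum>m\<in>{a..<b}. \<Sum>n\<in>{a..<b}. cell_sum D f m n)
    = (\<Sum>m\<in>{a..<b}. edge_integral D (node m a) (node (m + 1) a) f - edge_integral D (node m b) (node (m + 1) b) f)
    + (\<Sum>n\<in>{a..<b}. edge_integral D (node b n) (node b (n + 1)) f - edge_integral D (node a n) (node a (n + 1)) f)"
  unfolding cell_sum_def
  using sum_grid_telescope[OF assms, of "\<lambda>m n. edge_integral D (node m n) (node (m + 1) n) f"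
      "\<lambda>m n. edge_integral D (node m n) (node m (n + 1)) f"] by simp

text \<open>The cell is connected and misses the loop, so one sample point gives the winding number
  along all its edges.\<close>

lemma has_contour_integral_cell_sum:
  assumes "polynomial_function \<gamma>" "pathfinish \<gamma> = pathstart \<gamma>" "continuous_on D g"
    and disj: "cell m n \<inter> path_image \<gamma> = {}" and p: "p \<in> cell m n"
  shows "((\<lambda>z. cell_sum D (\<lambda>w. g w / (w - z)) m n) has_contour_integral
      - (2 * pi * \<i>) * winding_number \<gamma> p * cell_sum D g m n) \<gamma>"
proof -
  have n: "winding_number \<gamma> w = winding_number \<gamma> p" if "w \<in> cell m n" for w
    using winding_number_eq[of \<gamma> w "cell m n" p] that p disj assms convex_connected[OF convex_cell]
    by (auto simp: path_polynomial_function)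
  have e: "((\<lambda>z. edge_integral D a b (\<lambda>w. g w / (w - z))) has_contour_integral
           - (2 * pi * \<i>) * winding_number \<gamma> p * edge_integral D a b g) \<gamma>"
    if "closed_segment a b \<subseteq> cell m n" for a b
    using that disj n by (intro has_contour_integral_edge_integral assms) auto
  show ?thesis
    unfolding cell_sum_def right_diff_distrib distrib_left
    by (intro has_contour_integral_add has_contour_integral_diff e edge_subset_cell)
qed

lemma isCont_cell_sum:
  assumes "continuous_on D g" "z \<notin> cell m n"
  shows "isCont (\<lambda>z. cell_sum D (\<lambda>w. g w / (w - z)) m n) z"
  unfolding cell_sum_def
  using assms edge_subset_cell[of m n] by (intro continuous_intros isCont_edge_integral) auto

text \<open>Cauchy's formula for the cells contained in \<open>D\<close> and telescoping express \<open>g\<close> on the loop as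
  a sum of Cauchy transforms over the edges of the remaining cells; integrating along the loop
  replaces the Cauchy kernel by the winding number.\<close>

lemma contour_integral_grid:
  assumes D: "g holomorphic_on D"
    and \<gamma>: "polynomial_function \<gamma>" "pathfinish \<gamma> = pathstart \<gamma>" "path_image \<gamma> \<subseteq> D"
    and fine: "\<And>m n. cell m n \<subseteq> D \<or> cell m n \<inter> path_image \<gamma> = {}"
    and M: "0 \<le> M" "path_image \<gamma> \<subseteq> coord_box {-of_int M<..<of_int M} {-of_int M<..<of_int M}"
    and D': "open D"
    and p: "\<And>m n. p m n \<in> cell m n"
  shows "orient * contour_integral \<gamma> g =
     (\<Sum>m\<in>{-M..<M}. \<Sum>n\<in>{-M..<M}. winding_number \<gamma> (p m n) * cell_sum D g m n)"
proof -
  let ?I = "{-M..<M}" and ?c = "2 * of_real pi * \<i> :: complex"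
  let ?B = "coord_box {-of_int M<..<of_int M} {-of_int M<..<of_int M}"
  define K where "K z w = g w / (w - z)" for z w
  define bad where "bad m n \<longleftrightarrow> \<not> cell m n \<subseteq> D" for m n
  \<comment> \<open>The rim terms that survive telescoping; \<open>inner\<close> gathers the cells
    not contained in \<open>D\<close>.\<close>
  define outer where "outer z =
    (\<Sum>m\<in>?I. edge_integral D (node m (-M)) (node (m + 1) (-M)) (K z) - edge_integral D (node m M) (node (m + 1) M) (K z))
    + (\<Sum>n\<in>?I. edge_integral D (node M n) (node M (n + 1)) (K z) - edge_integral D (node (-M) n) (node (-M) (n + 1)) (K z))" for z
  define inner where "inner z = (\<Sum>m\<in>?I. \<Sum>n\<in>?I. if bad m n then cell_sum D (K z) m n else 0)" for z
  have cont: "continuous_on D g" using D by (rule holomorphic_on_imp_continuous_on)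
  have vp: "valid_path \<gamma>" using \<gamma>(1) by (rule valid_path_polynomial_function)
  \<comment> \<open>Sum of \<open>cell_sum_cauchy\<close> over all cells: among those contained in
    \<open>D\<close>, only the cell of \<open>z\<close> contributes, and it yields
    \<open>g z\<close>.\<close>
  have generic: "?c * orient * g z + inner z = outer z"
    if z: "coord1 z \<notin> \<int>" "coord2 z \<notin> \<int>" and c: "cell \<lfloor>coord1 z\<rfloor> \<lfloor>coord2 z\<rfloor> \<subseteq> D" and B: "z \<in> ?B" for z
  proof -
    let ?m = "\<lfloor>coord1 z\<rfloor>" and ?n = "\<lfloor>coord2 z\<rfloor>"
    have mn: "?m \<in> ?I" "?n \<in> ?I" using B by (auto simp: coord_box_def le_floor_iff floor_less_iff)
    have "outer z = (\<Sum>m\<in>?I. \<Sum>n\<in>?I. cell_sum D (K z) m n)"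
      unfolding outer_def using M(1) by (subst cell_sum_grid) auto
    also have "\<dots> = (\<Sum>m\<in>?I. \<Sum>n\<in>?I. (if bad m n then cell_sum D (K z) m n else 0) +
         (if m = ?m then if n = ?n then ?c * orient * g z else 0 else 0))"
    proof (intro sum.cong refl)
      fix m n
      show "cell_sum D (K z) m n = (if bad m n then cell_sum D (K z) m n else 0) +
         (if m = ?m then if n = ?n then ?c * orient * g z else 0 else 0)"
      proof (cases "bad m n")
        case True
        then have "\<not> (m = ?m \<and> n = ?n)" using c by (auto simp: bad_def)
        then show ?thesis using True by auto
      next
        case False
        then have "cell m n \<subseteq> D" by (simp add: bad_def)
        from cell_sum_cauchy[OF D this z] show ?thesis
          using False in_cell_iff_floor[OF z, of m n] by (auto simp: K_def[abs_def])
      qed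
    qed
    also have "\<dots> = inner z + (\<Sum>m\<in>?I. \<Sum>n\<in>?I. if m = ?m then if n = ?n then ?c * orient * g z else 0 else 0)"
      by (simp only: sum.distrib inner_def)
    also have "(\<Sum>m\<in>?I. \<Sum>n\<in>?I. if m = ?m then if n = ?n then ?c * orient * g z else 0 else 0)
       = (\<Sum>m\<in>?I. if m = ?m then (\<Sum>n\<in>?I. if n = ?n then ?c * orient * g z else 0) else 0)"
      by (intro sum.cong) auto
    also have "\<dots> = ?c * orient * g z"
      using mn by (simp only: sum.delta finite_atLeastLessThan_int if_True)
    finally show ?thesis by (simp add: add.commute)
  qed
  have outside: "z \<notin> ?B" if "z \<in> closed_segment a b"
     "coord1 a = c \<and> coord1 b = c \<or> coord2 a = c \<and> coord2 b = c" "\<bar>c\<bar> = of_int M" for z a b c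
  proof -
    have "closed_segment a b \<subseteq> coord_box {c} UNIV \<or> closed_segment a b \<subseteq> coord_box UNIV {c}"
      using that(2)
    proof
      assume "coord1 a = c \<and> coord1 b = c"
      then have "closed_segment a b \<subseteq> coord_box {c} UNIV"
        by (intro closed_segment_subset convex_coord_box) (auto simp: coord_box_def)
      then show ?thesis ..
    next
      assume "coord2 a = c \<and> coord2 b = c"
      then have "closed_segment a b \<subseteq> coord_box UNIV {c}"
        by (intro closed_segment_subset convex_coord_box) (auto simp: coord_box_def)
      then show ?thesis ..
    qed
    then show ?thesis using that(1,3) by (auto simp: coord_box_def abs_if split: if_splits)
  qed
  have on_path: "?c * orient * g z + inner z = outer z" if z: "z \<in> path_image \<gamma>" for z
  proof -
    define \<Phi> where "\<Phi> z = ?c * orient * g z + inner z - outer z" for z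
    have zB: "z \<in> ?B" using z M by blast
    have edge: "isCont (\<lambda>z. edge_integral D a b (K z)) z"
      if "coord1 a = c \<and> coord1 b = c \<or> coord2 a = c \<and> coord2 b = c" "\<bar>c\<bar> = of_int M" for a b c
      unfolding K_def[abs_def] using outside[OF _ that] zB by (intro isCont_edge_integral[OF cont]) blast
    have "isCont outer z"
      unfolding outer_def[abs_def]
      by (intro continuous_intros edge[of _ "- of_int M"] edge[of _ "of_int M"]; use M(1) in simp)
    moreover have "isCont inner z"
      unfolding inner_def[abs_def]
    proof (intro continuous_intros)
      fix m n
      show "isCont (\<lambda>z. if bad m n then cell_sum D (K z) m n else 0) z"
      proof (cases "bad m n")
        case True
        then have "z \<notin> cell m n" using fine[of m n] z by (auto simp: bad_def)
        then show ?thesis using True isCont_cell_sum[OF cont] by (simp add: K_def[abs_def])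
      qed simp
    qed
    moreover have "isCont g z"
      using cont D' \<gamma>(3) z by (auto simp: continuous_on_eq_continuous_at)
    ultimately have "isCont \<Phi> z"
      unfolding \<Phi>_def[abs_def] by (intro continuous_intros)
    moreover have "((\<lambda>t. z + of_real t * (\<alpha> + \<beta>)) \<longlongrightarrow> z + of_real 0 * (\<alpha> + \<beta>)) (at_right 0)"
      by (intro tendsto_intros)
    ultimately have lim: "((\<lambda>t. \<Phi> (z + of_real t * (\<alpha> + \<beta>))) \<longlongrightarrow> \<Phi> z) (at_right 0)"
      by (intro isCont_tendsto_compose[of z \<Phi>]) auto
    let ?x = "coord1 z" and ?y = "coord2 z"
    \<comment> \<open>For positive \<open>t\<close> below \<open>d\<close> both coordinates stay
      strictly below the next integer and inside the box, so the point leaves the grid lines without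
      changing its floors.\<close>
    define d where "d = Min {of_int \<lfloor>?x\<rfloor> + 1 - ?x, of_int \<lfloor>?y\<rfloor> + 1 - ?y, of_int M - ?x, of_int M - ?y}"
    have d: "d > 0" using zB by (auto simp: d_def coord_box_def; linarith)
    have "\<Phi> (z + of_real t * (\<alpha> + \<beta>)) = 0" if t: "0 < t" "t < d" for t
    proof -
      let ?w = "z + of_real t * (\<alpha> + \<beta>)"
      have w: "coord1 ?w = ?x + t" "coord2 ?w = ?y + t"
        using coord1_comb[of t t] coord2_comb[of t t] by (simp_all add: distrib_left)
      have td: "t < of_int \<lfloor>?x\<rfloor> + 1 - ?x" "t < of_int \<lfloor>?y\<rfloor> + 1 - ?y" "t < of_int M - ?x" "t < of_int M - ?y"
        using t(2) by (simp_all add: d_def)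
      have fl: "\<lfloor>coord1 ?w\<rfloor> = \<lfloor>?x\<rfloor>" "\<lfloor>coord2 ?w\<rfloor> = \<lfloor>?y\<rfloor>"
        unfolding w by (rule floor_unique; use t(1) td in linarith)+
      have nonint: "x + t \<notin> \<int>" if "t < of_int \<lfloor>x\<rfloor> + 1 - x" for x :: real
      proof
        assume "x + t \<in> \<int>"
        then obtain k where k: "x + t = of_int k" by (auto elim: Ints_cases)
        have "real_of_int \<lfloor>x\<rfloor> < of_int k \<and> real_of_int k < of_int (\<lfloor>x\<rfloor> + 1)"
          using that t(1) k unfolding of_int_add of_int_1 by linarith
        then have "\<lfloor>x\<rfloor> < k \<and> k < \<lfloor>x\<rfloor> + 1" by (simp only: of_int_less_iff)
        then show False by linarith
      qed
      have zc: "z \<in> cell \<lfloor>?x\<rfloor> \<lfloor>?y\<rfloor>" by (auto simp: cell_def coord_box_def; linarith)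
      then have "cell \<lfloor>?x\<rfloor> \<lfloor>?y\<rfloor> \<subseteq> D" using fine z by blast
      moreover have "?w \<in> ?B" using zB td t(1) unfolding coord_box_def mem_Collect_eq w by auto
      moreover have "coord1 ?w \<notin> \<int>" unfolding w by (rule nonint[OF td(1)])
      moreover have "coord2 ?w \<notin> \<int>" unfolding w by (rule nonint[OF td(2)])
      ultimately have "?c * orient * g ?w + inner ?w = outer ?w"
        using generic[of ?w] unfolding fl by blast
      then show ?thesis by (simp add: \<Phi>_def)
    qed
    then have "\<forall>\<^sub>F t in at_right 0. \<Phi> (z + of_real t * (\<alpha> + \<beta>)) = 0"
      using eventually_at_right_less d by (auto simp: eventually_at_right[OF d])
    then have "((\<lambda>t. \<Phi> (z + of_real t * (\<alpha> + \<beta>))) \<longlongrightarrow> 0) (at_right 0)"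
      by (rule tendsto_eventually)
    then have "\<Phi> z = 0" using lim tendsto_unique[OF trivial_limit_at_right_real] by blast
    then show ?thesis by (simp add: \<Phi>_def)
  qed
  \<comment> \<open>The rim lies outside a convex box that contains the loop, so the loop winds zero
    times around it.\<close>
  have edge: "((\<lambda>z. edge_integral D a b (K z)) has_contour_integral 0) \<gamma>"
    if e: "coord1 a = c \<and> coord1 b = c \<or> coord2 a = c \<and> coord2 b = c" "\<bar>c\<bar> = of_int M" for a b c
  proof -
    have "winding_number \<gamma> w = 0" if "w \<in> closed_segment a b" for w
      using outside[OF that e] M(2) \<gamma>
      by (intro winding_number_zero_outside[of _ ?B]) (auto simp: path_polynomial_function intro!: convex_coord_box)
    moreover have "closed_segment a b \<inter> path_image \<gamma> = {}" using outside[OF _ e] M(2) by blast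
    ultimately show ?thesis
      using has_contour_integral_edge_integral[OF \<gamma>(1,2) _ cont, of a b 0] by (simp add: K_def[abs_def])
  qed
  have "(outer has_contour_integral (\<Sum>m\<in>?I. 0 - 0) + (\<Sum>n\<in>?I. 0 - 0)) \<gamma>"
    unfolding outer_def[abs_def]
    by (intro has_contour_integral_add has_contour_integral_sum has_contour_integral_diff
        edge[of _ "- of_int M"] edge[of _ "of_int M"]; use M(1) in simp)
  then have o: "(outer has_contour_integral 0) \<gamma>" by simp
  \<comment> \<open>Cells contained in \<open>D\<close> are omitted from \<open>inner\<close>; their
    terms on the right vanish by Cauchy's theorem, so the sum may run over all cells.\<close>
  have i: "(inner has_contour_integral (\<Sum>m\<in>?I. \<Sum>n\<in>?I. - ?c * winding_number \<gamma> (p m n) * cell_sum D g m n)) \<gamma>"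
    unfolding inner_def[abs_def]
  proof (intro has_contour_integral_sum)
    fix m n
    show "((\<lambda>z. if bad m n then cell_sum D (K z) m n else 0) has_contour_integral
       - ?c * winding_number \<gamma> (p m n) * cell_sum D g m n) \<gamma>"
    proof (cases "bad m n")
      case True
      then have "cell m n \<inter> path_image \<gamma> = {}" using fine[of m n] by (auto simp: bad_def)
      from has_contour_integral_cell_sum[OF \<gamma>(1,2) cont this p] show ?thesis
        using True by (simp add: K_def[abs_def])
    next
      case False
      then have "cell_sum D g m n = 0" by (intro cell_sum_eq_0[OF D]) (simp add: bad_def)
      then show ?thesis using False by (simp add: has_contour_integral_0)
    qed
  qed auto
  have "((\<lambda>z. outer z - inner z) has_contour_integral
      0 - (\<Sum>m\<in>?I. \<Sum>n\<in>?I. - ?c * winding_number \<gamma> (p m n) * cell_sum D g m n)) \<gamma>"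
    by (rule has_contour_integral_diff[OF o i])
  then have "((\<lambda>z. ?c * orient * g z) has_contour_integral
      0 - (\<Sum>m\<in>?I. \<Sum>n\<in>?I. - ?c * winding_number \<gamma> (p m n) * cell_sum D g m n)) \<gamma>"
    by (rule has_contour_integral_eq) (use on_path in \<open>simp add: algebra_simps\<close>)
  moreover have "g contour_integrable_on \<gamma>"
    using contour_integrable_holomorphic_simple[OF D D' vp \<gamma>(3)] .
  then have "((\<lambda>z. ?c * orient * g z) has_contour_integral ?c * orient * contour_integral \<gamma> g) \<gamma>"
    by (intro has_contour_integral_lmul has_contour_integral_integral)
  ultimately have "?c * orient * contour_integral \<gamma> g =
      0 - (\<Sum>m\<in>?I. \<Sum>n\<in>?I. - ?c * winding_number \<gamma> (p m n) * cell_sum D g m n)"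
    by (rule has_contour_integral_unique[rotated])
  also have "\<dots> = ?c * (\<Sum>m\<in>?I. \<Sum>n\<in>?I. winding_number \<gamma> (p m n) * cell_sum D g m n)"
    by (simp add: sum_distrib_left sum_negf mult.assoc)
  finally show ?thesis by (simp add: mult.assoc)
qed

lemma cell_sum_translate:
  assumes "\<And>z. z + node i j \<in> D \<longleftrightarrow> z \<in> D" "\<And>z. z \<in> D \<Longrightarrow> g (z + node i j) = g z"
  shows "cell_sum D g (m + i) (n + j) = cell_sum D g m n"
proof -
  have e: "edge_integral D (node (m' + i) (n' + j)) (node (m'' + i) (n'' + j)) g = edge_integral D (node m' n') (node m'' n'') g"
    for m' n' m'' n''
    unfolding node_add by (rule edge_integral_translate[where v = "node i j" and D = D and g = g, OF assms])
  show ?thesis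
    using e[of m n "m + 1" n] e[of "m + 1" n "m + 1" "n + 1"] e[of m "n + 1" "m + 1" "n + 1"] e[of m n m "n + 1"]
    by (simp add: cell_sum_def add_ac)
qed

text \<open>Telescoping leaves the rim of a period parallelogram, whose opposite sides agree by
  periodicity. This is why the charges sum to zero.\<close>

lemma cell_sum_torus:
  assumes "N \<ge> 0"
    and per: "\<And>z. z + node N 0 \<in> D \<longleftrightarrow> z \<in> D" "\<And>z. z \<in> D \<Longrightarrow> g (z + node N 0) = g z"
      "\<And>z. z + node 0 N \<in> D \<longleftrightarrow> z \<in> D" "\<And>z. z \<in> D \<Longrightarrow> g (z + node 0 N) = g z"
  shows "(\<Sum>m\<in>{0..<N}. \<Sum>n\<in>{0..<N}. cell_sum D g m n) = 0"
proof -
  have "edge_integral D (node m N) (node (m + 1) N) g = edge_integral D (node m 0) (node (m + 1) 0) g" for m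
    using edge_integral_translate[where v = "node 0 N" and D = D and g = g, OF per(3,4), of "node m 0" "node (m + 1) 0"] node_add[of m 0 0 N] node_add[of "m + 1" 0 0 N] by simp
  moreover have "edge_integral D (node N n) (node N (n + 1)) g = edge_integral D (node 0 n) (node 0 (n + 1)) g" for n
    using edge_integral_translate[where v = "node N 0" and D = D and g = g, OF per(1,2), of "node 0 n" "node 0 (n + 1)"] node_add[of 0 N n 0] node_add[of 0 N "n + 1" 0] by simp
  ultimately show ?thesis using assms(1) by (subst cell_sum_grid) auto
qed

end

section \<open>Winding numbers on the torus\<close>

text \<open>Gaussian elimination, by induction on the number of unknowns. If the last unknown occurs
  in equation \<open>k\<close>, multiples of \<open>k\<close> remove it from the others; finite
  parts of the reduced system stay solvable because \<open>k\<close> can be added to them.\<close>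

lemma finitely_solvable_imp_solvable:
  fixes m :: "'i \<Rightarrow> nat \<Rightarrow> real" and t :: "'i \<Rightarrow> real"
  assumes "\<And>F. finite F \<Longrightarrow> F \<subseteq> A \<Longrightarrow> \<exists>c. \<forall>i\<in>F. (\<Sum>j=1..b. c j * m i j) = t i"
  shows "\<exists>c. \<forall>i\<in>A. (\<Sum>j=1..b. c j * m i j) = t i"
  using assms
proof (induction b arbitrary: m t)
  case 0
  have "0 = t i" if "i \<in> A" for i
    using 0[of "{i}"] that by auto
  then show ?case by auto
next
  case (Suc b)
  show ?case
  proof (cases "\<forall>i\<in>A. m i (Suc b) = 0")
    case True
    have "\<exists>c. \<forall>i\<in>A. (\<Sum>j=1..b. c j * m i j) = t i"
    proof (rule Suc.IH)
      fix F assume F: "finite F" "F \<subseteq> A"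
      then obtain c where "\<forall>i\<in>F. (\<Sum>j=1..Suc b. c j * m i j) = t i" using Suc.prems by blast
      then show "\<exists>c. \<forall>i\<in>F. (\<Sum>j=1..b. c j * m i j) = t i"
        using True F by (intro exI[of _ c]) (auto simp: subset_iff)
    qed
    then obtain c where "\<forall>i\<in>A. (\<Sum>j=1..b. c j * m i j) = t i" by blast
    then show ?thesis using True by (intro exI[of _ c]) auto
  next
    case False
    then obtain k where k: "k \<in> A" "m k (Suc b) \<noteq> 0" by blast
    define \<rho> where "\<rho> i = m i (Suc b) / m k (Suc b)" for i
    have sub: "(\<Sum>j=1..b. c j * (m i j - \<rho> i * m k j)) =
        (\<Sum>j=1..Suc b. c j * m i j) - \<rho> i * (\<Sum>j=1..Suc b. c j * m k j)" for c i
      using k(2) by (simp add: \<rho>_def sum_subtractf sum_distrib_left algebra_simps)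
    have "\<exists>c. \<forall>i\<in>A. (\<Sum>j=1..b. c j * (m i j - \<rho> i * m k j)) = t i - \<rho> i * t k"
    proof (rule Suc.IH)
      fix F assume F: "finite F" "F \<subseteq> A"
      then obtain c where "\<forall>i\<in>insert k F. (\<Sum>j=1..Suc b. c j * m i j) = t i"
        using Suc.prems[of "insert k F"] k(1) by blast
      then show "\<exists>c. \<forall>i\<in>F. (\<Sum>j=1..b. c j * (m i j - \<rho> i * m k j)) = t i - \<rho> i * t k"
        unfolding sub by (intro exI[of _ c]) auto
    qed
    then obtain c where c: "\<And>i. i \<in> A \<Longrightarrow> (\<Sum>j=1..b. c j * (m i j - \<rho> i * m k j)) = t i - \<rho> i * t k"
      by blast
    \<comment> \<open>Back substitution: equation \<open>k\<close> determines the last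
      unknown.\<close>
    define d where "d = c(Suc b := (t k - (\<Sum>j=1..b. c j * m k j)) / m k (Suc b))"
    have dc: "(\<Sum>j=1..b. d j * f j) = (\<Sum>j=1..b. c j * f j)" for f
      by (intro sum.cong) (auto simp: d_def)
    have dk: "(\<Sum>j=1..Suc b. d j * m k j) = t k"
      using k(2) dc[of "m k"] by (simp add: d_def)
    have "(\<Sum>j=1..Suc b. d j * m i j) = t i" if "i \<in> A" for i
      using sub[of d i] c[OF that] dk unfolding dc by simp
    then show ?thesis by blast
  qed
qed

text \<open>The remainder modulo \<open>N\<close> will name a cell on the torus and the quotient a
  lattice translate of it.\<close>

lemma sum_int_div_mod:
  fixes f :: "int \<Rightarrow> 'a::comm_monoid_add"
  assumes "N > 0"
  shows "(\<Sum>m\<in>{-(k * N)..<k * N}. f m) = (\<Sum>r\<in>{0..<N}. \<Sum>a\<in>{-k..<k}. f (r + N * a))"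
proof -
  have "bij_betw (\<lambda>(r, a). r + N * a) ({0..<N} \<times> {-k..<k}) {-(k * N)..<k * N}"
  proof (rule bij_betw_byWitness[where f' = "\<lambda>m. (m mod N, m div N)"])
    show "(\<lambda>(r, a). r + N * a) ` ({0..<N} \<times> {-k..<k}) \<subseteq> {-(k * N)..<k * N}"
    proof clarsimp
      fix r a assume h: "0 \<le> r" "r < N" "- k \<le> a" "a < k"
      have "N * (- k) \<le> N * a" "N * (a + 1) \<le> N * k"
        using assms h by (intro mult_left_mono; simp)+
      then show "- (k * N) \<le> r + N * a \<and> r + N * a < k * N"
        using h by (simp add: algebra_simps)
    qed
    show "(\<lambda>m. (m mod N, m div N)) ` {-(k * N)..<k * N} \<subseteq> {0..<N} \<times> {-k..<k}"
    proof clarsimp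
      fix m assume h: "- (k * N) \<le> m" "m < k * N"
      have "((- k) * N) div N \<le> m div N" using h assms by (intro zdiv_mono1) auto
      then have "- k \<le> m div N" using assms by (simp only: nonzero_mult_div_cancel_right)
      moreover have "(m div N) * N < k * N"
        using h div_mult_mod_eq[of m N] pos_mod_sign[OF assms, of m] by linarith
      then have "m div N < k" using assms by simp
      ultimately show "0 \<le> m mod N \<and> m mod N < N \<and> - k \<le> m div N \<and> m div N < k"
        using assms by auto
    qed
  qed (use assms in auto)
  from sum.reindex_bij_betw[OF this, of f, symmetric] show ?thesis
    by (simp add: sum.cartesian_product case_prod_unfold)
qed

section \<open>Winding numbers summed over lattice translates\<close>

context period_pair
begin

text \<open>The function W of the overview. For a closed path only finitely many summands are
  nonzero, since the other translates lie outside a ball around the path.\<close>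

definition wsum :: "(real \<Rightarrow> complex) \<Rightarrow> complex \<Rightarrow> complex" where
  "wsum \<gamma> z = (\<Sum>\<^sub>\<infinity>l\<in>L. winding_number \<gamma> (z + l))"

lemma wsum_translate:
  assumes "w \<in> L"
  shows "wsum \<gamma> (z + w) = wsum \<gamma> z"
proof -
  have "bij_betw (\<lambda>l. w + l) L L"
    by (rule bij_betw_byWitness[where f' = "\<lambda>l. l - w"])
      (use assms in \<open>auto intro: lattice_add lattice_diff\<close>)
  from infsum_reindex_bij_betw[OF this, of "\<lambda>l. winding_number \<gamma> (z + l)"]
  show ?thesis by (simp add: wsum_def add.assoc)
qed

text \<open>One finite set of lattice vectors serves all points near \<open>z\<close>, and each of
  the corresponding winding numbers is locally constant.\<close>

lemma wsum_locally_constant: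
  assumes \<gamma>: "path \<gamma>" "pathfinish \<gamma> = pathstart \<gamma>" and z: "\<And>l. l \<in> L \<Longrightarrow> z + l \<notin> path_image \<gamma>"
  shows "\<forall>\<^sub>F p in nhds z. (\<forall>l\<in>L. p + l \<notin> path_image \<gamma>) \<and> wsum \<gamma> p = wsum \<gamma> z"
proof -
  obtain R where R: "R > 0" "path_image \<gamma> \<subseteq> ball 0 R"
    using bounded_path_image[OF \<gamma>(1)] by (meson bounded_subset_ballD)
  \<comment> \<open>\<open>z + l\<close> is close to the origin when \<open>l\<close> is close to
    \<open>- z\<close>; the extra 1 covers all points of the unit ball around
    \<open>z\<close>.\<close>
  define A where "A = L \<inter> cball (- z) (R + 1)"
  have fin: "finite A" unfolding A_def by (rule finite_lattice_cball)
  have far: "p + l \<notin> ball 0 R" if "l \<in> L - A" "p \<in> ball z 1" for p l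
  proof
    assume "p + l \<in> ball 0 R"
    then have "norm (p + l) < R" by (simp only: mem_ball_0)
    moreover have "norm (z - p) < 1" using that(2) by (simp add: dist_norm)
    ultimately have "norm ((p + l) + (z - p)) < R + 1"
      using norm_triangle_ineq[of "p + l" "z - p"] by linarith
    then have "norm (z + l) < R + 1" by (simp add: add.commute)
    moreover have "R + 1 < norm (- z - l)" using that(1) by (auto simp: A_def dist_norm)
    then have "R + 1 < norm (z + l)" using norm_minus_cancel[of "z + l"] by simp
    ultimately show False by simp
  qed
  have wn: "winding_number \<gamma> (p + l) = 0" if "l \<in> L - A" "p \<in> ball z 1" for p l
    using far[OF that] R \<gamma> by (intro winding_number_zero_outside[of _ "ball 0 R"]) auto
  have ws: "wsum \<gamma> p = (\<Sum>l\<in>A. winding_number \<gamma> (p + l))" if "p \<in> ball z 1" for p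
  proof -
    have "wsum \<gamma> p = (\<Sum>\<^sub>\<infinity>l\<in>A. winding_number \<gamma> (p + l))"
      unfolding wsum_def using wn that by (intro infsum_cong_neutral) (auto simp: A_def)
    then show ?thesis using fin by simp
  qed
  have "\<forall>\<^sub>F p in nhds z. p + l \<notin> path_image \<gamma> \<and> winding_number \<gamma> (p + l) = winding_number \<gamma> (z + l)"
    if "l \<in> A" for l
  proof -
    have "z + l \<in> - path_image \<gamma>" using z that by (auto simp: A_def)
    then obtain e where e: "e > 0" "ball (z + l) e \<subseteq> - path_image \<gamma>"
      using closed_path_image[OF \<gamma>(1)] by (metis open_Compl openE)
    have "p + l \<notin> path_image \<gamma> \<and> winding_number \<gamma> (p + l) = winding_number \<gamma> (z + l)" if "dist p z < e" for p
    proof -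
      have p: "p + l \<in> ball (z + l) e" using that by (simp add: dist_commute)
      moreover have "winding_number \<gamma> (p + l) = winding_number \<gamma> (z + l)"
        using e p by (intro winding_number_eq[OF \<gamma> p, of "z + l"]) auto
      ultimately show ?thesis using e(2) by blast
    qed
    then show ?thesis unfolding eventually_nhds_metric using e(1) by blast
  qed
  then have "\<forall>\<^sub>F p in nhds z. \<forall>l\<in>A. p + l \<notin> path_image \<gamma> \<and> winding_number \<gamma> (p + l) = winding_number \<gamma> (z + l)"
    using fin by (intro eventually_ball_finite) auto
  moreover have "\<forall>\<^sub>F p in nhds z. p \<in> ball z 1"
    by (auto simp: eventually_nhds_metric dist_commute intro!: exI[of _ 1])
  ultimately show ?thesis
  proof eventually_elim
    case (elim p)
    have "p + l \<notin> path_image \<gamma>" if "l \<in> L" for l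
      using elim far[of l p] R that by (cases "l \<in> A") auto
    moreover have "wsum \<gamma> p = wsum \<gamma> z" using elim by (simp add: ws)
    ultimately show ?case by blast
  qed
qed

lemma torus_proj_eq_iff: "torus_proj \<omega>\<^sub>1 \<omega>\<^sub>2 z = torus_proj \<omega>\<^sub>1 \<omega>\<^sub>2 w \<longleftrightarrow> z - w \<in> L"
proof
  assume "torus_proj \<omega>\<^sub>1 \<omega>\<^sub>2 z = torus_proj \<omega>\<^sub>1 \<omega>\<^sub>2 w"
  moreover have "z \<in> torus_proj \<omega>\<^sub>1 \<omega>\<^sub>2 z" by (simp add: torus_proj_def)
  ultimately show "z - w \<in> L" by (auto simp: torus_proj_def)
next
  assume h: "z - w \<in> L"
  have "x - z \<in> L \<longleftrightarrow> x - w \<in> L" for x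
    using lattice_add_iff[OF h, of "x - z"] by simp
  then show "torus_proj \<omega>\<^sub>1 \<omega>\<^sub>2 z = torus_proj \<omega>\<^sub>1 \<omega>\<^sub>2 w" by (auto simp: torus_proj_def)
qed

lemma torus_proj_translate: "l \<in> L \<Longrightarrow> torus_proj \<omega>\<^sub>1 \<omega>\<^sub>2 (z + l) = torus_proj \<omega>\<^sub>1 \<omega>\<^sub>2 z"
  by (simp add: torus_proj_eq_iff)

lemma openin_torus_image:
  assumes "open S" and inv: "\<And>z l. z \<in> S \<Longrightarrow> l \<in> L \<Longrightarrow> z + l \<in> S"
  shows "openin (torus \<omega>\<^sub>1 \<omega>\<^sub>2) (torus_proj \<omega>\<^sub>1 \<omega>\<^sub>2 ` S)"
    and "torus_proj \<omega>\<^sub>1 \<omega>\<^sub>2 -` (torus_proj \<omega>\<^sub>1 \<omega>\<^sub>2 ` S) = S"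
proof -
  show eq: "torus_proj \<omega>\<^sub>1 \<omega>\<^sub>2 -` (torus_proj \<omega>\<^sub>1 \<omega>\<^sub>2 ` S) = S"
  proof
    show "torus_proj \<omega>\<^sub>1 \<omega>\<^sub>2 -` (torus_proj \<omega>\<^sub>1 \<omega>\<^sub>2 ` S) \<subseteq> S"
    proof
      fix z assume "z \<in> torus_proj \<omega>\<^sub>1 \<omega>\<^sub>2 -` (torus_proj \<omega>\<^sub>1 \<omega>\<^sub>2 ` S)"
      then obtain w where w: "w \<in> S" "z - w \<in> L" by (auto simp: torus_proj_eq_iff)
      from inv[OF this] show "z \<in> S" by simp
    qed
  qed auto
  show "openin (torus \<omega>\<^sub>1 \<omega>\<^sub>2) (torus_proj \<omega>\<^sub>1 \<omega>\<^sub>2 ` S)"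
    using assms(1) by (auto simp: openin_torus eq)
qed

text \<open>Off the translates of the path, the points where \<open>wsum\<close> has a given value
  and those where it differs form two open, lattice-invariant sets. Their images are open in the
  torus, and two different values would separate \<open>K\<close>.\<close>

lemma wsum_constant_on_connected:
  assumes K: "connectedin (torus \<omega>\<^sub>1 \<omega>\<^sub>2) K" and \<gamma>: "path \<gamma>" "pathfinish \<gamma> = pathstart \<gamma>"
    and disj: "\<And>z. z \<in> path_image \<gamma> \<Longrightarrow> torus_proj \<omega>\<^sub>1 \<omega>\<^sub>2 z \<notin> K"
    and zw: "torus_proj \<omega>\<^sub>1 \<omega>\<^sub>2 z \<in> K" "torus_proj \<omega>\<^sub>1 \<omega>\<^sub>2 w \<in> K"
  shows "wsum \<gamma> z = wsum \<gamma> w"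
proof (rule ccontr)
  assume neq: "wsum \<gamma> z \<noteq> wsum \<gamma> w"
  define S where "S Q = {z. (\<forall>l\<in>L. z + l \<notin> path_image \<gamma>) \<and> Q (wsum \<gamma> z)}" for Q
  have op: "open (S Q)" for Q
  proof (subst open_subopen, intro ballI)
    fix z assume z: "z \<in> S Q"
    then have "\<forall>\<^sub>F p in nhds z. (\<forall>l\<in>L. p + l \<notin> path_image \<gamma>) \<and> wsum \<gamma> p = wsum \<gamma> z"
      by (intro wsum_locally_constant \<gamma>) (auto simp: S_def)
    then have "\<forall>\<^sub>F p in nhds z. p \<in> S Q"
      by eventually_elim (use z in \<open>auto simp: S_def\<close>)
    then show "\<exists>T. open T \<and> z \<in> T \<and> T \<subseteq> S Q" by (auto simp: eventually_nhds)
  qed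
  have inv: "z + l \<in> S Q" if "z \<in> S Q" "l \<in> L" for z l Q
    using that lattice_add by (auto simp: S_def wsum_translate add.assoc)
  have mem: "torus_proj \<omega>\<^sub>1 \<omega>\<^sub>2 z \<in> torus_proj \<omega>\<^sub>1 \<omega>\<^sub>2 ` S Q \<longleftrightarrow> z \<in> S Q" for z Q
    using openin_torus_image(2)[OF op inv, of Q] by blast
  have inS: "z \<in> S Q" if "torus_proj \<omega>\<^sub>1 \<omega>\<^sub>2 z \<in> K" "Q (wsum \<gamma> z)" for z Q
    using that disj torus_proj_translate by (force simp: S_def)
  let ?U = "torus_proj \<omega>\<^sub>1 \<omega>\<^sub>2 ` S (\<lambda>x. x = wsum \<gamma> z)" and ?V = "torus_proj \<omega>\<^sub>1 \<omega>\<^sub>2 ` S (\<lambda>x. x \<noteq> wsum \<gamma> z)"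
  have "K \<subseteq> range (torus_proj \<omega>\<^sub>1 \<omega>\<^sub>2)"
    using connectedin_subset_topspace[OF K] by (simp add: topspace_torus)
  have 1: "K \<subseteq> ?U \<union> ?V"
  proof
    fix x assume x: "x \<in> K"
    then obtain y where y: "x = torus_proj \<omega>\<^sub>1 \<omega>\<^sub>2 y" using \<open>K \<subseteq> range _\<close> by blast
    show "x \<in> ?U \<union> ?V"
      using inS[of y "\<lambda>x. x = wsum \<gamma> z"] inS[of y "\<lambda>x. x \<noteq> wsum \<gamma> z"] x unfolding y by blast
  qed
  have 2: "?U \<inter> ?V \<inter> K = {}"
  proof -
    have False if "x \<in> ?U" "x \<in> ?V" for x
    proof -
      obtain y where y: "x = torus_proj \<omega>\<^sub>1 \<omega>\<^sub>2 y" "y \<in> S (\<lambda>x. x = wsum \<gamma> z)" using \<open>x \<in> ?U\<close> by blast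
      then have "y \<in> S (\<lambda>x. x \<noteq> wsum \<gamma> z)" using \<open>x \<in> ?V\<close> mem by metis
      then show False using y(2) by (simp add: S_def)
    qed
    then show ?thesis by blast
  qed
  have 3: "?U \<inter> K \<noteq> {}" using zw(1) inS[OF zw(1), of "\<lambda>x. x = wsum \<gamma> z"] by blast
  have "w \<in> S (\<lambda>x. x \<noteq> wsum \<gamma> z)" using inS[OF zw(2)] neq by simp
  then have 4: "?V \<inter> K \<noteq> {}" using zw(2) by blast
  have 5: "openin (torus \<omega>\<^sub>1 \<omega>\<^sub>2) (torus_proj \<omega>\<^sub>1 \<omega>\<^sub>2 ` S Q)" for Q
    by (rule openin_torus_image(1)[OF op]) (rule inv)
  have "\<exists>U V. openin (torus \<omega>\<^sub>1 \<omega>\<^sub>2) U \<and> openin (torus \<omega>\<^sub>1 \<omega>\<^sub>2) V \<and> K \<subseteq> U \<union> V \<and>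
      U \<inter> V \<inter> K = {} \<and> U \<inter> K \<noteq> {} \<and> V \<inter> K \<noteq> {}"
    by (rule exI[of _ ?U], rule exI[of _ ?V]) (intro conjI 5 1 2 3 4)
  then show False
    using K by (simp only: connectedin simp_thms)
qed

end

section \<open>Periods of holomorphic functions on the torus\<close>

context period_pair
begin

text \<open>The grid argument for finitely many loops that share one mesh. The charges obtained here
  are complex; \<open>real_charges\<close> passes to real parts.\<close>

lemma finite_charges:
  assumes D: "open D" "g holomorphic_on D"
    and perD: "\<And>z l. l \<in> L \<Longrightarrow> z + l \<in> D \<longleftrightarrow> z \<in> D"
    and perg: "\<And>z l. l \<in> L \<Longrightarrow> z \<in> D \<Longrightarrow> g (z + l) = g z"
    and F: "finite F"
    and loops: "\<And>\<gamma>. \<gamma> \<in> F \<Longrightarrow> polynomial_function \<gamma>" "\<And>\<gamma>. \<gamma> \<in> F \<Longrightarrow> pathfinish \<gamma> = pathstart \<gamma>"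
      "\<And>\<gamma>. \<gamma> \<in> F \<Longrightarrow> path_image \<gamma> \<subseteq> D"
    and J: "finite J" and E: "\<And>z. z \<notin> D \<Longrightarrow> \<exists>j\<in>J. z \<in> E j"
    and const: "\<And>\<gamma> j z. \<gamma> \<in> F \<Longrightarrow> j \<in> J \<Longrightarrow> z \<in> E j \<Longrightarrow> wsum \<gamma> z = wsum \<gamma> (a j)"
  shows "\<exists>c. (\<Sum>j\<in>J. c j) = 0 \<and>
     (\<forall>\<gamma>\<in>F. contour_integral \<gamma> g = 2 * pi * \<i> * (\<Sum>j\<in>J. c j * wsum \<gamma> (a j)))"
proof -
  have "compact (\<Union>\<gamma>\<in>F. path_image \<gamma>)"
    using F loops by (intro compact_UN) (auto intro: compact_path_image path_polynomial_function)
  moreover have "closed (- D)" using D by (simp add: closed_Compl)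
  moreover have "(\<Union>\<gamma>\<in>F. path_image \<gamma>) \<inter> - D = {}" using loops by blast
  ultimately obtain \<delta> where \<delta>: "\<delta> > 0" "\<And>x y. x \<in> (\<Union>\<gamma>\<in>F. path_image \<gamma>) \<Longrightarrow> y \<in> - D \<Longrightarrow> \<delta> \<le> dist x y"
    using separate_compact_closed by metis
  \<comment> \<open>Makes the cells smaller than \<open>\<delta>\<close>; adding 1 gives a strict
    inequality and a positive \<open>N\<close>.\<close>
  define N0 where "N0 = nat \<lceil>(norm (2 * \<omega>\<^sub>1) + norm (2 * \<omega>\<^sub>2)) / \<delta>\<rceil> + 1"
  define N where "N = int N0"
  have N: "N > 0" "real_of_int N > (norm (2 * \<omega>\<^sub>1) + norm (2 * \<omega>\<^sub>2)) / \<delta>"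
  proof -
    show "N > 0" by (simp only: N_def of_nat_0_less_iff) (simp add: N0_def)
    have "real_of_int N = real (nat \<lceil>(norm (2 * \<omega>\<^sub>1) + norm (2 * \<omega>\<^sub>2)) / \<delta>\<rceil>) + 1"
      by (simp add: N_def N0_def)
    then show "real_of_int N > (norm (2 * \<omega>\<^sub>1) + norm (2 * \<omega>\<^sub>2)) / \<delta>"
      using real_nat_ceiling_ge[of "(norm (2 * \<omega>\<^sub>1) + norm (2 * \<omega>\<^sub>2)) / \<delta>"] by linarith
  qed
  define \<alpha> where "\<alpha> = 2 * \<omega>\<^sub>1 / of_int N"
  define \<beta> where "\<beta> = 2 * \<omega>\<^sub>2 / of_int N"
  have small: "norm \<alpha> + norm \<beta> < \<delta>"
    using N \<delta>(1) by (simp add: \<alpha>_def \<beta>_def norm_divide norm_mult field_simps)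
  interpret G: complex_basis \<alpha> \<beta>
  proof
    have "Im (cnj (2 * \<omega>\<^sub>1) * (2 * \<omega>\<^sub>2)) = (of_int N)\<^sup>2 * Im (cnj \<alpha> * \<beta>)"
      using N(1) by (simp add: \<alpha>_def \<beta>_def power2_eq_square)
    then show "Im (cnj \<alpha> * \<beta>) \<noteq> 0" using indep by auto
  qed
  have node_lat: "G.node (N * i) (N * j) = lat (i, j)" for i j
    unfolding G.node_def using N(1) by (simp add: lat_def \<alpha>_def \<beta>_def)
  have latL: "lat p \<in> L" for p using range_lat by blast
  have fine: "G.cell m n \<subseteq> D \<or> G.cell m n \<inter> path_image \<gamma> = {}" if "\<gamma> \<in> F" for \<gamma> m n
  proof (rule ccontr)
    assume "\<not> ?thesis"
    then obtain x y where xy: "x \<in> G.cell m n" "x \<in> path_image \<gamma>" "y \<in> G.cell m n" "y \<notin> D" by blast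
    then have "\<delta> \<le> dist x y" using \<delta>(2) that by auto
    then show False using G.cell_diameter[OF xy(1,3)] small by (simp add: dist_norm)
  qed
  \<comment> \<open>A cell not contained in \<open>D\<close> gets a sample point outside
    \<open>D\<close>, so that some \<open>E j\<close> contains it. For the other cells the corner is
    a default value whose weight \<open>R\<close> is zero.\<close>
  define p0 where "p0 m n = (if G.cell m n \<subseteq> D then G.node m n else SOME z. z \<in> G.cell m n \<and> z \<notin> D)" for m n
  have p0: "p0 m n \<in> G.cell m n" "\<not> G.cell m n \<subseteq> D \<Longrightarrow> p0 m n \<notin> D" for m n
  proof -
    have "p0 m n \<in> G.cell m n \<and> p0 m n \<notin> D" if "\<not> G.cell m n \<subseteq> D"
    proof -
      have "\<exists>z. z \<in> G.cell m n \<and> z \<notin> D" using that by blast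
      from someI_ex[OF this] show ?thesis using that by (simp add: p0_def)
    qed
    then show "p0 m n \<in> G.cell m n" "\<not> G.cell m n \<subseteq> D \<Longrightarrow> p0 m n \<notin> D"
      by (auto simp: p0_def G.node_in_cell)
  qed
  \<comment> \<open>Sample points are chosen in one period and then translated, so those of
    congruent cells differ by lattice vectors and their winding numbers add up to
    \<open>wsum\<close>.\<close>
  define P where "P m n = p0 (m mod N) (n mod N) + lat (m div N, n div N)" for m n
  have P: "P m n \<in> G.cell m n" for m n
  proof -
    have "p0 (m mod N) (n mod N) + G.node (N * (m div N)) (N * (n div N))
       \<in> G.cell (m mod N + N * (m div N)) (n mod N + N * (n div N))"
      by (intro G.cell_shift p0)
    then show ?thesis by (simp add: P_def node_lat)
  qed
  have P_eq: "P (r + N * i) (t + N * j) = p0 r t + lat (i, j)" if "r \<in> {0..<N}" "t \<in> {0..<N}" for r t i j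
    using that by (simp add: P_def)
  define R where "R = G.cell_sum D g"
  have R_per: "R (r + N * i) (t + N * j) = R r t" for r t i j
    unfolding R_def by (rule G.cell_sum_translate) (simp_all add: node_lat perD perg latL)
  have R_good: "R r t = 0" if "G.cell r t \<subseteq> D" for r t
    unfolding R_def by (rule G.cell_sum_eq_0[OF D(2) that])
  have R_sum: "(\<Sum>r\<in>{0..<N}. \<Sum>t\<in>{0..<N}. R r t) = 0"
  proof -
    have "G.node N 0 = lat (1, 0)" "G.node 0 N = lat (0, 1)" using node_lat[of 1 0] node_lat[of 0 1] by simp_all
    then show ?thesis
      unfolding R_def using N(1) by (intro G.cell_sum_torus) (simp_all add: perD perg latL)
  qed
  have main: "G.orient * contour_integral \<gamma> g = (\<Sum>r\<in>{0..<N}. \<Sum>t\<in>{0..<N}. R r t * wsum \<gamma> (p0 r t))"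
    if \<gamma>: "\<gamma> \<in> F" for \<gamma>
  proof -
    note \<gamma>' = loops[OF \<gamma>]
    obtain C where C: "C > 0" "\<And>z. \<bar>G.coord1 z\<bar> + \<bar>G.coord2 z\<bar> \<le> C * norm z"
      using G.coord_bound by blast
    obtain B where B: "B > 0" "path_image \<gamma> \<subseteq> ball 0 B"
      using bounded_path_image[OF path_polynomial_function[OF \<gamma>'(1)]] by (meson bounded_subset_ballD)
    \<comment> \<open>Bounds the cell coordinates on the loop, so that \<open>k\<close> periods in
      each direction contain it.\<close>
    define k where "k = \<lceil>C * B\<rceil>"
    have k: "k \<ge> 0" "C * B \<le> of_int k" using mult_pos_pos[OF C(1) B(1)] by (auto simp: k_def)
    have kN: "k \<le> k * N" using k(1) N(1) by (simp add: mult_le_cancel_left1)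
    let ?box = "G.coord_box {- of_int (k * N)<..<of_int (k * N)} {- of_int (k * N)<..<of_int (k * N)}"
    have box: "path_image \<gamma> \<subseteq> ?box"
    proof
      fix z assume "z \<in> path_image \<gamma>"
      then have "norm z < B" using B(2) by auto
      then have "C * norm z < C * B" using C(1) by simp
      also have "\<dots> \<le> of_int k" by (rule k)
      also have "\<dots> \<le> of_int (k * N)" using kN by (simp only: of_int_le_iff)
      finally show "z \<in> ?box" using C(2)[of z] unfolding G.coord_box_def by auto
    qed
    let ?I = "{- (k * N)..<k * N}"
    have ws: "(\<Sum>i\<in>{-k..<k}. \<Sum>j\<in>{-k..<k}. winding_number \<gamma> (p0 r t + lat (i, j))) = wsum \<gamma> (p0 r t)"
      if rt: "r \<in> {0..<N}" "t \<in> {0..<N}" for r t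
    proof -
      \<comment> \<open>Cells with a translate index outside the range miss the open box, which is
        convex and contains the loop.\<close>
      have zero: "winding_number \<gamma> (p0 r t + lat p) = 0" if "p \<notin> {-k..<k} \<times> {-k..<k}" for p
      proof -
        obtain i j where p: "p = (i, j)" by (cases p)
        have "P (r + N * i) (t + N * j) \<notin> ?box"
        proof
          assume "P (r + N * i) (t + N * j) \<in> ?box"
          with P[of "r + N * i" "t + N * j"]
          have "real_of_int (r + N * i) < of_int (k * N) \<and> real_of_int (- (k * N)) < of_int (r + N * i + 1) \<and>
              real_of_int (t + N * j) < of_int (k * N) \<and> real_of_int (- (k * N)) < of_int (t + N * j + 1)"
            unfolding G.cell_def G.coord_box_def by auto
          then have "r + N * i < k * N \<and> - (k * N) < r + N * i + 1 \<and> t + N * j < k * N \<and> - (k * N) < t + N * j + 1"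
            by (simp only: of_int_less_iff)
          then have "r + N * i < N * k" "- (N * k) < r + N * i + 1" "t + N * j < N * k" "- (N * k) < t + N * j + 1"
            by (simp_all only: mult.commute[of k N])
          then have "N * i < N * k" "- (N * k) < N * i + N" "N * j < N * k" "- (N * k) < N * j + N"
            using rt unfolding atLeastLessThan_iff by linarith+
          then have "N * i < N * k" "N * (- k) < N * (i + 1)" "N * j < N * k" "N * (- k) < N * (j + 1)"
            by (simp_all only: distrib_left mult_minus_right mult_1_right)
          then have "i < k" "- k < i + 1" "j < k" "- k < j + 1"
            using N(1) by (simp_all only: mult_less_cancel_left_pos)
          then show False using that p by auto
        qed
        then have "p0 r t + lat (i, j) \<notin> ?box" using P_eq[OF rt] by simp
        then show ?thesis
          unfolding p using box \<gamma>' by (intro winding_number_zero_outside[of _ ?box] G.convex_coord_box)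
            (auto simp: path_polynomial_function)
      qed
      have "wsum \<gamma> (p0 r t) = (\<Sum>\<^sub>\<infinity>p. winding_number \<gamma> (p0 r t + lat p))"
        unfolding wsum_def by (rule infsum_reindex_bij_betw[OF bij_betw_lat, symmetric])
      also have "\<dots> = (\<Sum>\<^sub>\<infinity>p\<in>{-k..<k} \<times> {-k..<k}. winding_number \<gamma> (p0 r t + lat p))"
        using zero by (intro infsum_cong_neutral) auto
      also have "\<dots> = (\<Sum>p\<in>{-k..<k} \<times> {-k..<k}. winding_number \<gamma> (p0 r t + lat p))"
        by (intro infsum_finite) auto
      finally show ?thesis by (simp add: sum.cartesian_product case_prod_unfold)
    qed
    have "G.orient * contour_integral \<gamma> g = (\<Sum>m\<in>?I. \<Sum>n\<in>?I. winding_number \<gamma> (P m n) * R m n)"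
      unfolding R_def using k(1) N(1) box
      by (intro G.contour_integral_grid[OF D(2) \<gamma>' fine[OF \<gamma>] _ _ D(1) P]) auto
    also have "\<dots> = (\<Sum>r\<in>{0..<N}. \<Sum>i\<in>{-k..<k}. \<Sum>t\<in>{0..<N}. \<Sum>j\<in>{-k..<k}.
        winding_number \<gamma> (P (r + N * i) (t + N * j)) * R (r + N * i) (t + N * j))"
      by (simp only: sum_int_div_mod[OF N(1)])
    also have "\<dots> = (\<Sum>r\<in>{0..<N}. \<Sum>t\<in>{0..<N}. \<Sum>i\<in>{-k..<k}. \<Sum>j\<in>{-k..<k}.
        winding_number \<gamma> (P (r + N * i) (t + N * j)) * R (r + N * i) (t + N * j))"
      by (intro sum.cong refl sum.swap)
    also have "\<dots> = (\<Sum>r\<in>{0..<N}. \<Sum>t\<in>{0..<N}. \<Sum>i\<in>{-k..<k}. \<Sum>j\<in>{-k..<k}.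
        R r t * winding_number \<gamma> (p0 r t + lat (i, j)))"
      by (intro sum.cong refl) (simp only: R_per P_eq mult.commute[of "winding_number _ _"])
    also have "\<dots> = (\<Sum>r\<in>{0..<N}. \<Sum>t\<in>{0..<N}. R r t * wsum \<gamma> (p0 r t))"
      by (intro sum.cong refl) (simp add: ws flip: sum_distrib_left)
    finally show ?thesis .
  qed
  \<comment> \<open>Each cell not contained in \<open>D\<close> is assigned to one \<open>j\<close>
    whose set contains its sample point; its cell sum is credited to \<open>c j\<close>.\<close>
  define ind where "ind q = (SOME j. j \<in> J \<and> p0 (fst q) (snd q) \<in> E j)" for q
  define S where "S = {q \<in> {0..<N} \<times> {0..<N}. \<not> G.cell (fst q) (snd q) \<subseteq> D}"
  have ind: "ind q \<in> J \<and> p0 (fst q) (snd q) \<in> E (ind q)" if "q \<in> S" for q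
  proof -
    have "p0 (fst q) (snd q) \<notin> D" using that p0(2) by (auto simp: S_def)
    then have "\<exists>j. j \<in> J \<and> p0 (fst q) (snd q) \<in> E j" using E by blast
    then show ?thesis unfolding ind_def by (rule someI_ex)
  qed
  have S: "finite S" by (simp add: S_def)
  have toS: "(\<Sum>r\<in>{0..<N}. \<Sum>t\<in>{0..<N}. R r t * h r t) = (\<Sum>q\<in>S. R (fst q) (snd q) * h (fst q) (snd q))" for h
  proof -
    have "(\<Sum>r\<in>{0..<N}. \<Sum>t\<in>{0..<N}. R r t * h r t) = (\<Sum>q\<in>{0..<N} \<times> {0..<N}. R (fst q) (snd q) * h (fst q) (snd q))"
      by (simp add: sum.cartesian_product case_prod_unfold)
    also have "\<dots> = (\<Sum>q\<in>S. R (fst q) (snd q) * h (fst q) (snd q))"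
      by (rule sum.mono_neutral_right) (auto simp: S_def R_good)
    finally show ?thesis .
  qed
  define c where "c j = (\<Sum>q | q \<in> S \<and> ind q = j. R (fst q) (snd q)) / (2 * pi * \<i> * G.orient)" for j
  have group: "(\<Sum>j\<in>J. c j * h j) = (\<Sum>q\<in>S. R (fst q) (snd q) * h (ind q)) / (2 * pi * \<i> * G.orient)" for h
  proof -
    have "(\<Sum>q\<in>S. R (fst q) (snd q) * h (ind q)) = (\<Sum>j\<in>J. \<Sum>q | q \<in> S \<and> ind q = j. R (fst q) (snd q) * h (ind q))"
      using ind by (intro sum.group[OF S J, symmetric]) auto
    also have "\<dots> = (\<Sum>j\<in>J. (\<Sum>q | q \<in> S \<and> ind q = j. R (fst q) (snd q)) * h j)"
      by (intro sum.cong refl) (auto simp: sum_distrib_right)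
    finally show ?thesis by (simp add: c_def sum_divide_distrib[of _ J])
  qed
  have "(\<Sum>j\<in>J. c j) = 0"
    using group[of "\<lambda>_. 1"] toS[of "\<lambda>_ _. 1"] R_sum by simp
  moreover have "contour_integral \<gamma> g = 2 * pi * \<i> * (\<Sum>j\<in>J. c j * wsum \<gamma> (a j))" if "\<gamma> \<in> F" for \<gamma>
  proof -
    have "G.orient * contour_integral \<gamma> g = (\<Sum>q\<in>S. R (fst q) (snd q) * wsum \<gamma> (p0 (fst q) (snd q)))"
      unfolding main[OF that] by (rule toS)
    also have "\<dots> = (\<Sum>q\<in>S. R (fst q) (snd q) * wsum \<gamma> (a (ind q)))"
      using ind const[OF that] by (intro sum.cong refl) auto
    finally have "contour_integral \<gamma> g = (\<Sum>q\<in>S. R (fst q) (snd q) * wsum \<gamma> (a (ind q))) / G.orient"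
      using G.orient_nonzero by (simp add: field_simps)
    then show ?thesis
      unfolding group using G.orient_nonzero by simp
  qed
  ultimately show ?thesis by blast
qed

end

section \<open>Primitives and the decomposition\<close>

text \<open>Integrating from one base point per component gives a primitive, since vanishing periods
  make the choice of paths irrelevant. Starting with the value of \<open>v\<close> at the base point
  makes the real part equal to \<open>v\<close> throughout.\<close>

lemma primitive_of_vanishing_periods:
  assumes D: "open D" and \<phi>: "\<phi> holomorphic_on D"
    and loop: "\<And>\<gamma>. \<lbrakk>valid_path \<gamma>; path_image \<gamma> \<subseteq> D; pathfinish \<gamma> = pathstart \<gamma>\<rbrakk> \<Longrightarrow> contour_integral \<gamma> \<phi> = 0"
    and v: "\<And>\<gamma>. \<lbrakk>valid_path \<gamma>; path_image \<gamma> \<subseteq> D\<rbrakk> \<Longrightarrow> Re (contour_integral \<gamma> \<phi>) = v (pathfinish \<gamma>) - v (pathstart \<gamma>)"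
  shows "\<exists>f. \<forall>z\<in>D. (f has_field_derivative \<phi> z) (at z) \<and> Re (f z) = v z"
proof -
  \<comment> \<open>The choice depends only on the component as a set, so all points of a component
    share their base point.\<close>
  define base where "base z = (SOME x. x \<in> connected_component_set D z)" for z
  have base: "base z \<in> connected_component_set D z" if "z \<in> D" for z
  proof -
    have "z \<in> connected_component_set D z" using that by (simp add: connected_component_refl_eq)
    then show ?thesis unfolding base_def by (rule someI)
  qed
  have "\<exists>p. valid_path p \<and> path_image p \<subseteq> D \<and> pathstart p = base z \<and> pathfinish p = z" if z: "z \<in> D" for z
  proof -
    have "z \<in> connected_component_set D z" using z by (simp add: connected_component_refl_eq)
    then obtain p where "polynomial_function p" "path_image p \<subseteq> connected_component_set D z" "pathstart p = base z" "pathfinish p = z"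
      using connected_open_polynomial_connected[OF open_connected_component[OF D] connected_connected_component base[OF z]]
      by blast
    then show ?thesis using connected_component_subset valid_path_polynomial_function by blast
  qed
  then obtain p where p: "\<And>z. z \<in> D \<Longrightarrow> valid_path (p z) \<and> path_image (p z) \<subseteq> D \<and> pathstart (p z) = base z \<and> pathfinish (p z) = z"
    by metis
  have int: "\<phi> contour_integrable_on \<gamma>" if "valid_path \<gamma>" "path_image \<gamma> \<subseteq> D" for \<gamma>
    using contour_integrable_holomorphic_simple[OF \<phi> D that] .
  define f where "f z = of_real (v (base z)) + contour_integral (p z) \<phi>" for z
  have "(f has_field_derivative \<phi> z) (at z) \<and> Re (f z) = v z" if z: "z \<in> D" for z
  proof
    show "Re (f z) = v z" using v[of "p z"] p[OF z] by (simp add: f_def)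
    obtain r where r: "r > 0" "ball z r \<subseteq> D" using D z openE by blast
    obtain F where F: "\<And>w. w \<in> ball z r \<Longrightarrow> (F has_field_derivative \<phi> w) (at w within ball z r)"
      using holomorphic_convex_primitive'[OF convex_ball open_ball holomorphic_on_subset[OF \<phi> r(2)]] by blast
    have eq: "f z - F z + F w = f w" if w: "w \<in> ball z r" for w
    proof -
      let ?l = "linepath z w"
      have wD: "w \<in> D" using w r by blast
      have seg: "closed_segment z w \<subseteq> ball z r" using w r(1) by (intro closed_segment_subset) auto
      then have segD: "closed_segment z w \<subseteq> D" using r by blast
      have "connected_component D z w"
        unfolding connected_component_def using segD by (intro exI[of _ "closed_segment z w"]) auto
      then have b: "base w = base z" unfolding base_def by (metis connected_component_eq_eq connected_component_in)
      \<comment> \<open>The loop runs from the base point to \<open>z\<close>, along the segment to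
        \<open>w\<close>, and back. It shows that \<open>f\<close> and the local primitive
        \<open>F\<close> differ by a constant.\<close>
      have "contour_integral (p z +++ ?l +++ reversepath (p w)) \<phi> = 0"
        using p[OF z] p[OF wD] b segD by (intro loop) (auto simp: valid_path_join path_image_join)
      moreover have "contour_integral (p z +++ ?l +++ reversepath (p w)) \<phi> =
          contour_integral (p z) \<phi> + (contour_integral ?l \<phi> - contour_integral (p w) \<phi>)"
        using p[OF z] p[OF wD] int segD
        by (simp add: contour_integral_join contour_integral_reversepath contour_integrable_reversepath
            contour_integrable_joinI valid_path_join)
      moreover have "contour_integral ?l \<phi> = F w - F z"
      proof (rule contour_integral_unique)
        have "(\<phi> has_contour_integral F (pathfinish ?l) - F (pathstart ?l)) ?l"
          by (rule contour_integral_primitive[OF F]) (use seg in auto)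
        then show "(\<phi> has_contour_integral F w - F z) ?l" by simp
      qed
      ultimately show ?thesis by (simp add: f_def b algebra_simps)
    qed
    have "(F has_field_derivative \<phi> z) (at z)"
      using F[of z] r(1) at_within_open[OF _ open_ball, of z z r] by simp
    then have "((\<lambda>w. f z - F z + F w) has_field_derivative 0 + \<phi> z) (at z)"
      by (intro DERIV_add DERIV_const)
    then show "(f has_field_derivative \<phi> z) (at z)"
      using has_field_derivative_transform_within_open[OF _ open_ball, of "\<lambda>w. f z - F z + F w" "\<phi> z" z z r f] r(1) eq
      by simp
  qed
  then show ?thesis by blast
qed

lemma path_image_translate: "path_image (\<lambda>t. \<gamma> t + c) = (\<lambda>z. z + c) ` path_image \<gamma>"
  by (auto simp: path_image_def)

text \<open>Sufficiently close loops have equal integrals, and polynomial loops approximate any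
  closed path. This extends the grid argument, which covers polynomial loops only.\<close>

lemma contour_integral_zero_if_polynomial_loops:
  assumes D: "open D" "f holomorphic_on D"
    and zero: "\<And>p. \<lbrakk>polynomial_function p; path_image p \<subseteq> D; pathfinish p = pathstart p\<rbrakk> \<Longrightarrow> contour_integral p f = 0"
    and \<gamma>: "valid_path \<gamma>" "path_image \<gamma> \<subseteq> D" "pathfinish \<gamma> = pathstart \<gamma>"
  shows "contour_integral \<gamma> f = 0"
proof -
  obtain d where d: "d > 0" "\<And>g h. \<lbrakk>valid_path g; valid_path h;
      \<And>t. t \<in> {0..1} \<Longrightarrow> norm (g t - \<gamma> t) < d \<and> norm (h t - \<gamma> t) < d;
      pathfinish g = pathstart g; pathfinish h = pathstart h\<rbrakk>
     \<Longrightarrow> path_image g \<subseteq> D \<and> path_image h \<subseteq> D \<and> (\<forall>f. f holomorphic_on D \<longrightarrow> contour_integral h f = contour_integral g f)"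
    using contour_integral_nearby_loops[OF D(1) valid_path_imp_path[OF \<gamma>(1)] \<gamma>(2)] by metis
  obtain p where p: "polynomial_function p" "pathstart p = pathstart \<gamma>" "pathfinish p = pathfinish \<gamma>"
      "\<And>t. t \<in> {0..1} \<Longrightarrow> norm (p t - \<gamma> t) < d"
    using path_approx_polynomial_function[OF valid_path_imp_path[OF \<gamma>(1)] d(1)] by metis
  have "path_image p \<subseteq> D \<and> path_image \<gamma> \<subseteq> D \<and> (\<forall>f. f holomorphic_on D \<longrightarrow> contour_integral \<gamma> f = contour_integral p f)"
    by (rule d(2)) (use p \<gamma> d(1) in \<open>auto simp: valid_path_polynomial_function\<close>)
  then show ?thesis using zero[OF p(1)] p(2,3) \<gamma>(3) D(2) by simp
qed

section \<open>Translates of zeta and sigma, and the real charges\<close>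

context period_pair
begin

lemma wsum_eq: "wsum \<gamma> a = (\<Sum>\<^sub>\<infinity>l\<in>L. winding_number (\<lambda>t. \<gamma> t + - a) l)"
proof -
  have "winding_number \<gamma> (a + l) = winding_number (\<lambda>t. \<gamma> t + - a) l" for l
    using winding_number_offset[of \<gamma> "a + l"] winding_number_offset[of "\<lambda>t. \<gamma> t + - a" l]
    by (simp add: algebra_simps)
  then show ?thesis by (simp add: wsum_def)
qed

lemma avoid_translate:
  assumes "\<And>l. l \<in> L \<Longrightarrow> a + l \<notin> path_image \<gamma>"
  shows "path_image (\<lambda>t. \<gamma> t + - a) \<inter> L = {}"
  using assms unfolding path_image_translate by (force simp: algebra_simps)

lemma zeta_closed_contour_translate:
  assumes \<gamma>: "valid_path \<gamma>" "pathfinish \<gamma> = pathstart \<gamma>" "\<And>l. l \<in> L \<Longrightarrow> a + l \<notin> path_image \<gamma>"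
  shows "contour_integral \<gamma> (\<lambda>z. \<zeta> (z - a)) = 2 * pi * \<i> * wsum \<gamma> a" and "wsum \<gamma> a \<in> \<int>"
proof -
  have "pathfinish (\<lambda>t. \<gamma> t + - a) = pathstart (\<lambda>t. \<gamma> t + - a)"
    using \<gamma>(2) by (simp add: pathfinish_def pathstart_def)
  note zeta_closed_contour[OF valid_path_translate[OF \<gamma>(1)] this avoid_translate[OF \<gamma>(3)]]
  moreover have "contour_integral \<gamma> (\<lambda>z. \<zeta> (z - a)) = contour_integral (\<lambda>t. \<gamma> t + - a) \<zeta>"
    using contour_integral_translate[of \<gamma> \<zeta> "- a"] by simp
  ultimately show "contour_integral \<gamma> (\<lambda>z. \<zeta> (z - a)) = 2 * pi * \<i> * wsum \<gamma> a" "wsum \<gamma> a \<in> \<int>"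
    by (simp_all only: wsum_eq)
qed

lemma ln_sigma_path_translate:
  assumes "valid_path \<gamma>" "\<And>l. l \<in> L \<Longrightarrow> a + l \<notin> path_image \<gamma>"
  shows "ln (cmod (\<sigma> (pathfinish \<gamma> - a))) - ln (cmod (\<sigma> (pathstart \<gamma> - a))) = Re (contour_integral \<gamma> (\<lambda>z. \<zeta> (z - a)))"
  using ln_sigma_path[OF valid_path_translate[OF assms(1)] avoid_translate[OF assms(2)]]
    contour_integral_translate[of \<gamma> \<zeta> "- a"]
  by (simp add: pathfinish_def pathstart_def)

lemma zeta_translate_holomorphic:
  assumes "\<And>z l. z \<in> D \<Longrightarrow> l \<in> L \<Longrightarrow> z \<noteq> a + l"
  shows "(\<lambda>z. \<zeta> (z - a)) holomorphic_on D"
proof -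
  have "(\<zeta> \<circ> (\<lambda>z. z - a)) holomorphic_on D"
  proof (rule holomorphic_on_compose_gen[OF _ zeta_holomorphic])
    show "(\<lambda>z. z - a) ` D \<subseteq> - L"
      using assms by (force simp: algebra_simps)
  qed (intro holomorphic_intros)
  then show ?thesis by (simp add: o_def)
qed

text \<open>Since the charges sum to zero, the quadratic terms of the modified sigma functions cancel up
  to the real part of an affine function.\<close>

lemma sum_ln_modified_sigma:
  assumes c: "(\<Sum>j\<in>J. c j) = 0"
  obtains \<kappa> k where "\<And>z. (\<And>j. j \<in> J \<Longrightarrow> z - a j \<notin> L) \<Longrightarrow>
    (\<Sum>j\<in>J. c j * ln (cmod (modified_sigma \<omega>\<^sub>1 \<omega>\<^sub>2 (z - a j)))) =
    (\<Sum>j\<in>J. c j * ln (cmod (\<sigma> (z - a j)))) + Re (\<kappa> * z) + k"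
proof
  define G where "G = gamma2 \<omega>\<^sub>1 \<omega>\<^sub>2"
  define q where "q = pi / (2 * torus_area \<omega>\<^sub>1 \<omega>\<^sub>2)"
  define S where "S = (\<Sum>j\<in>J. of_real (c j) * a j)"
  define k where "k = - (\<Sum>j\<in>J. c j * Re (G / 2 * (a j)\<^sup>2)) - q * (\<Sum>j\<in>J. c j * (cmod (a j))\<^sup>2)"
  fix z assume z: "\<And>j. j \<in> J \<Longrightarrow> z - a j \<notin> L"
  \<comment> \<open>Sorted by the dependence on \<open>z\<close>: the quadratic part depends on
    \<open>j\<close> only through \<open>c j\<close> and cancels in the sum, the cross terms are
    real-linear in \<open>z\<close>, and the rest is constant.\<close>
  have term_eq: "c j * ln (cmod (modified_sigma \<omega>\<^sub>1 \<omega>\<^sub>2 (z - a j))) =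
      c j * ln (cmod (\<sigma> (z - a j))) + c j * (- Re (G / 2 * z\<^sup>2) - q * (cmod z)\<^sup>2)
      + Re (G * (of_real (c j) * a j) * z) + 2 * q * Re (cnj (of_real (c j) * a j) * z)
      + (- (c j * Re (G / 2 * (a j)\<^sup>2)) - q * (c j * (cmod (a j))\<^sup>2))" if j: "j \<in> J" for j
  proof -
    have 1: "ln (cmod (modified_sigma \<omega>\<^sub>1 \<omega>\<^sub>2 (z - a j))) = ln (cmod (\<sigma> (z - a j)))
      - Re (G / 2 * (z - a j)\<^sup>2) - q * (cmod (z - a j))\<^sup>2"
      using ln_modified_sigma[OF z[OF j]] by (simp add: G_def q_def)
    have 2: "G / 2 * (z - a j)\<^sup>2 = G / 2 * z\<^sup>2 - G * a j * z + G / 2 * (a j)\<^sup>2"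
      by (simp add: power2_eq_square algebra_simps)
    have 3: "(cmod (z - a j))\<^sup>2 = (cmod z)\<^sup>2 - 2 * Re (cnj (a j) * z) + (cmod (a j))\<^sup>2"
      unfolding cmod_power2 by (simp add: power2_eq_square algebra_simps)
    have 4: "Re (G * (of_real (c j) * a j) * z) = c j * Re (G * a j * z)"
      "Re (cnj (of_real (c j) * a j) * z) = c j * Re (cnj (a j) * z)"
      by (simp_all add: algebra_simps)
    show ?thesis unfolding 1 2 3 4 minus_complex.sel plus_complex.sel
      by (simp only: ring_distribs) (simp only: algebra_simps)
  qed
  have S1: "(\<Sum>j\<in>J. Re (G * (of_real (c j) * a j) * z)) = Re (G * S * z)"
    by (simp only: S_def sum_distrib_left sum_distrib_right Re_sum)
  have S2: "(\<Sum>j\<in>J. 2 * q * Re (cnj (of_real (c j) * a j) * z)) = 2 * q * Re (cnj S * z)"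
    by (simp only: S_def cnj_sum sum_distrib_left sum_distrib_right Re_sum)
  have S3: "(\<Sum>j\<in>J. c j * (- Re (G / 2 * z\<^sup>2) - q * (cmod z)\<^sup>2)) = 0"
    by (simp only: sum_distrib_right[symmetric] c mult_zero_left)
  have S4: "(\<Sum>j\<in>J. - (c j * Re (G / 2 * (a j)\<^sup>2)) - q * (c j * (cmod (a j))\<^sup>2)) = k"
    by (simp only: k_def sum_subtractf sum_negf sum_distrib_left)
  have S5: "Re ((G * S + 2 * of_real q * cnj S) * z) = Re (G * S * z) + 2 * q * Re (cnj S * z)"
    by (simp add: algebra_simps)
  show "(\<Sum>j\<in>J. c j * ln (cmod (modified_sigma \<omega>\<^sub>1 \<omega>\<^sub>2 (z - a j)))) =
    (\<Sum>j\<in>J. c j * ln (cmod (\<sigma> (z - a j)))) + Re ((G * S + 2 * of_real q * cnj S) * z) + k"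
    unfolding S5 S1[symmetric] S2[symmetric] S4[symmetric]
    using S3 by (simp only: term_eq sum.distrib cong: sum.cong)
qed

text \<open>One equation for each polynomial loop and one for the vanishing sum, in \<open>b\<close>
  real unknowns. Real parts of the complex charges solve each finite subsystem, because
  \<open>wsum\<close> is an integer at each \<open>a j\<close> and the imaginary periods of
  \<open>g\<close> become real after division by 2 pi i.\<close>

lemma real_charges:
  fixes b :: nat
  assumes D: "open D" "g holomorphic_on D"
    and perD: "\<And>z l. l \<in> L \<Longrightarrow> z + l \<in> D \<longleftrightarrow> z \<in> D"
    and perg: "\<And>z l. l \<in> L \<Longrightarrow> z \<in> D \<Longrightarrow> g (z + l) = g z"
    and real: "\<And>\<gamma>. \<lbrakk>valid_path \<gamma>; path_image \<gamma> \<subseteq> D; pathfinish \<gamma> = pathstart \<gamma>\<rbrakk> \<Longrightarrow> Re (contour_integral \<gamma> g) = 0"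
    and E: "\<And>z. z \<notin> D \<longleftrightarrow> (\<exists>j\<in>{1..b}. torus_proj \<omega>\<^sub>1 \<omega>\<^sub>2 z \<in> K j)"
    and K: "\<And>j. j \<in> {1..b} \<Longrightarrow> connectedin (torus \<omega>\<^sub>1 \<omega>\<^sub>2) (K j)"
    and a: "\<And>j. j \<in> {1..b} \<Longrightarrow> torus_proj \<omega>\<^sub>1 \<omega>\<^sub>2 (a j) \<in> K j"
  obtains c :: "nat \<Rightarrow> real" where "(\<Sum>j=1..b. c j) = 0"
    "\<And>\<gamma>. \<lbrakk>polynomial_function \<gamma>; path_image \<gamma> \<subseteq> D; pathfinish \<gamma> = pathstart \<gamma>\<rbrakk> \<Longrightarrow>
       contour_integral \<gamma> g = 2 * pi * \<i> * (\<Sum>j=1..b. of_real (c j) * wsum \<gamma> (a j))"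
proof -
  define A where "A = {\<gamma>. polynomial_function \<gamma> \<and> path_image \<gamma> \<subseteq> D \<and> pathfinish \<gamma> = pathstart \<gamma>}"
  have A: "polynomial_function \<gamma>" "path_image \<gamma> \<subseteq> D" "pathfinish \<gamma> = pathstart \<gamma>" "valid_path \<gamma>" if "\<gamma> \<in> A" for \<gamma>
    using that by (auto simp: A_def valid_path_polynomial_function)
  have aD: "a j + l \<notin> D" if "j \<in> {1..b}" "l \<in> L" for j l
    using a[OF that(1)] E that perD by blast
  have wreal: "Im (wsum \<gamma> (a j)) = 0" if "\<gamma> \<in> A" "j \<in> {1..b}" for \<gamma> j
  proof -
    have "wsum \<gamma> (a j) \<in> \<int>"
      using A[OF that(1)] aD[OF that(2)] by (intro zeta_closed_contour_translate(2)) auto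
    then show ?thesis by (auto elim: Ints_cases)
  qed
  have const: "wsum \<gamma> z = wsum \<gamma> (a j)" if "\<gamma> \<in> A" "j \<in> {1..b}" "torus_proj \<omega>\<^sub>1 \<omega>\<^sub>2 z \<in> K j" for \<gamma> j z
  proof (rule wsum_constant_on_connected[OF K[OF that(2)]])
    show "torus_proj \<omega>\<^sub>1 \<omega>\<^sub>2 w \<notin> K j" if "w \<in> path_image \<gamma>" for w
      using that A(2)[OF \<open>\<gamma> \<in> A\<close>] E[of w] \<open>j \<in> {1..b}\<close> by blast
  qed (use that A[OF that(1)] a in \<open>auto simp: path_polynomial_function\<close>)
  \<comment> \<open>\<open>None\<close> indexes the equation for the vanishing sum,
    \<open>Some \<gamma>\<close> the equation for the period over \<open>\<gamma>\<close>.\<close>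
  define m where "m i j = (case i of None \<Rightarrow> 1 | Some \<gamma> \<Rightarrow> Re (wsum \<gamma> (a j)))" for i :: "(real \<Rightarrow> complex) option" and j
  define t where "t i = (case i of None \<Rightarrow> 0 | Some \<gamma> \<Rightarrow> Re (contour_integral \<gamma> g / (2 * pi * \<i>)))" for i :: "(real \<Rightarrow> complex) option"
  have "\<exists>c. \<forall>i\<in>insert None (Some ` A). (\<Sum>j=1..b. c j * m i j) = t i"
  proof (rule finitely_solvable_imp_solvable)
    fix F assume F: "finite F" "F \<subseteq> insert None (Some ` A)"
    define F' where "F' = {\<gamma>. Some \<gamma> \<in> F}"
    have "finite (Some -` F)" by (intro finite_vimageI F) auto
    then have F': "finite F'" "F' \<subseteq> A" using F by (auto simp: F'_def vimage_def)
    have "\<exists>c. (\<Sum>j\<in>{1..b}. c j) = 0 \<and>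
       (\<forall>\<gamma>\<in>F'. contour_integral \<gamma> g = 2 * pi * \<i> * (\<Sum>j\<in>{1..b}. c j * wsum \<gamma> (a j)))"
    proof (rule finite_charges[OF D perD perg F'(1), where E = "\<lambda>j. torus_proj \<omega>\<^sub>1 \<omega>\<^sub>2 -` K j"])
      show "\<exists>j\<in>{1..b}. z \<in> torus_proj \<omega>\<^sub>1 \<omega>\<^sub>2 -` K j" if "z \<notin> D" for z
        using that E by auto
      show "wsum \<gamma> z = wsum \<gamma> (a j)" if "\<gamma> \<in> F'" "j \<in> {1..b}" "z \<in> torus_proj \<omega>\<^sub>1 \<omega>\<^sub>2 -` K j" for \<gamma> j z
        using that F' const by blast
      show "path_image \<gamma> \<subseteq> D" if "\<gamma> \<in> F'" for \<gamma>
        using A(2) F'(2) that by blast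
    qed (use A F' in auto)
    then obtain c where c: "(\<Sum>j\<in>{1..b}. c j) = 0"
      "\<And>\<gamma>. \<gamma> \<in> F' \<Longrightarrow> contour_integral \<gamma> g = 2 * pi * \<i> * (\<Sum>j\<in>{1..b}. c j * wsum \<gamma> (a j))" by blast
    have "(\<Sum>j=1..b. Re (c j) * m i j) = t i" if "i \<in> F" for i
    proof (cases i)
      case None
      then show ?thesis using c(1) by (simp add: m_def t_def flip: Re_sum)
    next
      case (Some \<gamma>)
      then have \<gamma>: "\<gamma> \<in> F'" using that by (simp add: F'_def)
      then have "contour_integral \<gamma> g / (2 * pi * \<i>) = (\<Sum>j=1..b. c j * wsum \<gamma> (a j))"
        using c(2)[OF \<gamma>] by simp
      then have "t i = (\<Sum>j=1..b. Re (c j * wsum \<gamma> (a j)))" by (simp add: t_def Some)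
      also have "\<dots> = (\<Sum>j=1..b. Re (c j) * m i j)"
        using wreal[of \<gamma>] \<gamma> F' by (intro sum.cong refl) (auto simp: m_def Some)
      finally show ?thesis by simp
    qed
    then show "\<exists>c. \<forall>i\<in>F. (\<Sum>j=1..b. c j * m i j) = t i" by (intro exI[of _ "\<lambda>j. Re (c j)"]) auto
  qed
  then obtain c where c: "\<And>i. i \<in> insert None (Some ` A) \<Longrightarrow> (\<Sum>j=1..b. c j * m i j) = t i" by blast
  show ?thesis
  proof (rule that)
    show "(\<Sum>j=1..b. c j) = 0" using c[of None] by (simp add: m_def t_def)
    fix \<gamma> assume "polynomial_function \<gamma>" "path_image \<gamma> \<subseteq> D" "pathfinish \<gamma> = pathstart \<gamma>"
    then have \<gamma>: "\<gamma> \<in> A" by (simp add: A_def)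
    have "(\<Sum>j=1..b. of_real (c j) * wsum \<gamma> (a j)) = (\<Sum>j=1..b. of_real (c j * m (Some \<gamma>) j))"
      using wreal[OF \<gamma>] by (intro sum.cong refl) (auto simp: m_def complex_eq_iff)
    also have "\<dots> = of_real (t (Some \<gamma>))"
      using c[of "Some \<gamma>", symmetric] \<gamma> by simp
    also have "\<dots> = contour_integral \<gamma> g / (2 * pi * \<i>)"
    proof -
      have "contour_integral \<gamma> g = \<i> * of_real (Im (contour_integral \<gamma> g))"
        using real[of \<gamma>] A[OF \<gamma>] by (simp add: complex_eq_iff)
      then obtain x where "contour_integral \<gamma> g = \<i> * of_real x" by blast
      then have "contour_integral \<gamma> g / (2 * pi * \<i>) = of_real (x / (2 * pi))" by simp
      then show ?thesis by (simp only: t_def option.case Re_complex_of_real)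
    qed
    finally show "contour_integral \<gamma> g = 2 * pi * \<i> * (\<Sum>j=1..b. of_real (c j) * wsum \<gamma> (a j))"
      by simp
  qed
qed

end

section \<open>Logarithmic decomposition of harmonic functions on a torus with holes\<close>

theorem theorem1p1:
  fixes \<omega>\<^sub>1 \<omega>\<^sub>2 :: complex
    and b :: nat
    and K :: "nat \<Rightarrow> complex set set"
    and \<Omega> :: "complex set set"
    and P :: "complex set"
    and a :: "nat \<Rightarrow> complex"
    and u :: "complex set \<Rightarrow> real"
  assumes "\<not> collinear {0, \<omega>\<^sub>1, \<omega>\<^sub>2}"
    and "b \<ge> 1"
    and "disjoint_family_on K {1..b}"
    and "\<And>j. j \<in> {1..b} \<Longrightarrow> compactin (torus \<omega>\<^sub>1 \<omega>\<^sub>2) (K j)"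
    and "\<And>j. j \<in> {1..b} \<Longrightarrow> connectedin (torus \<omega>\<^sub>1 \<omega>\<^sub>2) (K j)"
    and "\<And>j. j \<in> {1..b} \<Longrightarrow> torus_smooth_boundary \<omega>\<^sub>1 \<omega>\<^sub>2 (K j)"
    and "\<Omega> = topspace (torus \<omega>\<^sub>1 \<omega>\<^sub>2) - (\<Union>j\<in>{1..b}. K j)"
    and "P = parallelogram \<omega>\<^sub>1 \<omega>\<^sub>2 - torus_proj \<omega>\<^sub>1 \<omega>\<^sub>2 -` (\<Union>j\<in>{1..b}. K j)"
    and "\<And>j. j \<in> {1..b} \<Longrightarrow> torus_proj \<omega>\<^sub>1 \<omega>\<^sub>2 (a j) \<in> K j"
    and "torus_harmonic_on \<omega>\<^sub>1 \<omega>\<^sub>2 u \<Omega>"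
  shows "\<exists>(f :: complex \<Rightarrow> complex) (c :: nat \<Rightarrow> real).
           f analytic_on P \<and>
           f analytic_on (torus_proj \<omega>\<^sub>1 \<omega>\<^sub>2 -` \<Omega>) \<and>
           elliptic_on \<omega>\<^sub>1 \<omega>\<^sub>2 (deriv f) (torus_proj \<omega>\<^sub>1 \<omega>\<^sub>2 -` \<Omega>) \<and>
           (\<Sum>j=1..b. c j) = 0 \<and>
           (\<forall>z. torus_proj \<omega>\<^sub>1 \<omega>\<^sub>2 z \<in> \<Omega> \<longrightarrow>
              u (torus_proj \<omega>\<^sub>1 \<omega>\<^sub>2 z) =
                Re (f z) + (\<Sum>j=1..b. c j * ln (cmod (modified_sigma \<omega>\<^sub>1 \<omega>\<^sub>2 (z - a j))))) \<and>
           (b = 1 \<longrightarrow> c 1 = 0 \<and>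
              (\<forall>z. torus_proj \<omega>\<^sub>1 \<omega>\<^sub>2 z \<in> \<Omega> \<longrightarrow>
                 u (torus_proj \<omega>\<^sub>1 \<omega>\<^sub>2 z) = Re (f z)))"
proof -
  interpret period_pair \<omega>\<^sub>1 \<omega>\<^sub>2 by unfold_locales (rule assms(1))
  define D where "D = torus_proj \<omega>\<^sub>1 \<omega>\<^sub>2 -` \<Omega>"
  define U where "U = u \<circ> torus_proj \<omega>\<^sub>1 \<omega>\<^sub>2"
  define g where "g = wirtinger_deriv U"
  let ?J = "{1..b}"
  have harm: "harmonic_on U D"
    using assms(10) by (simp add: torus_harmonic_on_def U_def D_def)
  then have D: "open D" by (simp add: harmonic_on_def)
  have E: "z \<notin> D \<longleftrightarrow> (\<exists>j\<in>?J. torus_proj \<omega>\<^sub>1 \<omega>\<^sub>2 z \<in> K j)" for z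
    by (auto simp: D_def assms(7) topspace_torus)
  have perD: "z + l \<in> D \<longleftrightarrow> z \<in> D" if "l \<in> L" for z l
    using that by (simp add: D_def torus_proj_translate)
  have perU: "U (z + l) = U z" if "l \<in> L" for z l
    using that by (simp add: U_def torus_proj_translate)
  have perg: "g (z + l) = g z" if "l \<in> L" for z l
  proof -
    have "U (z + l + s) = U (z + s)" for s
      using perU[OF that, of "z + s"] by (simp add: add_ac)
    then show ?thesis by (simp add: g_def wirtinger_deriv_def partial_x_def partial_y_def)
  qed
  have g: "g holomorphic_on D" unfolding g_def by (rule harmonic_on_imp_holomorphic[OF harm])
  have Re_g: "Re (contour_integral \<gamma> g) = U (pathfinish \<gamma>) - U (pathstart \<gamma>)" if "valid_path \<gamma>" "path_image \<gamma> \<subseteq> D" for \<gamma>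
    unfolding g_def by (rule harmonic_on_contour_integral[OF harm that])
  obtain c where c0: "(\<Sum>j=1..b. c j) = 0"
    and c: "\<And>\<gamma>. \<lbrakk>polynomial_function \<gamma>; path_image \<gamma> \<subseteq> D; pathfinish \<gamma> = pathstart \<gamma>\<rbrakk> \<Longrightarrow>
       contour_integral \<gamma> g = 2 * pi * \<i> * (\<Sum>j=1..b. of_real (c j) * wsum \<gamma> (a j))"
  proof (rule real_charges[OF D g perD perg _ E assms(5) assms(9)])
    show "Re (contour_integral \<gamma> g) = 0" if "valid_path \<gamma>" "path_image \<gamma> \<subseteq> D" "pathfinish \<gamma> = pathstart \<gamma>" for \<gamma>
      using Re_g[OF that(1,2)] that(3) by simp
  qed auto
  obtain \<kappa> k where \<kappa>: "\<And>z. (\<And>j. j \<in> ?J \<Longrightarrow> z - a j \<notin> L) \<Longrightarrow>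
    (\<Sum>j\<in>?J. c j * ln (cmod (modified_sigma \<omega>\<^sub>1 \<omega>\<^sub>2 (z - a j)))) =
    (\<Sum>j\<in>?J. c j * ln (cmod (\<sigma> (z - a j)))) + Re (\<kappa> * z) + k"
    using sum_ln_modified_sigma[OF c0] by blast
  have aD: "a j + l \<notin> D" if "j \<in> ?J" "l \<in> L" for j l
    using assms(9)[OF that(1)] E that perD by blast
  have zaL: "z - a j \<notin> L" if "z \<in> D" "j \<in> ?J" for z j
    using aD[OF that(2), of "z - a j"] that(1) by auto
  define \<psi> where "\<psi> z = g z - (\<Sum>j=1..b. of_real (c j) * \<zeta> (z - a j))" for z
  have \<zeta>hol: "(\<lambda>z. \<zeta> (z - a j)) holomorphic_on D" if "j \<in> ?J" for j
    using aD[OF that] by (intro zeta_translate_holomorphic) auto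
  have \<psi>hol: "\<psi> holomorphic_on D"
    unfolding \<psi>_def[abs_def] by (intro holomorphic_intros g \<zeta>hol)
  have \<psi>int: "contour_integral \<gamma> \<psi> = contour_integral \<gamma> g - (\<Sum>j=1..b. of_real (c j) * contour_integral \<gamma> (\<lambda>z. \<zeta> (z - a j)))"
    if \<gamma>: "valid_path \<gamma>" "path_image \<gamma> \<subseteq> D" for \<gamma>
  proof -
    have "(g has_contour_integral contour_integral \<gamma> g) \<gamma>"
      by (intro has_contour_integral_integral contour_integrable_holomorphic_simple[OF g D \<gamma>])
    moreover have "((\<lambda>z. \<Sum>j=1..b. of_real (c j) * \<zeta> (z - a j)) has_contour_integral
        (\<Sum>j=1..b. of_real (c j) * contour_integral \<gamma> (\<lambda>z. \<zeta> (z - a j)))) \<gamma>"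
      by (intro has_contour_integral_sum has_contour_integral_lmul has_contour_integral_integral
          contour_integrable_holomorphic_simple[OF \<zeta>hol D \<gamma>]) auto
    ultimately show ?thesis
      unfolding \<psi>_def[abs_def] by (intro contour_integral_unique has_contour_integral_diff)
  qed
  have \<psi>loop: "contour_integral \<gamma> \<psi> = 0" if \<gamma>: "valid_path \<gamma>" "path_image \<gamma> \<subseteq> D" "pathfinish \<gamma> = pathstart \<gamma>" for \<gamma>
  proof (rule contour_integral_zero_if_polynomial_loops[OF D \<psi>hol _ \<gamma>])
    fix p assume p: "polynomial_function p" "path_image p \<subseteq> D" "pathfinish p = pathstart p"
    have vp: "valid_path p" using p(1) by (rule valid_path_polynomial_function)
    have "contour_integral p (\<lambda>z. \<zeta> (z - a j)) = 2 * pi * \<i> * wsum p (a j)" if "j \<in> ?J" for j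
      using aD[OF that] p(2) by (intro zeta_closed_contour_translate(1) vp p) auto
    then show "contour_integral p \<psi> = 0"
      unfolding \<psi>int[OF vp p(2)] c[OF p] by (simp add: sum_distrib_left mult_ac)
  qed
  \<comment> \<open>\<open>\<kappa>\<close> is the linear coefficient by which the sum with \<sigma>
    and the sum with the modified \<sigma> differ; the additive constant \<open>k\<close> drops out
    of differences between endpoints.\<close>
  define \<phi> where "\<phi> z = \<psi> z - \<kappa>" for z
  define v where "v z = U z - (\<Sum>j=1..b. c j * ln (cmod (modified_sigma \<omega>\<^sub>1 \<omega>\<^sub>2 (z - a j))))" for z
  have \<phi>int: "contour_integral \<gamma> \<phi> = contour_integral \<gamma> \<psi> - \<kappa> * (pathfinish \<gamma> - pathstart \<gamma>)"
    if \<gamma>: "valid_path \<gamma>" "path_image \<gamma> \<subseteq> D" for \<gamma>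
  proof -
    have "((\<lambda>z. \<kappa>) has_contour_integral \<kappa> * pathfinish \<gamma> - \<kappa> * pathstart \<gamma>) \<gamma>"
      by (rule contour_integral_primitive[where S = UNIV and f = "\<lambda>z. \<kappa> * z"]) (use \<gamma> in \<open>auto intro!: derivative_eq_intros\<close>)
    moreover have "(\<psi> has_contour_integral contour_integral \<gamma> \<psi>) \<gamma>"
      by (intro has_contour_integral_integral contour_integrable_holomorphic_simple[OF \<psi>hol D \<gamma>])
    ultimately show ?thesis
      unfolding \<phi>_def[abs_def] right_diff_distrib by (intro contour_integral_unique has_contour_integral_diff)
  qed
  have \<phi>hol: "\<phi> holomorphic_on D"
    unfolding \<phi>_def[abs_def] by (intro holomorphic_intros \<psi>hol)
  have "\<exists>f. \<forall>z\<in>D. (f has_field_derivative \<phi> z) (at z) \<and> Re (f z) = v z"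
  proof (rule primitive_of_vanishing_periods[OF D \<phi>hol])
    show "contour_integral \<gamma> \<phi> = 0" if "valid_path \<gamma>" "path_image \<gamma> \<subseteq> D" "pathfinish \<gamma> = pathstart \<gamma>" for \<gamma>
      using \<phi>int[OF that(1,2)] \<psi>loop[OF that] that(3) by simp
    show "Re (contour_integral \<gamma> \<phi>) = v (pathfinish \<gamma>) - v (pathstart \<gamma>)" if \<gamma>: "valid_path \<gamma>" "path_image \<gamma> \<subseteq> D" for \<gamma>
    proof -
      have ends: "pathfinish \<gamma> \<in> D" "pathstart \<gamma> \<in> D" using \<gamma>(2) by auto
      have "Re (contour_integral \<gamma> (\<lambda>z. \<zeta> (z - a j))) =
          ln (cmod (\<sigma> (pathfinish \<gamma> - a j))) - ln (cmod (\<sigma> (pathstart \<gamma> - a j)))" if "j \<in> ?J" for j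
        using aD[OF that] \<gamma>(2) by (intro ln_sigma_path_translate[symmetric] \<gamma>(1)) auto
      then have "Re (\<Sum>j=1..b. of_real (c j) * contour_integral \<gamma> (\<lambda>z. \<zeta> (z - a j))) =
          (\<Sum>j=1..b. c j * ln (cmod (\<sigma> (pathfinish \<gamma> - a j)))) - (\<Sum>j=1..b. c j * ln (cmod (\<sigma> (pathstart \<gamma> - a j))))"
        by (simp add: right_diff_distrib sum_subtractf)
      then show ?thesis
        using \<kappa>[OF zaL[OF ends(1)]] \<kappa>[OF zaL[OF ends(2)]] unfolding \<phi>int[OF \<gamma>] \<psi>int[OF \<gamma>]
        by (simp add: v_def Re_g[OF \<gamma>] right_diff_distrib del: Re_sum)
    qed
  qed
  then obtain f where f: "\<And>z. z \<in> D \<Longrightarrow> (f has_field_derivative \<phi> z) (at z)" "\<And>z. z \<in> D \<Longrightarrow> Re (f z) = v z"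
    by blast
  have fD: "f analytic_on D"
    using f(1) by (auto simp: analytic_on_open[OF D] holomorphic_on_open[OF D])
  have deriv: "deriv f z = \<phi> z" if "z \<in> D" for z
    using f(1)[OF that] by (rule DERIV_imp_deriv)
  \<comment> \<open>Every \<zeta> changes by the same \<eta> under the period, so the total change
    is \<eta> times the sum of the charges, which is zero.\<close>
  have per: "\<phi> (z + 2 * \<omega>) = \<phi> z" if z: "z \<in> D" and \<omega>: "\<omega> \<in> {\<omega>\<^sub>1, \<omega>\<^sub>2}" for z \<omega>
  proof -
    obtain \<eta> where \<eta>: "\<And>z. z \<notin> L \<Longrightarrow> \<zeta> (z + 2 * \<omega>) = \<zeta> z + \<eta>"
      using zeta_quasi_periodic[OF \<omega>] by blast
    have "(\<Sum>j=1..b. of_real (c j) * \<zeta> (z + 2 * \<omega> - a j)) = (\<Sum>j=1..b. of_real (c j) * \<zeta> (z - a j) + of_real (c j) * \<eta>)"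
      using \<eta>[OF zaL[OF z]] by (intro sum.cong refl) (simp add: algebra_simps)
    also have "\<dots> = (\<Sum>j=1..b. of_real (c j) * \<zeta> (z - a j)) + of_real (\<Sum>j=1..b. c j) * \<eta>"
      by (simp add: sum.distrib sum_distrib_right)
    finally have "(\<Sum>j=1..b. of_real (c j) * \<zeta> (z + 2 * \<omega> - a j)) = (\<Sum>j=1..b. of_real (c j) * \<zeta> (z - a j))"
      unfolding c0 by simp
    moreover have "2 * \<omega> \<in> L" using \<omega> periods_in_lattice by auto
    ultimately show ?thesis by (simp add: \<phi>_def \<psi>_def perg)
  qed
  have ell: "elliptic_on \<omega>\<^sub>1 \<omega>\<^sub>2 (deriv f) D"
    unfolding elliptic_on_def doubly_periodic_on_def
    using analytic_on_imp_meromorphic_on[OF analytic_deriv[OF fD]] per deriv perD periods_in_lattice by auto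
  have rep: "u (torus_proj \<omega>\<^sub>1 \<omega>\<^sub>2 z) = Re (f z) + (\<Sum>j=1..b. c j * ln (cmod (modified_sigma \<omega>\<^sub>1 \<omega>\<^sub>2 (z - a j))))"
    if "torus_proj \<omega>\<^sub>1 \<omega>\<^sub>2 z \<in> \<Omega>" for z
    using f(2)[of z] that by (simp add: D_def v_def U_def)
  have "P \<subseteq> D" using E by (auto simp: assms(8))
  then have "f analytic_on P" using fD analytic_on_subset by blast
  \<comment> \<open>With a single hole the vanishing sum is \<open>c 1\<close> alone, and the
    logarithmic term disappears.\<close>
  moreover have "c 1 = 0" if "b = 1" using c0 that by simp
  ultimately show ?thesis
    using fD ell c0 rep unfolding D_def by (intro exI[of _ f] exI[of _ c]) auto
qed

end
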